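(* Let $n,l\in\mathbb N$, $1<p_1,\dots,p_l<\infty$, $\frac1p=\frac1{p_1}+\cdots+\frac1{p_l}$, $1<u<\infty$ with $\frac1u+\frac1{u'}=1$, and $0<s<\infty$. Suppose that $$\|T_m(f_1,\dots,f_l)\|_{L^p(\mathbb R^n)}\lesssim\mathcal A^u_s[m]\prod_{i=1}^l\|f_i\|_{L^{p_i}(\mathbb R^n)}$$ for all $m$ with $\mathcal A^u_s[m]<\infty$ and all Schwartz $f_i$ on $\mathbb R^n$. Then necessarily $$\frac sn\ge\max\Big\{\frac lu,\ \max_I\Big(\frac1p-\frac12-\sum_{i\in I}\big(\tfrac1{p_i}-\tfrac12\big)\Big),\ \max_I\Big(\frac1p-\frac1{u'}-\sum_{i\in I}\big(\tfrac1{p_i}-\tfrac1u\big)\Big)\Big\},$$ where the maxima run over all subsets $I\subseteq\{1,\dots,l\}$.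
   Context: For bounded $m$ on $\mathbb R^{ln}$ and Schwartz $f_i$ on $\mathbb R^n$: $T_m(f_1,\dots,f_l)(x)=\int_{(\mathbb R^n)^l}\widehat{f_1}(\xi_1)\cdots\widehat{f_l}(\xi_l)m(\xi_1,\dots,\xi_l)e^{2\pi i\langle x,\xi_1+\cdots+\xi_l\rangle}d\xi$, with $\widehat f(\xi)=\int f(x)e^{-2\pi i\langle x,\xi\rangle}dx$. $\Theta$ is a fixed Schwartz function on $\mathbb R^{ln}$ with $\widehat\Theta$ supported in $\{1/2\le|\vec\xi|\le2\}$; $L^u_s(\mathbb R^{ln})$ is the Sobolev space with norm $\|[(1+4\pi^2|\cdot|^2)^{s/2}\widehat F]^\vee\|_{L^u}$; $\mathcal A^u_s[m]=\sup_{k\in\mathbb Z}\|m(2^k\cdot)\widehat\Theta\|_{L^u_s(\mathbb R^{ln})}$. *)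

theory Defs
  imports "HOL-Analysis.Analysis"
begin

definition FT :: "('a::euclidean_space \<Rightarrow> complex) \<Rightarrow> 'a \<Rightarrow> complex" where
  "FT f \<xi> = (LINT x|lborel. f x * cis (- 2 * pi * (x \<bullet> \<xi>)))"

definition schwartz :: "('a::euclidean_space \<Rightarrow> complex) \<Rightarrow> bool" where
  "schwartz f \<longleftrightarrow>
     (\<exists>D :: 'a list \<Rightarrow> 'a \<Rightarrow> complex.
        D [] = f \<and>
        (\<forall>ds \<in> lists Basis. continuous_on UNIV (D ds)) \<and>
        (\<forall>ds \<in> lists Basis. \<forall>b \<in> Basis. \<forall>x.
            ((\<lambda>t::real. D ds (x + t *\<^sub>R b)) has_vector_derivative D (b # ds) x) (at 0)) \<and>
        (\<forall>ds \<in> lists Basis. \<forall>N::nat. \<exists>C. \<forall>x. (1 + norm x) ^ N * norm (D ds x) \<le> C))"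

definition enn_root :: "real \<Rightarrow> ennreal \<Rightarrow> ennreal" where
  "enn_root p I = (if I = top then top else ennreal (enn2real I powr (1 / p)))"

definition Lp_norm :: "real \<Rightarrow> ('a::euclidean_space \<Rightarrow> complex) \<Rightarrow> ennreal" where
  "Lp_norm p f = enn_root p (\<integral>\<^sup>+ x. ennreal (norm (f x) powr p) \<partial>lborel)"

text \<open>The Sobolev norm of F is the L^u norm of G, where G is the (a.e. unique) L^u function
  whose distributional Fourier transform is (1 + 4 pi^2 |xi|^2)^(s/2) F^; it is \<infinity>
  if no such G exists.  The Fourier identity is tested against Schwartz functions:
  <G^, phi> = <G, phi^>.\<close>

definition sobolev_norm :: "real \<Rightarrow> real \<Rightarrow> ('a::euclidean_space \<Rightarrow> complex) \<Rightarrow> ennreal" where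
  "sobolev_norm u s F =
     (INF G \<in> {G. G \<in> borel_measurable lborel \<and> Lp_norm u G < top \<and>
                (\<forall>\<phi>. schwartz \<phi> \<longrightarrow>
                   (LINT x|lborel. G x * FT \<phi> x) =
                   (LINT \<xi>|lborel. complex_of_real ((1 + 4 * pi\<^sup>2 * (norm \<xi>)\<^sup>2) powr (s / 2))
                                     * FT F \<xi> * \<phi> \<xi>))}.
        Lp_norm u G)"

definition T_mult :: "(real^'n^'l \<Rightarrow> complex) \<Rightarrow> ('l \<Rightarrow> real^'n \<Rightarrow> complex) \<Rightarrow> real^'n \<Rightarrow> complex"
  where
  "T_mult m f x = (LINT \<xi>|lborel. (\<Prod>i\<in>UNIV. FT (f i) (\<xi> $ i)) * m \<xi>
                                   * cis (2 * pi * (x \<bullet> (\<Sum>i\<in>UNIV. \<xi> $ i))))"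

definition A_norm :: "(real^'n^'l \<Rightarrow> complex) \<Rightarrow> real \<Rightarrow> real \<Rightarrow> (real^'n^'l \<Rightarrow> complex) \<Rightarrow> ennreal"
  where
  "A_norm \<Theta> u s m = (SUP k::int. sobolev_norm u s (\<lambda>\<xi>. m ((2 powr real_of_int k) *\<^sub>R \<xi>) * FT \<Theta> \<xi>))"

end

theory Submission
  imports Defs "HOL-Probability.Probability"
begin

text \<open>
  Every condition is obtained by testing the inequality on one explicit Gaussian family. With complex
  weights \<open>w\<^sub>i\<close>, \<open>v\<close> of positive real part put
  \<open>m(\<xi>) = exp (- \<pi> (\<Sum>\<^sub>i w\<^sub>i |\<xi>\<^sub>i - a\<^sub>i|\<^sup>2 + v |\<Sum>\<^sub>i (\<xi>\<^sub>i - a\<^sub>i)|\<^sup>2))\<close>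
  and let the Fourier transform of \<open>f\<^sub>i\<close> be a multiple of \<open>exp (- \<pi> cnj w\<^sub>i |\<xi>\<^sub>i - a\<^sub>i|\<^sup>2)\<close>,
  so that the phases of \<open>f\<^sub>i\<close> and \<open>m\<close> cancel and \<open>T\<^sub>m f\<close> is, up to a modulation, a Gaussian that can
  be computed exactly. Taking \<open>w\<^sub>i = W\<^sup>2\<close> for \<open>i \<in> I\<close>, \<open>w\<^sub>i = 1\<close> otherwise, and \<open>v = W\<^sup>2\<close>,
  concentrates \<open>m\<close> at scale \<open>1/W\<close>; letting \<open>W\<close> tend to infinity gives the conditions that involve \<open>u\<close>
  (\<open>I\<close> the full index set gives \<open>s \<ge> l n / u\<close>). Let \<open>z\<close> have real part \<open>1\<close> and modulus \<open>W\<close>.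
  Taking \<open>w\<^sub>i = z\<close> for \<open>i \<in> I\<close>, \<open>w\<^sub>i = 1\<close> otherwise, and \<open>v = z\<close> produces quadratic chirps, which
  give the conditions with \<open>1/2\<close>.

  On the other side only an upper bound for the Sobolev norms is needed: if the derivatives of \<open>F\<close> of
  order \<open>i\<close> are bounded by \<open>W\<^sup>i A\<close>, then the norm of \<open>F\<close> of smoothness \<open>s\<close> is at most a constant
  times \<open>W\<^sup>s\<close> times the \<open>L\<^sup>u\<close> norm of \<open>A\<close>. For fractional \<open>s\<close> this follows by writing
  \<open>(1 - \<Delta>)\<^bsup>s/2\<^esup>\<close> as an integral over the heat semigroup, split at time \<open>W\<^sup>-\<^sup>2\<close>.
\<close>

section \<open>Directional derivatives and rapidly decreasing functions\<close>

definition has_directional_derivative ::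
  "('a::real_normed_vector \<Rightarrow> 'b::real_normed_vector) \<Rightarrow> ('a \<Rightarrow> 'b) \<Rightarrow> 'a \<Rightarrow> bool"
  (infix "has'_directional'_derivative" 50) where
  "(f has_directional_derivative f') b \<longleftrightarrow>
     (\<forall>x. ((\<lambda>t. f (x + t *\<^sub>R b)) has_vector_derivative f' x) (at 0))"

lemma has_directional_derivativeD:
  "(f has_directional_derivative f') b \<Longrightarrow> ((\<lambda>t. f (x + t *\<^sub>R b)) has_vector_derivative f' x) (at 0)"
  by (simp add: has_directional_derivative_def)

lemma has_directional_derivative_line:
  assumes "(f has_directional_derivative f') b"
  shows "((\<lambda>t. f (x + t *\<^sub>R b)) has_vector_derivative f' (x + t *\<^sub>R b)) (at t)"
proof -
  have shift: "((\<lambda>s. s - t) has_vector_derivative 1) (at t)"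
    by (auto intro!: derivative_eq_intros)
  have "((\<lambda>s. f ((x + t *\<^sub>R b) + s *\<^sub>R b)) has_vector_derivative f' (x + t *\<^sub>R b)) (at (t - t))"
    using assms by (simp add: has_directional_derivative_def)
  from vector_diff_chain_at[OF shift this] show ?thesis
    by (simp add: comp_def algebra_simps)
qed

lemma has_directional_derivative_const: "((\<lambda>_. c) has_directional_derivative (\<lambda>_. 0)) b"
  by (simp add: has_directional_derivative_def)

lemma has_directional_derivative_inner:
  "((\<lambda>x. complex_of_real (x \<bullet> c)) has_directional_derivative (\<lambda>_. complex_of_real (b \<bullet> c))) b"
  unfolding has_directional_derivative_def inner_add_left inner_scaleR_left
  by (auto intro!: derivative_eq_intros)

lemma has_directional_derivative_add:
  assumes "(f has_directional_derivative f') b" "(g has_directional_derivative g') b"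
  shows "((\<lambda>x. f x + g x) has_directional_derivative (\<lambda>x. f' x + g' x)) b"
  using assms by (auto simp: has_directional_derivative_def intro!: has_vector_derivative_add)

lemma has_directional_derivative_mult:
  fixes f g :: "'a::real_normed_vector \<Rightarrow> 'b::real_normed_algebra"
  assumes "(f has_directional_derivative f') b" "(g has_directional_derivative g') b"
  shows "((\<lambda>x. f x * g x) has_directional_derivative (\<lambda>x. f x * g' x + f' x * g x)) b"
  unfolding has_directional_derivative_def
proof
  fix x
  show "((\<lambda>t. f (x + t *\<^sub>R b) * g (x + t *\<^sub>R b)) has_vector_derivative f x * g' x + f' x * g x) (at 0)"
    using has_vector_derivative_mult[OF has_directional_derivativeD[OF assms(1), of x]
        has_directional_derivativeD[OF assms(2), of x]] by simp
qed

lemma has_directional_derivative_cmult: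
  fixes f :: "'a::real_normed_vector \<Rightarrow> 'b::real_normed_algebra"
  assumes "(f has_directional_derivative f') b"
  shows "((\<lambda>x. c * f x) has_directional_derivative (\<lambda>x. c * f' x)) b"
  using has_directional_derivative_mult[OF has_directional_derivative_const assms] by simp

lemma has_directional_derivative_exp:
  fixes f :: "'a::real_normed_vector \<Rightarrow> complex"
  assumes "(f has_directional_derivative f') b"
  shows "((\<lambda>x. exp (f x)) has_directional_derivative (\<lambda>x. f' x * exp (f x))) b"
  unfolding has_directional_derivative_def
proof
  fix x
  from field_vector_diff_chain_at[OF has_directional_derivativeD[OF assms, of x] DERIV_exp]
  show "((\<lambda>t. exp (f (x + t *\<^sub>R b))) has_vector_derivative f' x * exp (f x)) (at 0)"
    by (simp add: comp_def)
qed

lemma has_directional_derivative_bounded_bilinear: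
  assumes "bounded_bilinear B"
  shows "((\<lambda>x. B (c *\<^sub>R x - a) (c *\<^sub>R x - a)) has_directional_derivative
    (\<lambda>x. c *\<^sub>R (B (c *\<^sub>R x - a) b + B b (c *\<^sub>R x - a)))) b"
  unfolding has_directional_derivative_def
proof
  fix x
  interpret bounded_bilinear B by fact
  have "((\<lambda>t. c *\<^sub>R (x + t *\<^sub>R b) - a) has_vector_derivative c *\<^sub>R b) (at 0)"
    by (auto intro!: derivative_eq_intros)
  from has_vector_derivative[OF this this]
  show "((\<lambda>t. B (c *\<^sub>R (x + t *\<^sub>R b) - a) (c *\<^sub>R (x + t *\<^sub>R b) - a)) has_vector_derivative
      c *\<^sub>R (B (c *\<^sub>R x - a) b + B b (c *\<^sub>R x - a))) (at 0)"
    by (simp add: scaleR_left scaleR_right scaleR_add_right)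
qed

lemma has_directional_derivative_eq_0:
  assumes f: "(f has_directional_derivative f') b" and U: "closed U" "\<And>x. x \<notin> U \<Longrightarrow> f x = 0" and x: "x \<notin> U"
  shows "f' x = 0"
proof -
  have "open ((\<lambda>t::real. x + t *\<^sub>R b) -` (- U))"
    using U(1) by (intro open_vimage continuous_intros) auto
  from has_vector_derivative_transform_within_open[OF has_directional_derivativeD[OF f] this, of x "\<lambda>_. 0"]
  have "((\<lambda>_. 0) has_vector_derivative f' x) (at (0::real))"
    using U(2) x by auto
  then show ?thesis
    using vector_derivative_unique_at[OF _ has_vector_derivative_const] by blast
qed

definition rapid_decay :: "('a::euclidean_space \<Rightarrow> complex) \<Rightarrow> bool" where
  "rapid_decay f \<longleftrightarrow> f \<in> borel_measurable borel \<and> (\<forall>N::nat. \<exists>C. \<forall>x. (1 + norm x) ^ N * norm (f x) \<le> C)"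

lemma prod_square_le_power_norm:
  "(\<Prod>b\<in>Basis. (1 + (x \<bullet> b)\<^sup>2)) \<le> (1 + norm (x::'a::euclidean_space)) ^ (2 * DIM('a))"
proof -
  have "(\<Prod>b\<in>Basis. (1 + (x \<bullet> b)\<^sup>2)) \<le> (\<Prod>b\<in>(Basis::'a set). (1 + norm x)\<^sup>2)"
  proof (rule prod_mono, intro conjI)
    fix b :: 'a assume "b \<in> Basis"
    then have "(x \<bullet> b)\<^sup>2 \<le> (norm x)\<^sup>2"
      using power_mono[OF Basis_le_norm abs_ge_zero, of b x 2] by simp
    then show "1 + (x \<bullet> b)\<^sup>2 \<le> (1 + norm x)\<^sup>2"
      by (simp add: power2_sum add_increasing2)
  qed simp
  then show ?thesis by (simp add: power_mult)
qed

lemma integrable_inverse_prod_square: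
  "integrable lborel (\<lambda>x::'a::euclidean_space. \<Prod>b\<in>Basis. inverse (1 + (x \<bullet> b)\<^sup>2))"
proof (rule integrableI_nonneg)
  have one_dim: "integrable lborel (\<lambda>x::real. inverse (1 + x\<^sup>2))"
    using integrable_inverse_1_plus_square by (simp add: set_integrable_def)
  have "(\<integral>\<^sup>+x. ennreal (\<Prod>b\<in>Basis. inverse (1 + (x \<bullet> b)\<^sup>2)) \<partial>(lborel::'a measure))
      = (\<integral>\<^sup>+x. (\<Prod>b\<in>Basis. ennreal (inverse (1 + (x \<bullet> b)\<^sup>2))) \<partial>(lborel::'a measure))"
    by (subst prod_ennreal) auto
  also have "\<dots> = (\<Prod>b\<in>(Basis::'a set). (\<integral>\<^sup>+x. ennreal (inverse (1 + x\<^sup>2)) \<partial>lborel))"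
    by (intro nn_integral_lborel_prod) auto
  also have "\<dots> < \<infinity>"
    using one_dim by (simp add: real_integrable_def power_less_top_ennreal less_top)
  finally show "(\<integral>\<^sup>+x. ennreal (\<Prod>b\<in>Basis. inverse (1 + (x \<bullet> b)\<^sup>2)) \<partial>(lborel::'a measure)) < \<infinity>" .
qed (auto intro!: prod_nonneg AE_I2)

lemma integrable_inverse_power_norm:
  "integrable lborel (\<lambda>x::'a::euclidean_space. inverse ((1 + norm x) ^ (2 * DIM('a))))"
proof (rule Bochner_Integration.integrable_bound[OF integrable_inverse_prod_square], simp, rule AE_I2)
  fix x :: 'a
  have "inverse ((1 + norm x) ^ (2 * DIM('a))) \<le> inverse (\<Prod>b\<in>Basis. (1 + (x \<bullet> b)\<^sup>2))"
    by (intro le_imp_inverse_le prod_square_le_power_norm prod_pos) (auto intro: add_pos_nonneg)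
  then show "norm (inverse ((1 + norm x) ^ (2 * DIM('a)))) \<le> norm (\<Prod>b\<in>Basis. inverse (1 + (x \<bullet> b)\<^sup>2))"
    by (simp add: prod_inversef[symmetric] comp_def prod_nonneg)
qed

lemma rapid_decay_measurable [measurable_dest]: "rapid_decay f \<Longrightarrow> f \<in> borel_measurable borel"
  by (simp add: rapid_decay_def)

lemma rapid_decayE:
  assumes "rapid_decay f"
  obtains C where "C \<ge> 0" "\<And>x. norm (f x) \<le> C * inverse ((1 + norm x) ^ N)"
proof -
  obtain C where C: "\<And>x. (1 + norm x) ^ N * norm (f x) \<le> C"
    using assms by (auto simp: rapid_decay_def)
  have "0 \<le> C" using order_trans[OF norm_ge_zero, of "f 0" C] C[of 0] by simp
  moreover have "norm (f x) \<le> C * inverse ((1 + norm x) ^ N)" for x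
    using C[of x] add_pos_nonneg[OF zero_less_one norm_ge_zero[of x]] by (simp add: field_simps)
  ultimately show ?thesis using that by blast
qed

lemma rapid_decay_bounded:
  assumes "rapid_decay f" obtains B where "\<And>x. norm (f x) \<le> B"
  using rapid_decayE[OF assms, of 0] by (metis inverse_1 mult.right_neutral power_0)

lemma rapid_decay_integrable:
  fixes f :: "'a::euclidean_space \<Rightarrow> complex"
  assumes "rapid_decay f" shows "integrable lborel f"
proof -
  obtain C where C: "C \<ge> 0" "\<And>x. norm (f x) \<le> C * inverse ((1 + norm x) ^ (2 * DIM('a)))"
    using rapid_decayE[OF assms] by blast
  show ?thesis
  proof (rule Bochner_Integration.integrable_bound)
    show "integrable lborel (\<lambda>x::'a. C * inverse ((1 + norm x) ^ (2 * DIM('a))))"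
      by (intro integrable_mult_right integrable_inverse_power_norm)
  qed (use assms C in \<open>auto simp: rapid_decay_def abs_mult\<close>)
qed

lemma rapid_decay_mult:
  assumes f: "rapid_decay f" and [measurable]: "g \<in> borel_measurable borel"
    and g: "\<And>x. norm (g x) \<le> K * (1 + norm x) ^ M"
  shows "rapid_decay (\<lambda>x. g x * f x)"
  unfolding rapid_decay_def
proof (intro conjI allI)
  note [measurable] = rapid_decay_measurable[OF f]
  show "(\<lambda>x. g x * f x) \<in> borel_measurable borel" by measurable
  fix N
  have K: "K \<ge> 0" using order_trans[OF norm_ge_zero g, of 0] by simp
  obtain C where C: "\<And>x. (1 + norm x) ^ (N + M) * norm (f x) \<le> C"
    using f by (auto simp: rapid_decay_def)
  have "(1 + norm x) ^ N * norm (g x * f x) \<le> K * C" for x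
  proof -
    have "(1 + norm x) ^ N * norm (g x * f x) \<le> (1 + norm x) ^ N * ((K * (1 + norm x) ^ M) * norm (f x))"
      unfolding norm_mult by (intro mult_left_mono mult_right_mono g) auto
    also have "\<dots> = K * ((1 + norm x) ^ (N + M) * norm (f x))" by (simp add: power_add)
    also have "\<dots> \<le> K * C" by (intro mult_left_mono C K)
    finally show ?thesis .
  qed
  then show "\<exists>C. \<forall>x. (1 + norm x) ^ N * norm (g x * f x) \<le> C" by blast
qed

lemma rapid_decay_inner_mult: "rapid_decay f \<Longrightarrow> rapid_decay (\<lambda>x. complex_of_real (x \<bullet> b) * f x)"
proof (rule rapid_decay_mult[where K="norm b" and M=1])
  fix x
  have "\<bar>x \<bullet> b\<bar> \<le> norm b * norm x" using Cauchy_Schwarz_ineq2[of x b] by (simp add: mult.commute)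
  also have "\<dots> \<le> norm b * (1 + norm x)" by (intro mult_left_mono) auto
  finally show "norm (complex_of_real (x \<bullet> b)) \<le> norm b * (1 + norm x) ^ 1" by simp
qed auto

lemma rapid_decay_cmult: "rapid_decay f \<Longrightarrow> rapid_decay (\<lambda>x. c * f x)"
  by (rule rapid_decay_mult[where K="norm c" and M=0]) auto

lemma rapid_decay_add:
  assumes "rapid_decay f" "rapid_decay g" shows "rapid_decay (\<lambda>x. f x + g x)"
  unfolding rapid_decay_def
proof (intro conjI allI)
  note [measurable] = assms[THEN rapid_decay_measurable]
  show "(\<lambda>x. f x + g x) \<in> borel_measurable borel" by measurable
  fix N :: nat
  obtain C D where CD: "\<And>x. (1 + norm x) ^ N * norm (f x) \<le> C" "\<And>x. (1 + norm x) ^ N * norm (g x) \<le> D"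
    using assms unfolding rapid_decay_def by blast
  have "(1 + norm x) ^ N * norm (f x + g x) \<le> C + D" for x
  proof -
    have "(1 + norm x) ^ N * norm (f x + g x) \<le> (1 + norm x) ^ N * (norm (f x) + norm (g x))"
      by (intro mult_left_mono norm_triangle_ineq) auto
    also have "\<dots> \<le> C + D" using CD[of x] by (simp add: distrib_left)
    finally show ?thesis .
  qed
  then show "\<exists>C. \<forall>x. (1 + norm x) ^ N * norm (f x + g x) \<le> C" by blast
qed

lemma rapid_decay_compact_support:
  assumes "f \<in> borel_measurable borel" "\<And>x. norm (f x) \<le> C" "\<And>x. norm x > R \<Longrightarrow> f x = 0"
  shows "rapid_decay f"
  unfolding rapid_decay_def
proof (intro conjI allI)
  fix N :: nat
  have C: "C \<ge> 0" using assms(2) norm_ge_zero order_trans by blast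
  have "(1 + norm x) ^ N * norm (f x) \<le> (1 + \<bar>R\<bar>) ^ N * C" for x
  proof (cases "norm x > R")
    case False
    then show ?thesis using C by (intro mult_mono power_mono assms) auto
  qed (use assms(3) C in auto)
  then show "\<exists>C. \<forall>x. (1 + norm x) ^ N * norm (f x) \<le> C" by blast
qed (use assms in auto)

lemma schwartz_imp_rapid_decay:
  fixes f :: "'a::euclidean_space \<Rightarrow> complex"
  assumes "schwartz f" shows "rapid_decay f"
proof -
  obtain D :: "'a list \<Rightarrow> 'a \<Rightarrow> complex" where D: "D [] = f"
    "\<forall>ds \<in> lists Basis. continuous_on UNIV (D ds)"
    "\<forall>ds \<in> lists Basis. \<forall>N::nat. \<exists>C. \<forall>x. (1 + norm x) ^ N * norm (D ds x) \<le> C"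
    using assms unfolding schwartz_def by blast
  have "continuous_on UNIV (D [])" "\<forall>N::nat. \<exists>C. \<forall>x. (1 + norm x) ^ N * norm (D [] x) \<le> C"
    using D(2,3) lists.Nil by blast+
  then show ?thesis unfolding rapid_decay_def D(1) by (auto intro: borel_measurable_continuous_onI)
qed

lemma schwartz_closedI:
  fixes f :: "'a::euclidean_space \<Rightarrow> complex"
  assumes f: "f \<in> S"
    and cont: "\<And>g. g \<in> S \<Longrightarrow> continuous_on UNIV g"
    and decay: "\<And>g. g \<in> S \<Longrightarrow> rapid_decay g"
    and deriv: "\<And>g b. g \<in> S \<Longrightarrow> b \<in> Basis \<Longrightarrow> \<exists>g'\<in>S. (g has_directional_derivative g') b"
  shows "schwartz f"
proof -
  have "\<forall>b g. \<exists>g'. g \<in> S \<longrightarrow> b \<in> Basis \<longrightarrow> g' \<in> S \<and> (g has_directional_derivative g') b"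
    using deriv by blast
  then obtain d where d: "\<And>g b. g \<in> S \<Longrightarrow> b \<in> Basis \<Longrightarrow> d b g \<in> S"
    "\<And>g b. g \<in> S \<Longrightarrow> b \<in> Basis \<Longrightarrow> (g has_directional_derivative d b g) b"
    unfolding choice_iff by blast
  define D where "D ds = foldr d ds f" for ds
  have D: "D ds \<in> S" if "ds \<in> lists Basis" for ds
    using that unfolding D_def by (induction ds) (auto simp: f d(1))
  show ?thesis
    unfolding schwartz_def
  proof (intro exI[of _ D] conjI ballI allI)
    show "D [] = f" by (simp add: D_def)
    fix ds :: "'a list" assume ds: "ds \<in> lists Basis"
    show "continuous_on UNIV (D ds)" using cont D[OF ds] by blast
    show "\<exists>C. \<forall>x. (1 + norm x) ^ N * norm (D ds x) \<le> C" for N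
      using decay[OF D[OF ds]] by (auto simp: rapid_decay_def)
    show "((\<lambda>t. D ds (x + t *\<^sub>R b)) has_vector_derivative D (b # ds) x) (at 0)" if "b \<in> Basis" for b x
      using has_directional_derivativeD[OF d(2)[OF D[OF ds] that]] by (simp add: D_def)
  qed
qed

inductive_set polynomial_multiples :: "('a::euclidean_space \<Rightarrow> complex) \<Rightarrow> ('a \<Rightarrow> complex) set"
  for f :: "'a \<Rightarrow> complex" where
  base: "f \<in> polynomial_multiples f"
| cmult: "g \<in> polynomial_multiples f \<Longrightarrow> (\<lambda>x. c * g x) \<in> polynomial_multiples f"
| inner: "g \<in> polynomial_multiples f \<Longrightarrow> (\<lambda>x. complex_of_real (x \<bullet> b) * g x) \<in> polynomial_multiples f"
| add: "g \<in> polynomial_multiples f \<Longrightarrow> h \<in> polynomial_multiples f \<Longrightarrow> (\<lambda>x. g x + h x) \<in> polynomial_multiples f"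

lemma polynomial_multiples_derivative:
  assumes base_deriv: "\<exists>f'\<in>polynomial_multiples f. (f has_directional_derivative f') b"
    and "g \<in> polynomial_multiples f"
  shows "\<exists>g'\<in>polynomial_multiples f. (g has_directional_derivative g') b"
  using assms(2)
proof (induction rule: polynomial_multiples.induct)
  case base
  then show ?case by (rule base_deriv)
next
  case (cmult g c)
  then show ?case
    by (blast intro: has_directional_derivative_cmult polynomial_multiples.cmult)
next
  case (inner g c)
  then obtain g' where "g' \<in> polynomial_multiples f" "(g has_directional_derivative g') b" by blast
  then show ?case
    using inner.hyps
    by (intro bexI[of _ "\<lambda>x. complex_of_real (x \<bullet> c) * g' x + complex_of_real (b \<bullet> c) * g x"]
        has_directional_derivative_mult has_directional_derivative_inner polynomial_multiples.intros)
next
  case (add g h)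
  then show ?case
    by (blast intro: has_directional_derivative_add polynomial_multiples.add)
qed

lemma schwartz_polynomial_multiplesI:
  fixes f :: "'a::euclidean_space \<Rightarrow> complex"
  assumes cont: "continuous_on UNIV f" and decay: "rapid_decay f"
    and deriv: "\<And>b. b \<in> Basis \<Longrightarrow> \<exists>f'\<in>polynomial_multiples f. (f has_directional_derivative f') b"
  shows "schwartz f"
proof (rule schwartz_closedI[where S="polynomial_multiples f"])
  show "continuous_on UNIV g" if "g \<in> polynomial_multiples f" for g
    using that by induction (auto intro!: continuous_intros cont)
  show "rapid_decay g" if "g \<in> polynomial_multiples f" for g
    using that by induction (auto intro: decay rapid_decay_cmult rapid_decay_inner_mult rapid_decay_add)
qed (auto intro: polynomial_multiples.base polynomial_multiples_derivative deriv)

section \<open>The Fourier transform\<close>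

lemma borel_measurable_cis [measurable]:
  "h \<in> borel_measurable M \<Longrightarrow> (\<lambda>x. cis (h x)) \<in> borel_measurable M"
  by (simp add: cis_conv_exp)

lemma borel_measurable_FT [measurable]:
  assumes [measurable]: "f \<in> borel_measurable borel"
  shows "FT f \<in> borel_measurable borel"
proof -
  have "(\<lambda>\<xi>. LINT x|lborel. f x * cis (- 2 * pi * (x \<bullet> \<xi>))) \<in> borel_measurable borel"
    by (rule sigma_finite_measure.borel_measurable_lebesgue_integral)
       (auto intro: lborel.sigma_finite_measure_axioms)
  then show ?thesis by (simp add: FT_def[abs_def])
qed

lemma integrable_mult_cis:
  assumes "integrable M f" "h \<in> borel_measurable M"
  shows "integrable M (\<lambda>x. f x * cis (h x))"
  using assms by (intro Bochner_Integration.integrable_bound[OF assms(1)]) (auto simp: norm_mult)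

lemma norm_FT_le:
  assumes "integrable lborel f" shows "norm (FT f \<xi>) \<le> (LINT x|lborel. norm (f x))"
  unfolding FT_def by (rule order_trans[OF integral_norm_bound]) (simp add: norm_mult)

lemma FT_cmult: "FT (\<lambda>x. c * f x) \<xi> = c * FT f \<xi>"
  by (simp add: FT_def mult.assoc)

lemma FT_add:
  assumes "integrable lborel f" "integrable lborel g"
  shows "FT (\<lambda>x. f x + g x) \<xi> = FT f \<xi> + FT g \<xi>"
  using assms by (simp add: FT_def distrib_right integrable_mult_cis)

lemma FT_sum:
  assumes "\<And>i. i \<in> I \<Longrightarrow> integrable lborel (f i)"
  shows "FT (\<lambda>x. \<Sum>i\<in>I. f i x) \<xi> = (\<Sum>i\<in>I. FT (f i) \<xi>)"
  using assms by (simp add: FT_def sum_distrib_right integrable_mult_cis)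

lemma difference_quotient_bound:
  fixes f :: "real \<Rightarrow> 'b::real_normed_vector"
  assumes deriv: "\<And>t. t \<in> ball t0 \<delta> \<Longrightarrow> (f has_vector_derivative f' t) (at t)"
    and bound: "\<And>t. t \<in> ball t0 \<delta> \<Longrightarrow> norm (f' t) \<le> B"
    and h: "h \<noteq> 0" "\<bar>h\<bar> < \<delta>"
  shows "norm ((f (t0 + h) - f t0) /\<^sub>R h) \<le> B"
proof -
  have "norm (f (t0 + h) - f t0) \<le> B * norm ((t0 + h) - t0)"
  proof (rule differentiable_bound[where S="ball t0 \<delta>" and f'="\<lambda>t s. s *\<^sub>R f' t"])
    fix t assume t: "t \<in> ball t0 \<delta>"
    show "(f has_derivative (\<lambda>s. s *\<^sub>R f' t)) (at t within ball t0 \<delta>)"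
      using deriv[OF t] by (auto simp: has_vector_derivative_def intro: has_derivative_at_withinI)
    have "onorm (\<lambda>s::real. s *\<^sub>R f' t) \<le> norm (f' t)"
      by (rule onorm_bound) (auto simp: mult.commute)
    then show "onorm (\<lambda>s::real. s *\<^sub>R f' t) \<le> B"
      using bound[OF t] by linarith
  qed (use h in \<open>auto simp: dist_real_def\<close>)
  then show ?thesis using h(1) by (simp add: divide_inverse mult.commute flip: pos_divide_le_eq)
qed

lemma has_vector_derivative_at_iff_lim:
  "(f has_vector_derivative D) (at t) \<longleftrightarrow> ((\<lambda>h. (f (t + h) - f t) /\<^sub>R h) \<longlongrightarrow> D) (at 0)"
proof -
  have quotient: "norm (f (t + h) - f t - h *\<^sub>R D) / \<bar>h\<bar> = norm ((f (t + h) - f t) /\<^sub>R h - D)"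
    if "h \<noteq> 0" for h
  proof -
    have "(f (t + h) - f t) /\<^sub>R h - D = (f (t + h) - f t - h *\<^sub>R D) /\<^sub>R h"
      using that by (simp add: scaleR_diff_right)
    then show ?thesis by (simp add: divide_inverse mult.commute)
  qed
  have "(\<lambda>h. norm (f (t + h) - f t - h *\<^sub>R D) / norm h) \<midarrow>0\<rightarrow> 0 \<longleftrightarrow>
     (\<lambda>h. norm ((f (t + h) - f t) /\<^sub>R h - D)) \<midarrow>0\<rightarrow> 0"
    by (intro filterlim_cong refl) (auto simp: eventually_at_filter quotient intro!: always_eventually)
  then show ?thesis
    unfolding has_vector_derivative_def has_derivative_at
    by (simp add: bounded_linear_scaleR_left tendsto_norm_zero_iff LIM_zero_iff)
qed

lemma has_vector_derivative_lebesgue_integral: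
  fixes f f' :: "real \<Rightarrow> 'a \<Rightarrow> complex"
  assumes \<delta>: "\<delta> > 0"
    and deriv: "\<And>t x. t \<in> ball t0 \<delta> \<Longrightarrow> ((\<lambda>t. f t x) has_vector_derivative f' t x) (at t)"
    and int: "\<And>t. t \<in> ball t0 \<delta> \<Longrightarrow> integrable M (f t)"
    and bound: "\<And>t x. t \<in> ball t0 \<delta> \<Longrightarrow> norm (f' t x) \<le> g x"
    and g: "integrable M g"
    and f'_meas: "f' t0 \<in> borel_measurable M"
  shows "((\<lambda>t. LINT x|M. f t x) has_vector_derivative (LINT x|M. f' t0 x)) (at t0)"
  unfolding has_vector_derivative_at_iff_lim tendsto_at_iff_sequentially
proof (intro allI impI)
  fix X :: "nat \<Rightarrow> real"
  assume X_nz: "\<forall>i. X i \<in> UNIV - {0}" and X: "X \<longlonglongrightarrow> 0"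
  let ?q = "\<lambda>h x. (f (t0 + h) x - f t0 x) /\<^sub>R h"
  obtain N where N: "\<And>n. n \<ge> N \<Longrightarrow> \<bar>X n\<bar> < \<delta>"
    using tendstoD[OF X \<delta>] by (auto simp: eventually_sequentially dist_real_def)
  have ball: "t0 + X (n + N) \<in> ball t0 \<delta>" "t0 \<in> ball t0 \<delta>" for n
    using N[of "n + N"] \<delta> by (auto simp: dist_real_def)
  have "(\<lambda>n. LINT x|M. ?q (X (n + N)) x) \<longlonglongrightarrow> (LINT x|M. f' t0 x)"
  proof (rule integral_dominated_convergence[OF f'_meas _ g])
    show "?q (X (n + N)) \<in> borel_measurable M" for n
      using int[OF ball(1)] int[OF ball(2)] by auto
    show "AE x in M. norm (?q (X (n + N)) x) \<le> g x" for n
      using deriv bound X_nz N[of "n + N"] by (intro AE_I2 difference_quotient_bound) auto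
    show "AE x in M. (\<lambda>n. ?q (X (n + N)) x) \<longlonglongrightarrow> f' t0 x"
    proof (rule AE_I2)
      fix x
      have "((\<lambda>h. ?q h x) \<circ> X) \<longlonglongrightarrow> f' t0 x"
        using deriv[OF ball(2)] X X_nz
        unfolding has_vector_derivative_at_iff_lim tendsto_at_iff_sequentially by blast
      then show "(\<lambda>n. ?q (X (n + N)) x) \<longlonglongrightarrow> f' t0 x"
        by (auto simp: comp_def intro: LIMSEQ_ignore_initial_segment)
    qed
  qed
  moreover have "(LINT x|M. ?q (X (n + N)) x)
      = ((LINT x|M. f (t0 + X (n + N)) x) - (LINT x|M. f t0 x)) /\<^sub>R X (n + N)" for n
    using int[OF ball(1)] int[OF ball(2)] by simp
  ultimately have "(\<lambda>n. ((LINT x|M. f (t0 + X (n + N)) x) - (LINT x|M. f t0 x)) /\<^sub>R X (n + N))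
      \<longlonglongrightarrow> (LINT x|M. f' t0 x)"
    by (simp only:)
  then show "((\<lambda>h. ((LINT x|M. f (t0 + h) x) - (LINT x|M. f t0 x)) /\<^sub>R h) \<circ> X) \<longlonglongrightarrow> (LINT x|M. f' t0 x)"
    unfolding comp_def by (rule LIMSEQ_offset)
qed

lemma has_vector_derivative_cis_affine:
  "((\<lambda>t. cis (c + t * d)) has_vector_derivative \<i> * complex_of_real d * cis (c + t * d)) (at t)"
proof -
  have "((\<lambda>z. exp (\<i> * (of_real c + z * of_real d))) has_field_derivative
      \<i> * of_real d * exp (\<i> * (of_real c + of_real t * of_real d))) (at (of_real t))"
    by (auto intro!: derivative_eq_intros)
  from has_vector_derivative_real_field[OF this] show ?thesis
    by (simp add: cis_conv_exp)
qed

lemma FT_has_directional_derivative: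
  assumes f: "rapid_decay f"
  shows "(FT f has_directional_derivative FT (\<lambda>x. (- 2 * pi * \<i>) * (complex_of_real (x \<bullet> b) * f x))) b"
  unfolding has_directional_derivative_def
proof
  fix \<xi>
  let ?f' = "\<lambda>x. (- 2 * pi * \<i>) * (complex_of_real (x \<bullet> b) * f x)"
  note [measurable] = rapid_decay_measurable[OF f]
  have "((\<lambda>t. LINT x|lborel. f x * cis (- 2 * pi * (x \<bullet> (\<xi> + t *\<^sub>R b)))) has_vector_derivative
     (LINT x|lborel. ?f' x * cis (- 2 * pi * (x \<bullet> (\<xi> + 0 *\<^sub>R b))))) (at 0)"
  proof (rule has_vector_derivative_lebesgue_integral[where \<delta>=1 and g="\<lambda>x. norm (?f' x)"])
    fix t x
    have "((\<lambda>t. cis (- 2 * pi * (x \<bullet> \<xi>) + t * (- 2 * pi * (x \<bullet> b)))) has_vector_derivative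
      \<i> * of_real (- 2 * pi * (x \<bullet> b)) * cis (- 2 * pi * (x \<bullet> \<xi>) + t * (- 2 * pi * (x \<bullet> b)))) (at t)"
      by (rule has_vector_derivative_cis_affine)
    from has_vector_derivative_mult_right[OF this, of "f x"]
    show "((\<lambda>t. f x * cis (- 2 * pi * (x \<bullet> (\<xi> + t *\<^sub>R b)))) has_vector_derivative
       ?f' x * cis (- 2 * pi * (x \<bullet> (\<xi> + t *\<^sub>R b)))) (at t)"
      by (simp add: algebra_simps inner_add_right)
  next
    show "integrable lborel (\<lambda>x. norm (?f' x))"
      by (intro integrable_norm rapid_decay_integrable rapid_decay_cmult rapid_decay_inner_mult f)
    show "integrable lborel (\<lambda>x. f x * cis (- 2 * pi * (x \<bullet> (\<xi> + t *\<^sub>R b))))" for t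
      by (intro integrable_mult_cis rapid_decay_integrable f) auto
  qed (auto simp: norm_mult)
  then show "((\<lambda>t. FT f (\<xi> + t *\<^sub>R b)) has_vector_derivative FT ?f' \<xi>) (at 0)"
    by (simp add: FT_def)
qed

lemma lborel_integral_translate:
  fixes f :: "'a::euclidean_space \<Rightarrow> 'b::{banach, second_countable_topology}"
  assumes "f \<in> borel_measurable borel"
  shows "(LINT x|lborel. f (c + x)) = (LINT x|lborel. f x)"
  using integral_distr[of "(+) c" lborel borel f] assms by (simp add: lborel_distr_plus)

lemma lborel_integrable_translate:
  fixes f :: "'a::euclidean_space \<Rightarrow> 'b::{banach, second_countable_topology}"
  assumes "integrable lborel f"
  shows "integrable lborel (\<lambda>x. f (c + x))"
  using integrable_distr[of "(+) c" lborel borel f] assms by (simp add: lborel_distr_plus)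

lemma rapid_decay_translates_dominated:
  assumes "rapid_decay f"
  obtains g where "integrable lborel g" "\<And>t x. \<bar>t\<bar> < 1 \<Longrightarrow> norm (f (x + t *\<^sub>R b)) \<le> g x"
proof -
  let ?N = "2 * DIM('a)"
  obtain C where C: "C \<ge> 0" "\<And>x. norm (f x) \<le> C * inverse ((1 + norm x) ^ ?N)"
    using rapid_decayE[OF assms] by blast
  show thesis
  proof
    show "integrable lborel (\<lambda>x::'a. C * (1 + norm b) ^ ?N * inverse ((1 + norm x) ^ ?N))"
      by (intro integrable_mult_right integrable_inverse_power_norm)
    fix t :: real and x assume t: "\<bar>t\<bar> < 1"
    let ?y = "x + t *\<^sub>R b"
    have "norm (t *\<^sub>R b) \<le> norm b" using t by (simp add: mult_left_le_one_le)
    moreover have "norm x \<le> norm ?y + norm (t *\<^sub>R b)"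
      by (metis add_diff_cancel_right' norm_triangle_ineq4)
    ultimately have "1 + norm x \<le> 1 + norm ?y + norm b + norm b * norm ?y"
      using mult_nonneg_nonneg[OF norm_ge_zero norm_ge_zero, of b ?y] by linarith
    then have "1 + norm x \<le> (1 + norm b) * (1 + norm ?y)" by (simp add: algebra_simps)
    then have "(1 + norm x) ^ ?N \<le> (1 + norm b) ^ ?N * (1 + norm ?y) ^ ?N"
      unfolding power_mult_distrib[symmetric] by (intro power_mono) auto
    moreover have "(1 + norm x) ^ ?N > 0" "(1 + norm ?y) ^ ?N > 0"
      by (auto intro!: zero_less_power add_pos_nonneg)
    ultimately have "inverse ((1 + norm ?y) ^ ?N) \<le> (1 + norm b) ^ ?N * inverse ((1 + norm x) ^ ?N)"
      by (simp add: field_simps)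
    then show "norm (f ?y) \<le> C * (1 + norm b) ^ ?N * inverse ((1 + norm x) ^ ?N)"
      using C(2)[of ?y] mult_left_mono[OF _ C(1)] by (fastforce simp: mult.assoc)
  qed
qed

lemma FT_directional_derivative:
  assumes f: "rapid_decay f" and f': "rapid_decay f'" and deriv: "(f has_directional_derivative f') b"
  shows "FT f' \<xi> = 2 * pi * \<i> * complex_of_real (\<xi> \<bullet> b) * FT f \<xi>"
proof -
  note [measurable] = rapid_decay_measurable[OF f] rapid_decay_measurable[OF f']
  obtain g g' where g: "integrable lborel g" "\<And>t x. \<bar>t\<bar> < 1 \<Longrightarrow> norm (f (x + t *\<^sub>R b)) \<le> g x"
    and g': "integrable lborel g'" "\<And>t x. \<bar>t\<bar> < 1 \<Longrightarrow> norm (f' (x + t *\<^sub>R b)) \<le> g' x"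
    using rapid_decay_translates_dominated[OF f] rapid_decay_translates_dominated[OF f'] by metis
  let ?H = "\<lambda>t. LINT x|lborel. f (x + t *\<^sub>R b) * cis (- 2 * pi * (x \<bullet> \<xi>))"
  have "(?H has_vector_derivative (LINT x|lborel. f' (x + 0 *\<^sub>R b) * cis (- 2 * pi * (x \<bullet> \<xi>)))) (at 0)"
  proof (rule has_vector_derivative_lebesgue_integral[where \<delta>=1 and g=g'])
    show "((\<lambda>t. f (x + t *\<^sub>R b) * cis (- 2 * pi * (x \<bullet> \<xi>))) has_vector_derivative
      f' (x + t *\<^sub>R b) * cis (- 2 * pi * (x \<bullet> \<xi>))) (at t)" for t x
      by (intro has_vector_derivative_mult_left has_directional_derivative_line deriv)
    show "integrable lborel (\<lambda>x. f (x + t *\<^sub>R b) * cis (- 2 * pi * (x \<bullet> \<xi>)))" if "t \<in> ball 0 1" for t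
      using that g(2) by (intro Bochner_Integration.integrable_bound[OF g(1)])
        (auto simp: norm_mult intro: order_trans[OF _ abs_ge_self])
    show "norm (f' (x + t *\<^sub>R b) * cis (- 2 * pi * (x \<bullet> \<xi>))) \<le> g' x" if "t \<in> ball 0 1" for t x
      using g'(2)[of t x] that by (simp add: norm_mult)
  qed (use g' in auto)
  then have derivative_inside: "(?H has_vector_derivative FT f' \<xi>) (at 0)" by (simp add: FT_def)
  have "?H t = FT f \<xi> * cis (0 + t * (2 * pi * (b \<bullet> \<xi>)))" for t
  proof -
    have "?H t = (LINT x|lborel. f (t *\<^sub>R b + x) * cis (- 2 * pi * ((t *\<^sub>R b + x) \<bullet> \<xi>))
        * cis (t * (2 * pi * (b \<bullet> \<xi>))))"
      by (simp add: cis_mult inner_add_left algebra_simps)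
    also have "\<dots> = (LINT x|lborel. f x * cis (- 2 * pi * (x \<bullet> \<xi>)) * cis (t * (2 * pi * (b \<bullet> \<xi>))))"
      by (rule lborel_integral_translate) measurable
    finally show ?thesis by (simp add: FT_def)
  qed
  moreover have "((\<lambda>t. FT f \<xi> * cis (0 + t * (2 * pi * (b \<bullet> \<xi>)))) has_vector_derivative
      FT f \<xi> * (\<i> * complex_of_real (2 * pi * (b \<bullet> \<xi>)) * cis (0 + 0 * (2 * pi * (b \<bullet> \<xi>))))) (at 0)"
    by (intro has_vector_derivative_mult_right has_vector_derivative_cis_affine)
  ultimately have "FT f' \<xi> = FT f \<xi> * (\<i> * complex_of_real (2 * pi * (b \<bullet> \<xi>)) * cis (0 + 0 * (2 * pi * (b \<bullet> \<xi>))))"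
    using vector_derivative_unique_at[OF derivative_inside] by (simp only:)
  then show ?thesis by (simp add: inner_commute algebra_simps)
qed

lemma (in pair_sigma_finite) integrable_prod_bounded:
  fixes f :: "'a \<Rightarrow> complex" and g :: "'b \<Rightarrow> complex"
  assumes f: "integrable M1 f" and g: "integrable M2 g"
    and k: "(\<lambda>(x, y). k x y) \<in> borel_measurable (M1 \<Otimes>\<^sub>M M2)" "\<And>x y. norm (k x y) \<le> B"
  shows "integrable (M1 \<Otimes>\<^sub>M M2) (\<lambda>(x, y). f x * g y * k x y)"
proof -
  note [measurable] = borel_measurable_integrable[OF f] borel_measurable_integrable[OF g] k(1)
  have fg: "integrable (M1 \<Otimes>\<^sub>M M2) (\<lambda>(x, y). f x * g y)"
  proof (rule Fubini_integrable)
    show "integrable M1 (\<lambda>x. LINT y|M2. norm (case (x, y) of (x, y) \<Rightarrow> f x * g y))"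
      using f by (simp add: norm_mult)
    show "AE x in M1. integrable M2 (\<lambda>y. case (x, y) of (x, y) \<Rightarrow> f x * g y)"
      using g by simp
  qed measurable
  show ?thesis
  proof (rule Bochner_Integration.integrable_bound[OF integrable_mult_right[OF fg, of "of_real B"]])
    have "B \<ge> 0" using k(2) norm_ge_zero order_trans by blast
    then show "AE x in M1 \<Otimes>\<^sub>M M2. norm (case x of (x, y) \<Rightarrow> f x * g y * k x y)
       \<le> norm (complex_of_real B * (case x of (x, y) \<Rightarrow> f x * g y))"
      using k(2) by (intro AE_I2) (auto simp: norm_mult mult.commute[of B] intro!: mult_left_mono)
  qed measurable
qed

lemma (in pair_sigma_finite) integral_swap_bounded:
  fixes f :: "'a \<Rightarrow> complex" and g :: "'b \<Rightarrow> complex"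
  assumes "integrable M1 f" "integrable M2 g"
    and "(\<lambda>(x, y). k x y) \<in> borel_measurable (M1 \<Otimes>\<^sub>M M2)" "\<And>x y. norm (k x y) \<le> B"
  shows "(LINT y|M2. LINT x|M1. f x * g y * k x y) = (LINT x|M1. LINT y|M2. f x * g y * k x y)"
  using Fubini_integral[OF integrable_prod_bounded[OF assms]] .

lemma FT_pairing:
  assumes f: "integrable lborel f" and g: "integrable lborel g"
  shows "(LINT x|lborel. f x * FT g (x + y)) = (LINT \<xi>|lborel. FT f \<xi> * g \<xi> * cis (- 2 * pi * (y \<bullet> \<xi>)))"
proof -
  have "(LINT x|lborel. f x * FT g (x + y))
      = (LINT x|lborel. LINT \<xi>|lborel. g \<xi> * f x * cis (- 2 * pi * (\<xi> \<bullet> (x + y))))"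
    unfolding FT_def by (subst integral_mult_right_zero[symmetric]) (simp add: mult_ac)
  also have "\<dots> = (LINT \<xi>|lborel. LINT x|lborel. g \<xi> * f x * cis (- 2 * pi * (\<xi> \<bullet> (x + y))))"
    using f g by (intro lborel_pair.integral_swap_bounded[where B=1]) auto
  also have "\<dots> = (LINT \<xi>|lborel. FT f \<xi> * g \<xi> * cis (- 2 * pi * (y \<bullet> \<xi>)))"
  proof (rule Bochner_Integration.integral_cong[OF refl])
    fix \<xi>
    have "(LINT x|lborel. g \<xi> * f x * cis (- 2 * pi * (\<xi> \<bullet> (x + y))))
      = (LINT x|lborel. (g \<xi> * cis (- 2 * pi * (y \<bullet> \<xi>))) * (f x * cis (- 2 * pi * (x \<bullet> \<xi>))))"
      by (intro Bochner_Integration.integral_cong refl)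
         (simp add: cis_mult inner_add_right inner_commute algebra_simps)
    also have "\<dots> = FT f \<xi> * g \<xi> * cis (- 2 * pi * (y \<bullet> \<xi>))"
      by (subst integral_mult_right_zero) (simp add: FT_def mult_ac)
    finally show "(LINT x|lborel. g \<xi> * f x * cis (- 2 * pi * (\<xi> \<bullet> (x + y)))) = \<dots>" .
  qed
  finally show ?thesis .
qed

section \<open>Complex Gaussians\<close>

definition gauss :: "complex \<Rightarrow> 'a::euclidean_space \<Rightarrow> complex" where
  "gauss w x = exp (- (of_real pi * w * of_real ((norm x)\<^sup>2)))"

lemma gauss_measurable [measurable]: "gauss w \<in> borel_measurable borel"
  unfolding gauss_def[abs_def] by measurable

lemma gauss_mult: "gauss v x * gauss w x = gauss (v + w) x"
  by (simp add: gauss_def exp_add[symmetric] algebra_simps)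

lemma prod_gauss: "(\<Prod>i\<in>A. gauss (w i) x) = gauss (\<Sum>i\<in>A. w i) x"
  by (induction A rule: infinite_finite_induct) (simp_all add: gauss_mult, simp_all add: gauss_def)

lemma gauss_scaleR: "gauss w (r *\<^sub>R x) = gauss (of_real (r\<^sup>2) * w) x"
  by (simp add: gauss_def power_mult_distrib mult_ac)

lemma cnj_gauss: "cnj (gauss w x) = gauss (cnj w) x"
  by (simp add: gauss_def exp_cnj)

lemma norm_gauss: "norm (gauss w x) = exp (- (pi * Re w * (norm x)\<^sup>2))"
  by (simp add: gauss_def norm_exp_eq_Re power2_eq_square)

lemma norm_gauss_mono: "Re w \<le> Re v \<Longrightarrow> norm (gauss v x) \<le> norm (gauss w x)"
  by (simp add: norm_gauss mult_left_mono mult_right_mono)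

lemma gauss_of_real: "gauss (of_real r) x = of_real (exp (- (pi * r * (norm x)\<^sup>2)))"
  by (simp add: gauss_def exp_of_real[symmetric])

lemma rapid_decay_gauss:
  assumes w: "Re w > 0" shows "rapid_decay (gauss w)"
  unfolding rapid_decay_def
proof (intro conjI allI)
  fix N :: nat
  let ?c = "pi * Re w"
  have c: "?c > 0" using w by simp
  have "(1 + norm x) ^ N * norm (gauss w x) \<le> exp ((real N)\<^sup>2 / (4 * ?c))" for x :: 'a
  proof -
    have "0 \<le> (2 * ?c * norm x - real N)\<^sup>2" by simp
    then have "4 * ?c * (real N * norm x - ?c * (norm x)\<^sup>2) \<le> (real N)\<^sup>2"
      by (simp add: power2_diff power_mult_distrib algebra_simps power2_eq_square)
    then have exponent: "real N * norm x - ?c * (norm x)\<^sup>2 \<le> (real N)\<^sup>2 / (4 * ?c)"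
      using c by (simp add: pos_le_divide_eq mult.commute)
    have "(1 + norm x) ^ N \<le> exp (norm x) ^ N" by (intro power_mono) (auto intro: exp_ge_add_one_self)
    also have "\<dots> = exp (real N * norm x)" by (simp add: exp_of_nat_mult)
    finally have "(1 + norm x) ^ N * norm (gauss w x) \<le> exp (real N * norm x) * exp (- (?c * (norm x)\<^sup>2))"
      unfolding norm_gauss by (intro mult_right_mono) auto
    also have "\<dots> = exp (real N * norm x - ?c * (norm x)\<^sup>2)" by (simp add: exp_add[symmetric])
    also have "\<dots> \<le> exp ((real N)\<^sup>2 / (4 * ?c))" using exponent by simp
    finally show ?thesis .
  qed
  then show "\<exists>C. \<forall>x::'a. (1 + norm x) ^ N * norm (gauss w x) \<le> C" by blast
qed simp

lemma integrable_gauss: "Re w > 0 \<Longrightarrow> integrable lborel (gauss w)"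
  by (intro rapid_decay_integrable rapid_decay_gauss)

lemma gauss_has_directional_derivative:
  fixes w :: complex
  shows "(gauss w has_directional_derivative (\<lambda>x. (- 2 * pi * w) * (complex_of_real (x \<bullet> b) * gauss w x))) b"
proof -
  have "((\<lambda>x. complex_of_real (x \<bullet> x)) has_directional_derivative (\<lambda>x. complex_of_real (2 * (x \<bullet> b)))) b"
    unfolding has_directional_derivative_def
  proof
    fix x
    have square: "(x + t *\<^sub>R b) \<bullet> (x + t *\<^sub>R b) = x \<bullet> x + t * (2 * (x \<bullet> b)) + t\<^sup>2 * (b \<bullet> b)" for t
      by (simp add: inner_add_left inner_add_right inner_commute algebra_simps power2_eq_square)
    show "((\<lambda>t. complex_of_real ((x + t *\<^sub>R b) \<bullet> (x + t *\<^sub>R b))) has_vector_derivative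
        complex_of_real (2 * (x \<bullet> b))) (at 0)"
      unfolding square by (intro has_vector_derivative_of_real) (auto intro!: derivative_eq_intros)
  qed
  from has_directional_derivative_exp[OF has_directional_derivative_cmult[OF this, of "- (of_real pi * w)"]]
  show ?thesis
    by (simp add: gauss_def[abs_def] power2_norm_eq_inner mult_ac)
qed

text \<open>On each line through the origin both sides solve the same linear differential equation.\<close>

lemma FT_gauss:
  fixes \<xi> :: "'a::euclidean_space"
  assumes w: "Re w > 0"
  shows "FT (gauss w) \<xi> = FT (gauss w) (0::'a) * gauss (1 / w) \<xi>"
proof -
  have w0: "w \<noteq> 0" using w by auto
  note decay = rapid_decay_gauss[OF w, where ?'a='a]
  let ?g' = "\<lambda>x. (- 2 * pi * w) * (complex_of_real (x \<bullet> \<xi>) * gauss w x)"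
  let ?h = "\<lambda>t::real. FT (gauss w) (t *\<^sub>R \<xi>) * exp (of_real pi / w * of_real t ^ 2 * of_real (\<xi> \<bullet> \<xi>))"
  have "((\<lambda>t. FT (gauss w) (t *\<^sub>R \<xi>)) has_vector_derivative
      - (2 * pi / w) * complex_of_real (t * (\<xi> \<bullet> \<xi>)) * FT (gauss w) (t *\<^sub>R \<xi>)) (at t)" for t
  proof -
    have "FT (\<lambda>x. (- 2 * pi * \<i>) * (complex_of_real (x \<bullet> \<xi>) * gauss w x)) (t *\<^sub>R \<xi>) = (\<i> / w) * FT ?g' (t *\<^sub>R \<xi>)"
      unfolding FT_cmult[symmetric] using w0 by (simp add: field_simps)
    also have "\<dots> = - (2 * pi / w) * complex_of_real (t * (\<xi> \<bullet> \<xi>)) * FT (gauss w) (t *\<^sub>R \<xi>)"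
      unfolding FT_directional_derivative[OF decay rapid_decay_cmult[OF rapid_decay_inner_mult[OF decay]]
          gauss_has_directional_derivative] by (simp add: field_simps)
    finally show ?thesis
      using has_directional_derivative_line[OF FT_has_directional_derivative[OF decay, of \<xi>], of 0 t] by simp
  qed
  moreover have "((\<lambda>t. exp (of_real pi / w * of_real t ^ 2 * of_real (\<xi> \<bullet> \<xi>))) has_vector_derivative
      (2 * pi / w) * of_real t * of_real (\<xi> \<bullet> \<xi>)
          * exp (of_real pi / w * of_real t ^ 2 * of_real (\<xi> \<bullet> \<xi>))) (at t)" for t :: real
    by (rule has_vector_derivative_real_field) (use w0 in \<open>auto intro!: derivative_eq_intros\<close>)
  ultimately have "(?h has_vector_derivative 0) (at t within UNIV)" for t
    using has_vector_derivative_mult[of "\<lambda>t. FT (gauss w) (t *\<^sub>R \<xi>)" _ t UNIV] w0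
    by (fastforce simp: algebra_simps)
  then obtain c where "\<And>t. ?h t = c"
    using has_vector_derivative_zero_constant[of UNIV ?h] by auto
  then have "?h 1 = ?h 0" by (simp only:)
  then have "FT (gauss w) \<xi> * exp (of_real pi / w * of_real (\<xi> \<bullet> \<xi>)) = FT (gauss w) (0::'a)" by simp
  moreover have "exp (of_real pi / w * of_real (\<xi> \<bullet> \<xi>)) * gauss (1 / w) \<xi> = 1"
    by (simp add: gauss_def exp_add[symmetric] power2_norm_eq_inner)
  ultimately show ?thesis by (metis mult.assoc mult.right_neutral)
qed

lemma FT_0: "FT f 0 = (LINT x|lborel. f x)"
  by (simp add: FT_def)

lemma Re_inverse_pos: "Re w > 0 \<Longrightarrow> Re (1 / w) > 0"
  by (simp add: Re_divide sum_power2_gt_zero_iff)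

lemma FT_gauss_0_pairing:
  assumes w: "Re w > 0" and v: "Re v > 0"
  shows "FT (gauss w) (0::'a::euclidean_space) * FT (gauss (v + 1 / w)) (0::'a)
    = FT (gauss v) (0::'a) * FT (gauss (w + 1 / v)) (0::'a)"
proof -
  have "(LINT x|lborel. FT (gauss v) (0::'a) * (gauss w (x::'a) * gauss (1 / v) x))
      = (LINT x|lborel. FT (gauss w) (0::'a) * (gauss (1 / w) (x::'a) * gauss v x))"
    using FT_pairing[OF integrable_gauss[OF w] integrable_gauss[OF v], of "0::'a"]
    by (subst (asm) (1 2) FT_gauss) (auto simp: w v mult_ac)
  then show ?thesis by (simp add: gauss_mult FT_0 add.commute)
qed

lemma FT_gauss_0_scale:
  assumes r: "r > 0"
  shows "FT (gauss (of_real r * w)) (0::'a::euclidean_space)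
      = of_real (r powr (- (real DIM('a) / 2))) * FT (gauss w) (0::'a)"
proof -
  let ?c = "sqrt r"
  have c: "?c > 0" using r by simp
  have "(LINT x::'a|lborel. gauss w x)
      = (LINT x::'a|density (distr lborel borel (\<lambda>x. 0 + ?c *\<^sub>R x)) (\<lambda>_. \<bar>?c\<bar> ^ DIM('a)). gauss w x)"
    using c by (subst lborel_affine[of ?c "0::'a"]) auto
  also have "\<dots> = of_real (?c ^ DIM('a)) * (LINT x::'a|lborel. gauss (of_real r * w) x)"
    using c r by (simp add: integral_density integral_distr gauss_scaleR scaleR_conv_of_real)
  also have "?c ^ DIM('a) = r powr (real DIM('a) / 2)"
    using r c by (simp add: powr_realpow[symmetric] powr_half_sqrt[symmetric] powr_powr)
  finally show ?thesis
    using r by (simp add: FT_0 powr_minus)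
qed

lemma FT_gauss_0_tendsto:
  assumes w: "Re w > 0" and v: "Re v \<ge> 0"
  shows "(\<lambda>k. FT (gauss (w + of_real (inverse (real (Suc k))) * v)) (0::'a::euclidean_space))
      \<longlonglongrightarrow> FT (gauss w) (0::'a)"
  unfolding FT_0
proof (rule integral_dominated_convergence[where w="\<lambda>x. norm (gauss w x)"])
  show "integrable lborel (\<lambda>x::'a. norm (gauss w x))"
    by (intro integrable_norm integrable_gauss w)
  have "(\<lambda>k. w + of_real (inverse (real (Suc k))) * v) \<longlonglongrightarrow> w + of_real 0 * v"
    by (intro tendsto_intros LIMSEQ_inverse_real_of_nat)
  then show "AE x in lborel. (\<lambda>k. gauss (w + of_real (inverse (real (Suc k))) * v) x) \<longlonglongrightarrow> gauss w (x::'a)"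
    unfolding gauss_def by (intro AE_I2 tendsto_intros) simp
  show "AE x in lborel. norm (gauss (w + of_real (inverse (real (Suc k))) * v) (x::'a)) \<le> norm (gauss w x)" for k
    using v by (intro AE_I2 norm_gauss_mono) simp
qed measurable

lemma FT_gauss_1_0: "FT (gauss 1) (0::'a::euclidean_space) = 1"
proof -
  have "normal_density 0 (1 / sqrt (2 * pi)) = (\<lambda>t::real. exp (- (pi * t\<^sup>2)))"
    by (auto simp: normal_density_def real_sqrt_divide power_divide field_simps)
  then have one_dim: "(\<integral>\<^sup>+ t. ennreal (exp (- (pi * t\<^sup>2))) \<partial>lborel) = 1"
    using nn_integral_eq_integral[OF integrable_normal_density[of "1 / sqrt (2 * pi)" 0]]
      integral_normal_density[of "1 / sqrt (2 * pi)" 0] by (simp del: integral_normal_density)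
  have "exp (- (pi * (norm x)\<^sup>2)) = (\<Prod>b\<in>Basis. exp (- (pi * (x \<bullet> b)\<^sup>2)))" for x :: 'a
    unfolding power2_norm_eq_inner euclidean_inner[of x x]
    by (simp add: exp_sum[symmetric] sum_negf sum_distrib_left power2_eq_square)
  then have "(\<integral>\<^sup>+ x. ennreal (exp (- (pi * (norm (x::'a))\<^sup>2))) \<partial>lborel)
      = (\<integral>\<^sup>+ x. (\<Prod>b\<in>Basis. ennreal (exp (- (pi * ((x::'a) \<bullet> b)\<^sup>2)))) \<partial>lborel)"
    by (simp add: prod_ennreal)
  also have "\<dots> = (\<Prod>b\<in>(Basis::'a set). \<integral>\<^sup>+ t. ennreal (exp (- (pi * t\<^sup>2))) \<partial>lborel)"
    by (rule nn_integral_lborel_prod) auto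
  finally have "has_bochner_integral lborel (\<lambda>x::'a. exp (- (pi * (norm x)\<^sup>2))) 1"
    by (intro has_bochner_integral_nn_integral) (auto simp: one_dim)
  then have "(LINT x::'a|lborel. exp (- (pi * (norm x)\<^sup>2))) = 1"
    by (rule has_bochner_integral_integral_eq)
  then show ?thesis
    using gauss_of_real[of 1, where ?'a='a] by (simp add: FT_0)
qed

text \<open>Fourier inversion at \<open>0\<close>, obtained by letting \<open>t\<close> tend to \<open>0\<close> in
  \<open>FT_gauss_0_pairing\<close> for \<open>v = t\<close>.\<close>

lemma FT_gauss_0_inverse:
  assumes w: "Re w > 0"
  shows "FT (gauss w) (0::'a::euclidean_space) * FT (gauss (1 / w)) (0::'a) = 1"
proof -
  have "FT (gauss w) (0::'a) * FT (gauss (1 / w + of_real t)) (0::'a) = FT (gauss (1 + of_real t * w)) (0::'a)"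
    if t: "t > 0" for t
  proof -
    have "FT (gauss (of_real t * 1)) (0::'a) * FT (gauss (of_real (1 / t) * (1 + of_real t * w))) (0::'a)
        = of_real (t powr (- (real DIM('a) / 2)) * (1 / t) powr (- (real DIM('a) / 2)))
            * FT (gauss (1 + of_real t * w)) (0::'a)"
      using FT_gauss_0_scale[of t 1, where ?'a='a] FT_gauss_0_scale[of "1 / t" "1 + of_real t * w", where ?'a='a] t
      by (simp add: FT_gauss_1_0)
    also have "t powr (- (real DIM('a) / 2)) * (1 / t) powr (- (real DIM('a) / 2)) = 1"
      using t by (simp add: powr_mult[symmetric])
    finally show ?thesis
      using FT_gauss_0_pairing[OF w, of "of_real t", where ?'a='a] t by (simp add: field_simps)
  qed
  from this[of "inverse (real (Suc k))" for k]
  have "(\<lambda>k. FT (gauss (1 + of_real (inverse (real (Suc k))) * w)) (0::'a))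
      \<longlonglongrightarrow> FT (gauss w) (0::'a) * FT (gauss (1 / w)) (0::'a)"
    using tendsto_mult_left[OF FT_gauss_0_tendsto[OF Re_inverse_pos[OF w], of 1, where ?'a='a],
        of "FT (gauss w) (0::'a)"]
    by (simp del: of_nat_Suc)
  from LIMSEQ_unique[OF this FT_gauss_0_tendsto] show ?thesis
    using w by (simp add: FT_gauss_1_0)
qed

lemma gauss_eq_FT:
  fixes x :: "'a::euclidean_space"
  assumes "Re w > 0"
  shows "gauss w x = FT (gauss w) (0::'a) * FT (gauss (1 / w)) x"
  using FT_gauss[OF Re_inverse_pos[OF assms], of x] FT_gauss_0_inverse[OF assms, where ?'a='a]
  by (simp flip: mult.assoc)

text \<open>Parseval's identity, i.e. \<open>FT_gauss_0_pairing\<close> for \<open>v = 1 / cnj w\<close>, reduces the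
  modulus to integrals of real Gaussians.\<close>

lemma norm_FT_gauss_0:
  assumes w: "Re w > 0"
  shows "norm (FT (gauss w) (0::'a::euclidean_space)) = norm w powr (- (real DIM('a) / 2))"
proof -
  let ?c = "\<lambda>w. norm (FT (gauss w) (0::'a))" and ?n = "real DIM('a) / 2"
  have w0: "w \<noteq> 0" using w by auto
  let ?r = "2 * Re w" and ?r' = "2 * Re w / (norm w)\<^sup>2"
  have real: "?c (of_real r) = r powr (- ?n)" if "r > 0" for r
    using FT_gauss_0_scale[OF that, of 1, where ?'a='a] by (simp add: FT_gauss_1_0)
  have r: "?r > 0" "?r' > 0" using w w0 by auto
  have "FT (gauss (1 / cnj w)) (0::'a) = cnj (FT (gauss (1 / w)) (0::'a))"
    using Bochner_Integration.integral_cnj[of lborel "gauss (1 / w) :: 'a \<Rightarrow> complex"]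
    by (simp add: FT_0 cnj_gauss[abs_def])
  then have inverse: "?c w * ?c (1 / cnj w) = 1"
    using arg_cong[OF FT_gauss_0_inverse[OF w, where ?'a='a], of norm] by (simp add: norm_mult)
  have sum: "w + cnj w = of_real ?r" by (simp add: complex_add_cnj)
  then have "1 / cnj w + 1 / w = of_real ?r'"
    using w0 by (simp add: add_frac_eq add.commute mult.commute flip: complex_norm_square)
  then have "?c w * ?c (of_real ?r') = ?c (1 / cnj w) * ?c (of_real ?r)"
    using arg_cong[OF FT_gauss_0_pairing[of w "1 / cnj w", where ?'a='a], of norm] w sum
    by (simp add: norm_mult Re_divide sum_power2_gt_zero_iff)
  then have "?c w * (?c w * ?r' powr (- ?n)) = (?c w * ?c (1 / cnj w)) * ?r powr (- ?n)"
    unfolding real[OF r(1)] real[OF r(2)] by simp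
  then have "(?c w)\<^sup>2 * ?r powr (- ?n) = ((norm w)\<^sup>2) powr (- ?n) * ?r powr (- ?n)"
    using w w0 unfolding inverse by (simp add: powr_divide power2_eq_square field_simps)
  then have "(?c w)\<^sup>2 = ((norm w)\<^sup>2) powr (- ?n)"
    using w by simp
  also have "\<dots> = (norm w powr (- ?n))\<^sup>2"
    using w0 by (simp add: power2_eq_square powr_mult)
  finally show ?thesis by (simp add: power2_eq_iff_nonneg)
qed

section \<open>Gaussian multipliers\<close>

lemma measurable_vec_nth [measurable]: "(\<lambda>x::'a::euclidean_space^'l. x $ i) \<in> borel \<rightarrow>\<^sub>M borel"
  by (intro borel_measurable_continuous_onI continuous_intros)

lemma measurable_vec_lambda_PiM:
  "(\<lambda>f. \<chi> i. f i) \<in> (\<Pi>\<^sub>M i\<in>(UNIV::'l::finite set). lborel) \<rightarrow>\<^sub>M (borel :: ('a::euclidean_space^'l) measure)"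
proof (subst borel_measurable_euclidean_space, intro ballI)
  fix c :: "'a^'l" assume "c \<in> Basis"
  then obtain i b where c: "c = axis i b" "b \<in> Basis" by (auto simp: Basis_vec_def)
  have "(\<lambda>f. f i) \<in> (\<Pi>\<^sub>M i\<in>(UNIV::'l set). lborel) \<rightarrow>\<^sub>M (borel :: 'a measure)"
    using measurable_component_singleton[of i UNIV "\<lambda>_. lborel"] by simp
  then show "(\<lambda>f. (\<chi> i. f i) \<bullet> c) \<in> borel_measurable (\<Pi>\<^sub>M i\<in>(UNIV::'l set). (lborel :: 'a measure))"
    unfolding c by (simp add: inner_axis)
qed

lemma prod_Basis_vec:
  "(\<Prod>b\<in>(Basis :: ('a::euclidean_space^'l) set). x \<bullet> b) = (\<Prod>i\<in>UNIV. \<Prod>b\<in>Basis. x $ i \<bullet> b)"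
proof -
  have Basis: "(Basis :: ('a^'l) set) = (\<lambda>(i, b). axis i b) ` (UNIV \<times> Basis)"
    by (auto simp: Basis_vec_def)
  have "inj_on (\<lambda>(i, b). axis i b :: 'a^'l) (UNIV \<times> Basis)"
    by (auto simp: inj_on_def axis_eq_axis nonzero_Basis)
  then show ?thesis
    unfolding Basis
    by (subst prod.reindex) (simp_all add: prod.cartesian_product comp_def case_prod_beta inner_axis)
qed

lemma lborel_vec_eq_distr_PiM:
  "(lborel :: ('a::euclidean_space^'l) measure) = distr (\<Pi>\<^sub>M i\<in>UNIV. lborel) borel (\<lambda>f. \<chi> i. f i)"
proof (rule lborel_eqI)
  interpret product_sigma_finite "\<lambda>_::'l. lborel :: 'a measure" by standard
  fix l u :: "'a^'l"
  assume le: "\<And>b. b \<in> Basis \<Longrightarrow> l \<bullet> b \<le> u \<bullet> b"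
  have component_le: "l $ i \<bullet> b \<le> u $ i \<bullet> b" if "b \<in> Basis" for i b
    using le[of "axis i b"] that by (simp add: inner_axis axis_in_Basis_iff)
  have "(\<lambda>f. \<chi> i. f i) -` box l u \<inter> space (\<Pi>\<^sub>M i\<in>(UNIV::'l set). (lborel::'a measure))
      = (\<Pi>\<^sub>E i\<in>UNIV. box (l $ i) (u $ i))"
    by (auto simp: space_PiM mem_box Basis_vec_def inner_axis PiE_iff)
  then have "emeasure (distr (\<Pi>\<^sub>M i\<in>UNIV. lborel) borel (\<lambda>f. \<chi> i. f i)) (box l u)
     = emeasure (\<Pi>\<^sub>M i\<in>(UNIV::'l set). lborel) (\<Pi>\<^sub>E i\<in>UNIV. box (l $ i) (u $ i))"
    by (subst emeasure_distr[OF measurable_vec_lambda_PiM]) auto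
  also have "\<dots> = (\<Prod>i\<in>UNIV. emeasure lborel (box (l $ i) (u $ i)))"
    by (rule emeasure_PiM) auto
  also have "\<dots> = (\<Prod>i\<in>UNIV. ennreal (\<Prod>b\<in>Basis. (u $ i - l $ i) \<bullet> b))"
    using component_le by (simp add: emeasure_lborel_box)
  also have "\<dots> = ennreal (\<Prod>i\<in>UNIV. \<Prod>b\<in>Basis. (u $ i - l $ i) \<bullet> b)"
    using component_le by (subst prod_ennreal) (auto intro!: prod_nonneg simp: inner_diff_left)
  finally show "emeasure (distr (\<Pi>\<^sub>M i\<in>UNIV. lborel) borel (\<lambda>f. \<chi> i. f i)) (box l u)
      = ennreal (\<Prod>b\<in>Basis. (u - l) \<bullet> b)"
    by (simp add: prod_Basis_vec)
qed simp

lemma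
  fixes g :: "'l::finite \<Rightarrow> 'a::euclidean_space \<Rightarrow> complex"
  assumes g: "\<And>i. integrable lborel (g i)"
  shows integrable_vec_prod: "integrable lborel (\<lambda>\<xi>. \<Prod>i\<in>UNIV. g i (\<xi> $ i))"
    and integral_vec_prod: "(LINT \<xi>|lborel. (\<Prod>i\<in>UNIV. g i (\<xi> $ i))) = (\<Prod>i\<in>UNIV. LINT x|lborel. g i x)"
proof -
  interpret product_sigma_finite "\<lambda>_::'l. lborel :: 'a measure" by standard
  have [measurable]: "g i \<in> borel_measurable borel" for i
    using borel_measurable_integrable[OF g[of i]] by simp
  show "integrable lborel (\<lambda>\<xi>. \<Prod>i\<in>UNIV. g i (\<xi> $ i))"
    using g by (simp add: lborel_vec_eq_distr_PiM integrable_distr_eq[OF measurable_vec_lambda_PiM]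
        product_integrable_prod)
  show "(LINT \<xi>|lborel. (\<Prod>i\<in>UNIV. g i (\<xi> $ i))) = (\<Prod>i\<in>UNIV. LINT x|lborel. g i x)"
    using g by (simp add: lborel_vec_eq_distr_PiM integral_distr[OF measurable_vec_lambda_PiM]
        product_integral_prod)
qed

lemma prod_cis: "(\<Prod>i\<in>A. cis (h i)) = cis (\<Sum>i\<in>A. h i)"
  by (induction A rule: infinite_finite_induct) (auto simp: cis_mult)

lemma integral_prod_FT_sum:
  fixes g :: "'l::finite \<Rightarrow> 'a::euclidean_space \<Rightarrow> complex"
  assumes g: "\<And>i. integrable lborel (g i)" and h: "integrable lborel h"
  shows "(LINT \<eta>|lborel. (\<Prod>i\<in>UNIV. g i (\<eta> $ i)) * FT h (\<Sum>i\<in>UNIV. \<eta> $ i) * cis (2 * pi * (x \<bullet> (\<Sum>i\<in>UNIV. \<eta> $ i))))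
    = (LINT y|lborel. h y * (\<Prod>i\<in>UNIV. FT (g i) (y - x)))"
proof -
  let ?P = "\<lambda>\<eta>::'a^'l. \<Prod>i\<in>UNIV. g i (\<eta> $ i)" and ?S = "\<lambda>\<eta>::'a^'l. \<Sum>i\<in>UNIV. \<eta> $ i"
  let ?k = "\<lambda>y \<eta>. cis (- 2 * pi * ((y - x) \<bullet> ?S \<eta>))"
  have "(LINT \<eta>|lborel. ?P \<eta> * FT h (?S \<eta>) * cis (2 * pi * (x \<bullet> ?S \<eta>)))
      = (LINT \<eta>|lborel. LINT y|lborel. h y * ?P \<eta> * ?k y \<eta>)"
  proof (rule Bochner_Integration.integral_cong[OF refl])
    fix \<eta>
    have "(LINT y|lborel. h y * ?P \<eta> * ?k y \<eta>)
        = (LINT y|lborel. (?P \<eta> * cis (2 * pi * (x \<bullet> ?S \<eta>))) * (h y * cis (- 2 * pi * (y \<bullet> ?S \<eta>))))"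
      by (intro Bochner_Integration.integral_cong refl) (simp add: cis_mult inner_diff_left algebra_simps)
    also have "\<dots> = ?P \<eta> * cis (2 * pi * (x \<bullet> ?S \<eta>)) * FT h (?S \<eta>)"
      by (simp only: integral_mult_right_zero FT_def)
    finally show "?P \<eta> * FT h (?S \<eta>) * cis (2 * pi * (x \<bullet> ?S \<eta>)) = (LINT y|lborel. h y * ?P \<eta> * ?k y \<eta>)"
      by (simp only: mult_ac)
  qed
  also have "\<dots> = (LINT y|lborel. LINT \<eta>|lborel. h y * ?P \<eta> * ?k y \<eta>)"
    by (rule lborel_pair.integral_swap_bounded[where B=1]) (auto intro!: h integrable_vec_prod g)
  also have "\<dots> = (LINT y|lborel. h y * (\<Prod>i\<in>UNIV. FT (g i) (y - x)))"
  proof (rule Bochner_Integration.integral_cong[OF refl])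
    fix y
    have "?k y \<eta> = (\<Prod>i\<in>UNIV. cis (- 2 * pi * (\<eta> $ i \<bullet> (y - x))))" for \<eta>
      by (simp add: prod_cis inner_sum_right sum_distrib_left inner_commute)
    then have "(LINT \<eta>|lborel. h y * ?P \<eta> * ?k y \<eta>)
      = (LINT \<eta>|lborel. h y * (\<Prod>i\<in>UNIV. g i (\<eta> $ i) * cis (- 2 * pi * (\<eta> $ i \<bullet> (y - x)))))"
      by (simp add: prod.distrib mult_ac)
    also have "\<dots> = h y * (\<Prod>i\<in>UNIV. FT (g i) (y - x))"
      unfolding FT_def integral_mult_right_zero by (subst integral_vec_prod) (auto intro!: integrable_mult_cis g)
    finally show "(LINT \<eta>|lborel. h y * ?P \<eta> * ?k y \<eta>) = h y * (\<Prod>i\<in>UNIV. FT (g i) (y - x))" .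
  qed
  finally show ?thesis .
qed

lemma gauss_convolution:
  fixes x :: "'a::euclidean_space"
  assumes \<alpha>: "Re \<alpha> > 0" and \<beta>: "Re \<beta> > 0"
  shows "(LINT y|lborel. gauss \<alpha> y * gauss \<beta> (y - x))
    = FT (gauss \<alpha>) (0::'a) * FT (gauss \<beta>) (0::'a) * FT (gauss (1 / \<alpha> + 1 / \<beta>)) (0::'a)
        * gauss (1 / (1 / \<alpha> + 1 / \<beta>)) x"
proof -
  let ?\<gamma> = "1 / \<alpha> + 1 / \<beta>"
  have \<gamma>: "Re ?\<gamma> > 0" using Re_inverse_pos[OF \<alpha>] Re_inverse_pos[OF \<beta>] by simp
  have "gauss \<alpha> y * gauss \<beta> (y - x) = FT (gauss \<beta>) (0::'a) * (gauss \<alpha> y * FT (gauss (1 / \<beta>)) (y + (- x)))" for y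
    by (simp add: gauss_eq_FT[OF \<beta>, of "y - x"])
  then have "(LINT y|lborel. gauss \<alpha> y * gauss \<beta> (y - x))
      = FT (gauss \<beta>) (0::'a) * (LINT y|lborel. gauss \<alpha> y * FT (gauss (1 / \<beta>)) (y + (- x)))"
    by (simp only: integral_mult_right_zero)
  also have "(LINT y|lborel. gauss \<alpha> y * FT (gauss (1 / \<beta>)) (y + (- x)))
      = (LINT \<xi>|lborel. FT (gauss \<alpha>) \<xi> * gauss (1 / \<beta>) \<xi> * cis (- 2 * pi * ((- x) \<bullet> \<xi>)))"
    by (intro FT_pairing integrable_gauss \<alpha> Re_inverse_pos \<beta>)
  also have "\<dots> = (LINT \<xi>|lborel. FT (gauss \<alpha>) (0::'a) * (gauss ?\<gamma> \<xi> * cis (- 2 * pi * (\<xi> \<bullet> (- x)))))"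
  proof (rule Bochner_Integration.integral_cong[OF refl])
    fix \<xi>
    show "FT (gauss \<alpha>) \<xi> * gauss (1 / \<beta>) \<xi> * cis (- 2 * pi * ((- x) \<bullet> \<xi>))
        = FT (gauss \<alpha>) (0::'a) * (gauss ?\<gamma> \<xi> * cis (- 2 * pi * (\<xi> \<bullet> (- x))))"
      unfolding FT_gauss[OF \<alpha>, of \<xi>] gauss_mult[symmetric] by (simp add: inner_commute)
  qed
  also have "\<dots> = FT (gauss \<alpha>) (0::'a) * FT (gauss ?\<gamma>) (- x)"
    by (simp only: integral_mult_right_zero FT_def)
  also have "FT (gauss ?\<gamma>) (- x) = FT (gauss ?\<gamma>) (0::'a) * gauss (1 / ?\<gamma>) x"
    by (subst FT_gauss[OF \<gamma>]) (simp add: gauss_def)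
  finally show ?thesis by (simp add: mult_ac)
qed

lemma norm_gauss_form_integral:
  fixes x :: "'a::euclidean_space" and b :: "'l::finite \<Rightarrow> complex"
  assumes b: "\<And>i. Re (b i) > 0" and v: "Re v > 0"
  defines "\<beta> \<equiv> (\<Sum>i\<in>UNIV. 1 / b i)"
  shows "norm (LINT \<eta>|lborel. (\<Prod>i\<in>UNIV. gauss (b i) (\<eta> $ i)) * gauss v (\<Sum>i\<in>UNIV. \<eta> $ i)
           * cis (2 * pi * (x \<bullet> (\<Sum>i\<in>UNIV. \<eta> $ i))))
    = (\<Prod>i\<in>UNIV. norm (b i) powr (- (real DIM('a) / 2))) * norm (1 + \<beta> * v) powr (- (real DIM('a) / 2))
       * norm (gauss (\<beta> / (1 + \<beta> * v)) x)"
proof -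
  let ?c = "\<lambda>w. FT (gauss w) (0::'a)" and ?P = "\<lambda>\<eta>::'a^'l. \<Prod>i\<in>UNIV. gauss (b i) (\<eta> $ i)"
    and ?S = "\<lambda>\<eta>::'a^'l. \<Sum>i\<in>UNIV. \<eta> $ i"
  have \<beta>: "Re \<beta> > 0" unfolding \<beta>_def Re_sum by (intro sum_pos Re_inverse_pos b) auto
  have \<beta>0: "\<beta> \<noteq> 0" using \<beta> by auto
  have v': "Re (1 / v) > 0" "Re (v + 1 / \<beta>) > 0" using v Re_inverse_pos[OF v] Re_inverse_pos[OF \<beta>] by auto
  have product: "gauss (1 / v) y * (\<Prod>i\<in>(UNIV::'l set). FT (gauss (b i)) (y - x))
      = (\<Prod>i\<in>(UNIV::'l set). ?c (b i)) * (gauss (1 / v) y * gauss \<beta> (y - x))" for y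
  proof -
    have "FT (gauss (b i)) (y - x) = ?c (b i) * gauss (1 / b i) (y - x)" for i by (rule FT_gauss[OF b])
    then have "(\<Prod>i\<in>(UNIV::'l set). FT (gauss (b i)) (y - x)) = (\<Prod>i\<in>(UNIV::'l set). ?c (b i)) * gauss \<beta> (y - x)"
      by (simp only: prod.distrib prod_gauss \<beta>_def)
    then show ?thesis by (simp only: mult.left_commute)
  qed
  have "?P \<eta> * gauss v (?S \<eta>) * z = ?c v * (?P \<eta> * FT (gauss (1 / v)) (?S \<eta>) * z)" for \<eta> z
    by (simp add: gauss_eq_FT[OF v, of "?S \<eta>"])
  then have "(LINT \<eta>|lborel. ?P \<eta> * gauss v (?S \<eta>) * cis (2 * pi * (x \<bullet> ?S \<eta>)))
      = ?c v * (LINT \<eta>|lborel. ?P \<eta> * FT (gauss (1 / v)) (?S \<eta>) * cis (2 * pi * (x \<bullet> ?S \<eta>)))"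
    by (simp only: integral_mult_right_zero)
  also have "\<dots> = ?c v * (LINT y|lborel. gauss (1 / v) y * (\<Prod>i\<in>(UNIV::'l set). FT (gauss (b i)) (y - x)))"
    by (subst integral_prod_FT_sum) (auto intro!: integrable_gauss b v')
  also have "\<dots> = ?c v * ((\<Prod>i\<in>(UNIV::'l set). ?c (b i)) * (LINT y|lborel. gauss (1 / v) y * gauss \<beta> (y - x)))"
    by (simp only: product integral_mult_right_zero)
  also have "\<dots> = (?c v * ?c (1 / v)) * (\<Prod>i\<in>(UNIV::'l set). ?c (b i)) * (?c \<beta> * ?c (v + 1 / \<beta>))
      * gauss (1 / (v + 1 / \<beta>)) x"
    using gauss_convolution[OF v'(1) \<beta>, of x] by simp
  also have "1 / (v + 1 / \<beta>) = \<beta> / (1 + \<beta> * v)" using \<beta>0 by (simp add: field_simps)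
  finally have "norm (LINT \<eta>|lborel. ?P \<eta> * gauss v (?S \<eta>) * cis (2 * pi * (x \<bullet> ?S \<eta>)))
      = (\<Prod>i\<in>(UNIV::'l set). norm (?c (b i))) * norm (?c \<beta> * ?c (v + 1 / \<beta>)) * norm (gauss (\<beta> / (1 + \<beta> * v)) x)"
    by (simp add: FT_gauss_0_inverse[OF v] norm_mult prod_norm)
  also have "norm (?c \<beta> * ?c (v + 1 / \<beta>)) = norm (1 + \<beta> * v) powr (- (real DIM('a) / 2))"
  proof -
    have "1 + \<beta> * v = \<beta> * (v + 1 / \<beta>)" using \<beta>0 by (simp add: field_simps)
    then show ?thesis by (simp only: norm_mult norm_FT_gauss_0[OF \<beta>] norm_FT_gauss_0[OF v'(2)] powr_mult)
  qed
  finally show ?thesis by (simp add: norm_FT_gauss_0[OF b])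
qed

definition modulated_gauss :: "'a::euclidean_space \<Rightarrow> complex \<Rightarrow> 'a \<Rightarrow> complex" where
  "modulated_gauss a w x = cis (2 * pi * (x \<bullet> a)) * gauss w x"

lemma norm_modulated_gauss: "norm (modulated_gauss a w x) = norm (gauss w x)"
  by (simp add: modulated_gauss_def norm_mult)

lemma modulated_gauss_has_directional_derivative:
  fixes w :: complex
  shows "(modulated_gauss a w has_directional_derivative
    (\<lambda>x. (2 * pi * \<i> * complex_of_real (b \<bullet> a)) * modulated_gauss a w x
       + (- 2 * pi * w) * (complex_of_real (x \<bullet> b) * modulated_gauss a w x))) b"
proof -
  have cis: "cis (2 * pi * (x \<bullet> a)) = exp (2 * pi * \<i> * complex_of_real (x \<bullet> a))" for x
    by (simp add: cis_conv_exp mult_ac)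
  from has_directional_derivative_mult[OF has_directional_derivative_exp[OF has_directional_derivative_cmult[OF
        has_directional_derivative_inner[of a b]], of "2 * pi * \<i>"] gauss_has_directional_derivative[of w b]]
  show ?thesis
    unfolding modulated_gauss_def[abs_def] cis by (simp add: algebra_simps)
qed

lemma schwartz_modulated_gauss:
  assumes w: "Re w > 0" shows "schwartz (modulated_gauss a w)"
proof (rule schwartz_polynomial_multiplesI)
  show "continuous_on UNIV (modulated_gauss a w)"
    unfolding modulated_gauss_def[abs_def] gauss_def cis_conv_exp by (intro continuous_intros)
  show "rapid_decay (modulated_gauss a w)"
    unfolding modulated_gauss_def[abs_def]
    by (rule rapid_decay_mult[where K=1 and M=0]) (auto intro: rapid_decay_gauss w)
  show "\<exists>f'\<in>polynomial_multiples (modulated_gauss a w).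
      (modulated_gauss a w has_directional_derivative f') b" for b
    by (rule bexI, rule modulated_gauss_has_directional_derivative, intro polynomial_multiples.intros)
qed

lemma FT_modulated_gauss:
  fixes \<xi> :: "'a::euclidean_space"
  assumes "Re w > 0"
  shows "FT (modulated_gauss a w) \<xi> = FT (gauss w) (0::'a) * gauss (1 / w) (\<xi> - a)"
proof -
  have "FT (modulated_gauss a w) \<xi> = FT (gauss w) (\<xi> - a)"
    unfolding FT_def modulated_gauss_def
    by (intro Bochner_Integration.integral_cong refl) (simp add: cis_mult inner_diff_right algebra_simps)
  then show ?thesis using FT_gauss[OF assms] by simp
qed

definition form_gauss :: "('a::real_normed_vector \<Rightarrow> 'a \<Rightarrow> complex) \<Rightarrow> 'a \<Rightarrow> 'a \<Rightarrow> complex" where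
  "form_gauss B a \<xi> = exp (- B (\<xi> - a) (\<xi> - a))"

definition weight_form :: "('l::finite \<Rightarrow> complex) \<Rightarrow> complex \<Rightarrow> real^'n^'l \<Rightarrow> real^'n^'l \<Rightarrow> complex" where
  "weight_form w v \<eta> \<zeta> = of_real pi * ((\<Sum>i\<in>UNIV. w i * of_real (\<eta> $ i \<bullet> \<zeta> $ i))
     + v * of_real ((\<Sum>i\<in>UNIV. \<eta> $ i) \<bullet> (\<Sum>i\<in>UNIV. \<zeta> $ i)))"

lemma exp_weight_form:
  "exp (- weight_form w v \<eta> \<eta>) = (\<Prod>i\<in>UNIV. gauss (w i) (\<eta> $ i)) * gauss v (\<Sum>i\<in>UNIV. \<eta> $ i)"
proof -
  have "(\<Prod>i\<in>UNIV. gauss (w i) (\<eta> $ i)) = exp (\<Sum>i\<in>UNIV. - (of_real pi * w i * of_real ((norm (\<eta> $ i))\<^sup>2)))"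
    unfolding gauss_def by (rule exp_sum[symmetric]) simp
  then show ?thesis
    by (simp add: weight_form_def gauss_def exp_add[symmetric] sum_negf sum_distrib_left power2_norm_eq_inner
        algebra_simps)
qed

lemma form_gauss_weight_form:
  "form_gauss (weight_form w v) a \<xi> = (\<Prod>i\<in>UNIV. gauss (w i) ((\<xi> - a) $ i)) * gauss v (\<Sum>i\<in>UNIV. (\<xi> - a) $ i)"
  by (simp add: form_gauss_def exp_weight_form)

definition dual_weight :: "('l::finite \<Rightarrow> complex) \<Rightarrow> complex" where
  "dual_weight w = of_real (\<Sum>i\<in>UNIV. 1 / (2 * Re (w i)))"

text \<open>The phases of the multiplier and of the test functions cancel, as \<open>w i + cnj (w i)\<close> is real.\<close>

lemma T_mult_form_gauss:
  fixes a :: "real^'n^'l" and x :: "real^'n"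
  assumes w: "\<And>i. Re (w i) > 0"
  shows "T_mult (form_gauss (weight_form w v) a) (\<lambda>i. modulated_gauss (a $ i) (1 / cnj (w i))) x
    = (\<Prod>i\<in>UNIV. FT (gauss (1 / cnj (w i))) (0::real^'n)) * cis (2 * pi * (x \<bullet> (\<Sum>i\<in>UNIV. a $ i)))
      * (LINT \<eta>|lborel. (\<Prod>i\<in>UNIV. gauss (of_real (2 * Re (w i))) (\<eta> $ i)) * gauss v (\<Sum>i\<in>UNIV. \<eta> $ i)
          * cis (2 * pi * (x \<bullet> (\<Sum>i\<in>UNIV. \<eta> $ i))))"
proof -
  let ?b = "\<lambda>i. complex_of_real (2 * Re (w i))" and ?c = "\<lambda>i. FT (gauss (1 / cnj (w i))) (0::real^'n)"
  let ?e = "\<lambda>\<eta>::real^'n^'l. cis (2 * pi * (x \<bullet> (\<Sum>i\<in>UNIV. \<eta> $ i)))"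
  let ?J = "\<lambda>\<eta>::real^'n^'l. (\<Prod>i\<in>UNIV. gauss (?b i) (\<eta> $ i)) * gauss v (\<Sum>i\<in>UNIV. \<eta> $ i) * ?e \<eta>"
  have w': "Re (1 / cnj (w i)) > 0" for i using Re_inverse_pos[of "cnj (w i)"] w by simp
  have "T_mult (form_gauss (weight_form w v) a) (\<lambda>i. modulated_gauss (a $ i) (1 / cnj (w i))) x
      = (LINT \<xi>|lborel. ((\<Prod>i\<in>UNIV. ?c i) * ?e a) * ?J (- a + \<xi>))"
    unfolding T_mult_def
  proof (rule Bochner_Integration.integral_cong[OF refl])
    fix \<xi> :: "real^'n^'l"
    have "FT (modulated_gauss (a $ i) (1 / cnj (w i))) (\<xi> $ i) * gauss (w i) ((\<xi> - a) $ i)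
        = ?c i * gauss (?b i) ((\<xi> - a) $ i)" for i
      by (subst FT_modulated_gauss[OF w']) (simp add: gauss_mult complex_add_cnj add.commute)
    then have phases: "(\<Prod>i\<in>UNIV. FT (modulated_gauss (a $ i) (1 / cnj (w i))) (\<xi> $ i))
        * (\<Prod>i\<in>UNIV. gauss (w i) ((\<xi> - a) $ i))
        = (\<Prod>i\<in>UNIV. ?c i) * (\<Prod>i\<in>UNIV. gauss (?b i) ((\<xi> - a) $ i))"
      by (simp only: prod.distrib[symmetric])
    have "?e \<xi> = ?e a * ?e (\<xi> - a)"
      by (simp add: cis_mult sum_subtractf inner_diff_right algebra_simps)
    then show "(\<Prod>i\<in>UNIV. FT (modulated_gauss (a $ i) (1 / cnj (w i))) (\<xi> $ i))
        * form_gauss (weight_form w v) a \<xi> * ?e \<xi>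
        = ((\<Prod>i\<in>UNIV. ?c i) * ?e a) * ?J (- a + \<xi>)"
      using phases by (simp add: form_gauss_weight_form mult_ac flip: diff_conv_add_uminus)
  qed
  also have "\<dots> = ((\<Prod>i\<in>UNIV. ?c i) * ?e a) * (LINT \<eta>|lborel. ?J \<eta>)"
    by (simp only: integral_mult_right_zero) (subst lborel_integral_translate, measurable)
  finally show ?thesis .
qed

lemma norm_T_mult_form_gauss:
  fixes a :: "real^'n^'l" and x :: "real^'n"
  assumes w: "\<And>i. Re (w i) > 0" and v: "Re v > 0"
  shows "norm (T_mult (form_gauss (weight_form w v) a) (\<lambda>i. modulated_gauss (a $ i) (1 / cnj (w i))) x)
    = (\<Prod>i\<in>UNIV. (norm (w i) / (2 * Re (w i))) powr (real CARD('n) / 2))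
       * norm (1 + dual_weight w * v) powr (- (real CARD('n) / 2))
       * norm (gauss (dual_weight w / (1 + dual_weight w * v)) x)"
proof -
  let ?n = "real CARD('n) / 2" and ?b = "\<lambda>i. complex_of_real (2 * Re (w i))"
  let ?c = "\<lambda>i. FT (gauss (1 / cnj (w i))) (0::real^'n)"
  have w': "Re (1 / cnj (w i)) > 0" for i using Re_inverse_pos[of "cnj (w i)"] w by simp
  have "norm (T_mult (form_gauss (weight_form w v) a) (\<lambda>i. modulated_gauss (a $ i) (1 / cnj (w i))) x)
    = (\<Prod>i\<in>UNIV. norm (?c i))
        * ((\<Prod>i\<in>UNIV. norm (?b i) powr (- ?n)) * norm (1 + dual_weight w * v) powr (- ?n)
            * norm (gauss (dual_weight w / (1 + dual_weight w * v)) x))"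
    unfolding T_mult_form_gauss[OF w] using norm_gauss_form_integral[of ?b v x] w v
    by (simp add: norm_mult prod_norm dual_weight_def)
  also have "\<dots> = (\<Prod>i\<in>UNIV. norm (?c i) * norm (?b i) powr (- ?n)) * norm (1 + dual_weight w * v) powr (- ?n)
      * norm (gauss (dual_weight w / (1 + dual_weight w * v)) x)"
    by (simp only: prod.distrib mult.assoc)
  also have "(\<Prod>i\<in>UNIV. norm (?c i) * norm (?b i) powr (- ?n)) = (\<Prod>i\<in>UNIV. (norm (w i) / (2 * Re (w i))) powr ?n)"
  proof (rule prod.cong[OF refl])
    fix i
    have "norm (?c i) = norm (w i) powr ?n" "norm (?b i) = 2 * Re (w i)"
      using norm_FT_gauss_0[OF w'[of i], where ?'a="real^'n"] w[of i]
      by (simp_all add: norm_divide powr_divide powr_minus)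
    then show "norm (?c i) * norm (?b i) powr (- ?n) = (norm (w i) / (2 * Re (w i))) powr ?n"
      using w[of i] by (simp only: powr_divide powr_minus_divide) simp
  qed
  finally show ?thesis .
qed

section \<open>Lebesgue norms\<close>

lemma enn_root_mono: "p > 0 \<Longrightarrow> I \<le> J \<Longrightarrow> enn_root p I \<le> enn_root p J"
  by (auto simp: enn_root_def top_unique less_top intro!: ennreal_leI powr_mono2 enn2real_mono)

lemma enn_root_powr: "p > 0 \<Longrightarrow> X \<ge> 0 \<Longrightarrow> enn_root p (ennreal (X powr p)) = ennreal X"
  by (simp add: enn_root_def powr_powr)

lemma enn_root_powr_cancel: "p > 0 \<Longrightarrow> I < top \<Longrightarrow> ennreal (enn2real (enn_root p I) powr p) = I"
  by (simp add: enn_root_def powr_powr)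

lemma Lp_norm_le_iff:
  assumes p: "p > 0" and X: "X \<ge> 0"
  shows "Lp_norm p f \<le> ennreal X \<longleftrightarrow> (\<integral>\<^sup>+ x. ennreal (norm (f x) powr p) \<partial>lborel) \<le> ennreal (X powr p)"
proof
  let ?I = "\<integral>\<^sup>+ x. ennreal (norm (f x) powr p) \<partial>lborel"
  assume le: "Lp_norm p f \<le> ennreal X"
  then have fin: "?I < top" by (auto simp: Lp_norm_def enn_root_def less_top top_unique split: if_splits)
  have "ennreal (enn2real (Lp_norm p f) powr p) \<le> ennreal (X powr p)"
    using le p X by (intro ennreal_leI powr_mono2 enn2real_leI) auto
  then show "?I \<le> ennreal (X powr p)"
    unfolding Lp_norm_def enn_root_powr_cancel[OF p fin] .
next
  assume "(\<integral>\<^sup>+ x. ennreal (norm (f x) powr p) \<partial>lborel) \<le> ennreal (X powr p)"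
  then show "Lp_norm p f \<le> ennreal X"
    unfolding Lp_norm_def using enn_root_mono[OF p] enn_root_powr[OF p X] by metis
qed

lemma Lp_norm_mono:
  assumes "p > 0" "\<And>x. norm (f x) \<le> norm (g x)"
  shows "Lp_norm p f \<le> Lp_norm p g"
  unfolding Lp_norm_def using assms
  by (intro enn_root_mono nn_integral_mono ennreal_leI powr_mono2) auto

lemma Lp_norm_cmult:
  assumes p: "p > 0" and [measurable]: "f \<in> borel_measurable borel"
  shows "Lp_norm p (\<lambda>x. c * f x) = ennreal (norm c) * Lp_norm p f"
proof -
  let ?I = "\<integral>\<^sup>+ x. ennreal (norm (f x) powr p) \<partial>lborel"
  have "(\<integral>\<^sup>+ x. ennreal (norm (c * f x) powr p) \<partial>lborel)
      = (\<integral>\<^sup>+ x. ennreal (norm c powr p) * ennreal (norm (f x) powr p) \<partial>lborel)"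
    by (simp add: norm_mult powr_mult ennreal_mult)
  also have "\<dots> = ennreal (norm c powr p) * ?I"
    by (rule nn_integral_cmult) measurable
  finally show ?thesis
    using p by (auto simp: Lp_norm_def enn_root_def ennreal_mult_eq_top_iff ennreal_mult_top enn2real_mult
        powr_mult powr_powr ennreal_mult)
qed

lemma powr_above_tangent:
  fixes c x u :: real
  assumes c: "c > 0" and x: "x \<ge> 0" and u: "u \<ge> 1"
  shows "c powr u + u * c powr (u - 1) * (x - c) \<le> x powr u"
proof (cases "x = 0")
  case True
  have "c powr u = c powr (u - 1) * c" using c by (simp add: powr_diff)
  then have "c powr u + u * c powr (u - 1) * (x - c) = c powr u * (1 - u)"
    using True by (simp add: algebra_simps)
  also have "\<dots> \<le> x powr u" using True u by (simp add: mult_nonneg_nonpos)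
  finally show ?thesis .
next
  case False
  have "x powr u - c powr u \<ge> u * c powr (u - 1) * (x - c)"
  proof (rule convex_on_imp_above_tangent[where A="{0<..}"])
    show "convex_on {0<..} (\<lambda>x::real. x powr u)" using u by (rule powr_convex)
    show "((\<lambda>x. x powr u) has_real_derivative u * c powr (u - 1)) (at c within {0<..})"
      using c by (auto intro!: derivative_eq_intros simp: powr_diff)
  qed (use c x False in \<open>auto simp: interior_open\<close>)
  then show ?thesis by simp
qed

lemma powr_convex_combination_le:
  fixes a b x y u :: real
  assumes "a \<ge> 0" "b \<ge> 0" "a + b = 1" "x \<ge> 0" "y \<ge> 0" and u: "u \<ge> 1"
  shows "(a * x + b * y) powr u \<le> a * x powr u + b * y powr u"
proof (cases "a * x + b * y = 0")
  case False
  let ?c = "a * x + b * y"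
  have c: "?c > 0" using False assms by (simp add: order_less_le)
  have "?c powr u = a * (?c powr u + u * ?c powr (u - 1) * (x - ?c))
      + b * (?c powr u + u * ?c powr (u - 1) * (y - ?c))"
    using \<open>a + b = 1\<close> by algebra
  also have "\<dots> \<le> a * x powr u + b * y powr u"
    using assms by (intro add_mono mult_left_mono powr_above_tangent[OF c])
  finally show ?thesis .
qed (use assms in simp)

lemma nn_integral_powr_add_le:
  fixes f g :: "'a::euclidean_space \<Rightarrow> complex"
  assumes [measurable]: "f \<in> borel_measurable borel" "g \<in> borel_measurable borel"
    and ab: "a > 0" "b > 0" and p: "p \<ge> 1"
    and f: "(\<integral>\<^sup>+ x. ennreal (norm (f x) powr p) \<partial>lborel) \<le> ennreal (a powr p)"
    and g: "(\<integral>\<^sup>+ x. ennreal (norm (g x) powr p) \<partial>lborel) \<le> ennreal (b powr p)"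
  shows "(\<integral>\<^sup>+ x. ennreal (norm (f x + g x) powr p) \<partial>lborel) \<le> ennreal ((a + b) powr p)"
proof -
  define A B where AB_def: "A = (a + b) powr p * (a / (a + b) / a powr p)"
    "B = (a + b) powr p * (b / (a + b) / b powr p)"
  have nonneg: "A \<ge> 0" "B \<ge> 0" using ab by (auto simp: AB_def)
  have pointwise: "norm (f x + g x) powr p \<le> A * norm (f x) powr p + B * norm (g x) powr p" for x
  proof -
    have "a + b \<noteq> 0" using ab by simp
    then have "norm (f x + g x) \<le> (a + b) * (a / (a + b) * (norm (f x) / a) + b / (a + b) * (norm (g x) / b))"
      using ab norm_triangle_ineq[of "f x" "g x"] by (simp add: distrib_left)
    then have "norm (f x + g x) powr p
        \<le> ((a + b) * (a / (a + b) * (norm (f x) / a) + b / (a + b) * (norm (g x) / b))) powr p"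
      using p by (intro powr_mono2) auto
    also have "\<dots> = (a + b) powr p * (a / (a + b) * (norm (f x) / a) + b / (a + b) * (norm (g x) / b)) powr p"
      by (rule powr_mult)
    also have "\<dots> \<le> (a + b) powr p
        * (a / (a + b) * (norm (f x) / a) powr p + b / (a + b) * (norm (g x) / b) powr p)"
      using ab p by (intro mult_left_mono powr_convex_combination_le) (auto simp: add_divide_distrib[symmetric])
    also have "\<dots> = A * norm (f x) powr p + B * norm (g x) powr p"
      using ab by (simp add: AB_def powr_divide algebra_simps)
    finally show ?thesis .
  qed
  have "(\<integral>\<^sup>+ x. ennreal (norm (f x + g x) powr p) \<partial>lborel)
     \<le> (\<integral>\<^sup>+ x. ennreal A * ennreal (norm (f x) powr p) + ennreal B * ennreal (norm (g x) powr p) \<partial>lborel)"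
    using pointwise nonneg
    by (intro nn_integral_mono)
      (simp add: ennreal_mult[symmetric] ennreal_plus[symmetric] ennreal_leI del: ennreal_plus)
  also have "\<dots> = ennreal A * (\<integral>\<^sup>+ x. ennreal (norm (f x) powr p) \<partial>lborel)
      + ennreal B * (\<integral>\<^sup>+ x. ennreal (norm (g x) powr p) \<partial>lborel)"
    by (subst nn_integral_add, measurable, subst nn_integral_cmult, measurable, subst nn_integral_cmult,
        measurable)
  also have "\<dots> \<le> ennreal A * ennreal (a powr p) + ennreal B * ennreal (b powr p)"
    by (intro add_mono mult_left_mono f g) auto
  also have "\<dots> = ennreal (A * a powr p + B * b powr p)"
    using nonneg by (simp only: ennreal_mult ennreal_plus powr_ge_zero mult_nonneg_nonneg)
  also have "A * a powr p + B * b powr p = (a + b) powr p * (a / (a + b) + b / (a + b))"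
    using ab by (simp add: AB_def distrib_left)
  also have "\<dots> = (a + b) powr p" using ab by (simp add: add_divide_distrib[symmetric])
  finally show ?thesis .
qed

theorem Minkowski_Lp_norm:
  fixes f g :: "'a::euclidean_space \<Rightarrow> complex"
  assumes f: "f \<in> borel_measurable borel" and g: "g \<in> borel_measurable borel" and p: "p \<ge> 1"
  shows "Lp_norm p (\<lambda>x. f x + g x) \<le> Lp_norm p f + Lp_norm p g"
proof (cases "Lp_norm p f = top \<or> Lp_norm p g = top")
  case False
  have p0: "p > 0" using p by simp
  obtain a b where a: "Lp_norm p f = ennreal a" "a \<ge> 0" and b: "Lp_norm p g = ennreal b" "b \<ge> 0"
    using False by (metis ennreal_cases)
  show ?thesis
  proof (rule ennreal_le_epsilon)
    fix e :: real assume e: "0 < e"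
    have pos: "a + e / 2 > 0" "b + e / 2 > 0" using a b e by auto
    have "Lp_norm p f \<le> ennreal (a + e / 2)" "Lp_norm p g \<le> ennreal (b + e / 2)"
      using a b e by (auto intro!: ennreal_leI)
    then have "Lp_norm p (\<lambda>x. f x + g x) \<le> ennreal ((a + e / 2) + (b + e / 2))"
      using pos nn_integral_powr_add_le[OF f g pos p] by (simp add: Lp_norm_le_iff[OF p0])
    then show "Lp_norm p (\<lambda>x. f x + g x) \<le> Lp_norm p f + Lp_norm p g + ennreal e"
      using a b e by (simp add: ennreal_plus[symmetric] del: ennreal_plus) (simp add: algebra_simps)
  qed
qed auto

lemma nn_integral_norm_gauss_powr:
  assumes w: "Re w > 0" and p: "p > 0"
  shows "(\<integral>\<^sup>+ x. ennreal (norm (gauss w (x::'a::euclidean_space)) powr p) \<partial>lborel)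
    = ennreal ((p * Re w) powr (- (real DIM('a) / 2)))"
proof -
  let ?r = "p * Re w"
  have r: "Re (of_real ?r) > 0" using assms by simp
  have "norm (gauss w x) powr p = norm (gauss (of_real ?r) x)" for x :: 'a
    by (simp add: norm_gauss powr_def mult_ac)
  then have "(\<integral>\<^sup>+ x. ennreal (norm (gauss w (x::'a)) powr p) \<partial>lborel)
      = ennreal (LINT x::'a|lborel. norm (gauss (of_real ?r) x))"
    by (simp only:) (intro nn_integral_eq_integral integrable_norm integrable_gauss r, simp)
  also have "(LINT x::'a|lborel. norm (gauss (of_real ?r) x)) = norm (FT (gauss (of_real ?r)) (0::'a))"
    by (simp add: FT_0 gauss_of_real del: of_real_mult)
  finally show ?thesis
    using assms norm_FT_gauss_0[OF r, where ?'a='a] by (simp del: of_real_mult)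
qed

lemma Lp_norm_gauss:
  assumes w: "Re w > 0" and p: "p > 0"
  shows "Lp_norm p (gauss w :: 'a::euclidean_space \<Rightarrow> complex)
      = ennreal ((p * Re w) powr (- (real DIM('a) / (2 * p))))"
  using p by (simp add: Lp_norm_def nn_integral_norm_gauss_powr[OF assms] enn_root_def powr_powr mult.commute)

section \<open>Convolution with finite measures\<close>

definition measure_convolution :: "'a::euclidean_space measure \<Rightarrow> ('a \<Rightarrow> complex) \<Rightarrow> 'a \<Rightarrow> complex" where
  "measure_convolution \<kappa> E x = (LINT y|\<kappa>. E (x - y))"

lemma measure_convolution_measurable [measurable]:
  assumes "finite_measure \<kappa>" and [measurable_cong]: "sets \<kappa> = sets borel"
    and [measurable]: "E \<in> borel_measurable borel"
  shows "measure_convolution \<kappa> E \<in> borel_measurable borel"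
proof -
  interpret finite_measure \<kappa> by fact
  show ?thesis unfolding measure_convolution_def[abs_def] by measurable
qed

lemma (in finite_measure) powr_integral_le:
  assumes X: "X \<in> borel_measurable M" "\<And>x. 0 \<le> X x" "\<And>x. X x \<le> B" and u: "u \<ge> (1::real)"
  shows "(LINT x|M. X x) powr u \<le> measure M (space M) powr (u - 1) * (LINT x|M. X x powr u)"
proof (cases "(LINT x|M. X x) = 0")
  case True
  then show ?thesis using u by (auto intro!: mult_nonneg_nonneg integral_nonneg_AE)
next
  case False
  note [measurable] = X(1)
  let ?m = "measure M (space M)"
  have int: "integrable M X" using X by (intro integrable_const_bound[of _ B]) auto
  have int_powr: "integrable M (\<lambda>x. X x powr u)"
    using X u by (intro integrable_const_bound[of _ "B powr u"]) (auto intro!: powr_mono2)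
  have pos: "(LINT x|M. X x) > 0" using False X by (simp add: order_less_le integral_nonneg_AE)
  have "?m \<noteq> 0"
  proof
    assume "?m = 0"
    then have "AE x in M. False"
      by (intro AE_I[of _ _ "space M"]) (auto simp: emeasure_eq_measure)
    then have "(LINT x|M. X x) = 0" by (intro integral_eq_zero_AE) auto
    then show False using False by simp
  qed
  then have m: "?m > 0" by (simp add: zero_less_measure_iff)
  define c where "c = (LINT x|M. X x) / ?m"
  have c: "c > 0" using pos m by (simp add: c_def)
  have "?m * c powr u = (LINT x|M. c powr u + u * c powr (u - 1) * (X x - c))"
    using int m by (simp add: c_def)
  also have "\<dots> \<le> (LINT x|M. X x powr u)"
    using int int_powr X(2) u by (intro integral_mono powr_above_tangent[OF c]) auto
  finally have mean: "?m * c powr u \<le> (LINT x|M. X x powr u)" .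
  have "(LINT x|M. X x) powr u = ?m powr (u - 1) * (?m * c powr u)"
    using m pos by (simp add: c_def powr_divide powr_diff)
  also have "\<dots> \<le> ?m powr (u - 1) * (LINT x|M. X x powr u)"
    using mean by (intro mult_left_mono) auto
  finally show ?thesis .
qed

lemma norm_measure_convolution_powr_le:
  assumes \<kappa>: "finite_measure \<kappa>" and [measurable_cong]: "sets \<kappa> = sets borel"
    and [measurable]: "E \<in> borel_measurable borel" and E: "\<And>x. norm (E x) \<le> B" and u: "u \<ge> 1"
  shows "ennreal (norm (measure_convolution \<kappa> E x) powr u)
    \<le> ennreal (measure \<kappa> UNIV powr (u - 1)) * (\<integral>\<^sup>+ y. ennreal (norm (E (x - y)) powr u) \<partial>\<kappa>)"
proof -
  interpret finite_measure \<kappa> by fact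
  have space: "space \<kappa> = UNIV" using sets_eq_imp_space_eq[of \<kappa> borel] by (simp add: assms)
  have int: "integrable \<kappa> (\<lambda>y. norm (E (x - y)) powr u)"
    using E u by (intro integrable_const_bound[of _ "B powr u"]) (auto intro!: powr_mono2)
  have "norm (measure_convolution \<kappa> E x) powr u \<le> (LINT y|\<kappa>. norm (E (x - y))) powr u"
    unfolding measure_convolution_def using u by (intro powr_mono2 integral_norm_bound) auto
  also have "\<dots> \<le> measure \<kappa> UNIV powr (u - 1) * (LINT y|\<kappa>. norm (E (x - y)) powr u)"
    using powr_integral_le[of "\<lambda>y. norm (E (x - y))" B u] E u by (simp add: space)
  finally show ?thesis
    using int by (simp add: nn_integral_eq_integral integral_nonneg_AE ennreal_leI flip: ennreal_mult)
qed

lemma lborel_nn_integral_translate: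
  fixes f :: "'a::euclidean_space \<Rightarrow> ennreal"
  assumes "f \<in> borel_measurable borel"
  shows "(\<integral>\<^sup>+ x. f (c + x) \<partial>lborel) = (\<integral>\<^sup>+ x. f x \<partial>lborel)"
  using nn_integral_distr[of "(+) c" lborel borel f] assms by (simp add: lborel_distr_plus)

lemma Young_Lp_norm_measure_convolution:
  assumes \<kappa>: "finite_measure \<kappa>" and [measurable_cong]: "sets \<kappa> = sets borel"
    and [measurable]: "E \<in> borel_measurable borel" and E: "\<And>x. norm (E x) \<le> B" and u: "u \<ge> 1"
  shows "Lp_norm u (measure_convolution \<kappa> E) \<le> ennreal (measure \<kappa> UNIV) * Lp_norm u E"
proof -
  interpret finite_measure \<kappa> by fact
  interpret pair_sigma_finite \<kappa> "lborel :: 'a measure" by standard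
  let ?m = "measure \<kappa> UNIV" and ?E = "\<lambda>x. ennreal (norm (E x) powr u)"
  have space: "space \<kappa> = UNIV" using sets_eq_imp_space_eq[of \<kappa> borel] by (simp add: assms)
  have translate: "(\<integral>\<^sup>+ x. ?E (x - y) \<partial>lborel) = (\<integral>\<^sup>+ x. ?E x \<partial>lborel)" for y
    using lborel_nn_integral_translate[of ?E "- y"] by simp
  have "(\<integral>\<^sup>+ x. ennreal (norm (measure_convolution \<kappa> E x) powr u) \<partial>lborel)
     \<le> (\<integral>\<^sup>+ x. ennreal (?m powr (u - 1)) * (\<integral>\<^sup>+ y. ?E (x - y) \<partial>\<kappa>) \<partial>lborel)"
    using norm_measure_convolution_powr_le[OF assms] by (intro nn_integral_mono)
  also have "\<dots> = ennreal (?m powr (u - 1)) * (\<integral>\<^sup>+ x. (\<integral>\<^sup>+ y. ?E (x - y) \<partial>\<kappa>) \<partial>lborel)"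
    by (rule nn_integral_cmult) measurable
  also have "(\<integral>\<^sup>+ x. (\<integral>\<^sup>+ y. ?E (x - y) \<partial>\<kappa>) \<partial>lborel) = (\<integral>\<^sup>+ y. (\<integral>\<^sup>+ x. ?E (x - y) \<partial>lborel) \<partial>\<kappa>)"
    by (rule Fubini') measurable
  also have "\<dots> = (\<integral>\<^sup>+ y. (\<integral>\<^sup>+ x. ?E x \<partial>lborel) \<partial>\<kappa>)"
    by (simp only: translate)
  also have "\<dots> = (\<integral>\<^sup>+ x. ?E x \<partial>lborel) * ennreal ?m"
    by (simp add: emeasure_eq_measure space)
  also have "ennreal (?m powr (u - 1)) * ((\<integral>\<^sup>+ x. ?E x \<partial>lborel) * ennreal ?m)
      = ennreal (?m powr u) * (\<integral>\<^sup>+ x. ?E x \<partial>lborel)"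
  proof -
    have "?m powr u = ?m powr (u - 1) * ?m" by (cases "?m = 0") (auto simp: powr_diff)
    then show ?thesis by (simp add: ennreal_mult mult_ac)
  qed
  also have "\<dots> = (\<integral>\<^sup>+ x. ennreal (norm (of_real ?m * E x) powr u) \<partial>lborel)"
    by (simp add: norm_mult powr_mult ennreal_mult nn_integral_cmult)
  finally have "Lp_norm u (measure_convolution \<kappa> E) \<le> Lp_norm u (\<lambda>x. of_real ?m * E x)"
    unfolding Lp_norm_def using u by (intro enn_root_mono) auto
  then show ?thesis using Lp_norm_cmult[of u E "of_real ?m"] u by simp
qed

definition has_weak_FT :: "('a::euclidean_space \<Rightarrow> complex) \<Rightarrow> ('a \<Rightarrow> complex) \<Rightarrow> bool" where
  "has_weak_FT G h \<longleftrightarrow> G \<in> borel_measurable borel \<and>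
     (\<forall>\<phi>. schwartz \<phi> \<longrightarrow> integrable lborel (\<lambda>x. G x * FT \<phi> x) \<and> integrable lborel (\<lambda>\<xi>. h \<xi> * \<phi> \<xi>) \<and>
        (LINT x|lborel. G x * FT \<phi> x) = (LINT \<xi>|lborel. h \<xi> * \<phi> \<xi>))"

lemma has_weak_FT_cmult:
  assumes "has_weak_FT G h" shows "has_weak_FT (\<lambda>x. c * G x) (\<lambda>\<xi>. c * h \<xi>)"
  using assms by (auto simp: has_weak_FT_def mult.assoc)

lemma has_weak_FT_add:
  assumes "has_weak_FT G h" "has_weak_FT G' h'"
  shows "has_weak_FT (\<lambda>x. G x + G' x) (\<lambda>\<xi>. h \<xi> + h' \<xi>)"
  using assms by (auto simp: has_weak_FT_def distrib_right)

lemma integrable_translate_prod: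
  fixes E :: "'a::euclidean_space \<Rightarrow> complex"
  assumes "finite_measure \<kappa>" and [measurable_cong]: "sets \<kappa> = sets borel"
    and E: "integrable lborel E" and [measurable]: "k \<in> borel_measurable borel" and k: "\<And>x. norm (k x) \<le> B"
  shows "integrable (\<kappa> \<Otimes>\<^sub>M lborel) (\<lambda>(y, x). E (x - y) * k x)"
proof -
  interpret finite_measure \<kappa> by fact
  interpret pair_sigma_finite \<kappa> "lborel :: 'a measure" by standard
  have [measurable]: "E \<in> borel_measurable borel"
    using borel_measurable_integrable[OF E] by simp
  have bound: "norm (E (x - y) * k x) \<le> B * norm (E (x - y))" for x y
    using mult_right_mono[OF k[of x], of "norm (E (x - y))"] by (simp add: norm_mult mult.commute)
  have int_E: "integrable lborel (\<lambda>x. B * norm (E (x - y)))" for y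
    using lborel_integrable_translate[OF E, of "- y"] by simp
  have int: "integrable lborel (\<lambda>x. E (x - y) * k x)" for y
    using bound by (intro Bochner_Integration.integrable_bound[OF int_E[of y]])
      (auto intro: order_trans[OF _ abs_ge_self])
  show ?thesis
  proof (rule Fubini_integrable)
    show "integrable \<kappa> (\<lambda>y. LINT x|lborel. norm (case (y, x) of (y, x) \<Rightarrow> E (x - y) * k x))"
    proof (rule integrable_const_bound[of _ "B * (LINT x|lborel. norm (E x))"], rule AE_I2)
      fix y
      have "(LINT x|lborel. norm (E (x - y) * k x)) \<le> (LINT x|lborel. B * norm (E (x - y)))"
        using bound by (intro integral_mono integrable_norm int int_E)
      also have "\<dots> = B * (LINT x|lborel. norm (E x))"
        using lborel_integral_translate[of "\<lambda>x. norm (E x)" "- y"] by simp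
      finally show "norm (LINT x|lborel. norm (case (y, x) of (y, x) \<Rightarrow> E (x - y) * k x))
          \<le> B * (LINT x|lborel. norm (E x))"
        by (simp add: integral_nonneg_AE)
    qed measurable
  qed (use int in simp_all)
qed

lemma has_weak_FT_measure_convolution:
  fixes E :: "'a::euclidean_space \<Rightarrow> complex"
  assumes \<kappa>: "finite_measure \<kappa>" and sets[measurable_cong]: "sets \<kappa> = sets borel" and E: "integrable lborel E"
  shows "has_weak_FT (measure_convolution \<kappa> E) (\<lambda>\<xi>. (LINT y|\<kappa>. cis (- 2 * pi * (y \<bullet> \<xi>))) * FT E \<xi>)"
proof -
  interpret finite_measure \<kappa> by fact
  interpret pair_sigma_finite \<kappa> "lborel :: 'a measure" by standard
  have [measurable]: "E \<in> borel_measurable borel" using borel_measurable_integrable[OF E] by simp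
  let ?h = "\<lambda>\<xi>. LINT y|\<kappa>. cis (- 2 * pi * (y \<bullet> \<xi>))"
  have "integrable lborel (\<lambda>x. measure_convolution \<kappa> E x * FT \<phi> x) \<and> integrable lborel (\<lambda>\<xi>. ?h \<xi> * FT E \<xi> * \<phi> \<xi>) \<and>
        (LINT x|lborel. measure_convolution \<kappa> E x * FT \<phi> x) = (LINT \<xi>|lborel. ?h \<xi> * FT E \<xi> * \<phi> \<xi>)"
    if "schwartz \<phi>" for \<phi>
  proof -
    have \<phi>: "integrable lborel \<phi>" using that by (intro rapid_decay_integrable schwartz_imp_rapid_decay)
    have [measurable]: "\<phi> \<in> borel_measurable borel" using borel_measurable_integrable[OF \<phi>] by simp
    have int: "integrable (\<kappa> \<Otimes>\<^sub>M lborel) (\<lambda>(y, x). E (x - y) * FT \<phi> x)"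
      using norm_FT_le[OF \<phi>] by (intro integrable_translate_prod \<kappa> sets E) auto
    have "integrable lborel (\<lambda>\<xi>. FT E \<xi> * \<phi> \<xi>)"
      using norm_FT_le[OF E] by (intro Bochner_Integration.integrable_bound[OF integrable_mult_right[OF \<phi>,
            of "of_real (LINT x|lborel. norm (E x))"]])
                (auto simp: norm_mult integral_nonneg_AE intro!: AE_I2 mult_right_mono)
    then have int': "integrable (\<kappa> \<Otimes>\<^sub>M lborel) (\<lambda>(y, \<xi>). 1 * (FT E \<xi> * \<phi> \<xi>) * cis (- 2 * pi * (y \<bullet> \<xi>)))"
      by (intro integrable_prod_bounded[where B=1]) auto
    have conv: "measure_convolution \<kappa> E x * FT \<phi> x = (LINT y|\<kappa>. E (x - y) * FT \<phi> x)" for x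
      by (simp add: measure_convolution_def)
    have symbol: "?h \<xi> * FT E \<xi> * \<phi> \<xi> = (LINT y|\<kappa>. 1 * (FT E \<xi> * \<phi> \<xi>) * cis (- 2 * pi * (y \<bullet> \<xi>)))" for \<xi>
      by (subst integral_mult_right_zero) (simp add: mult_ac)
    have translate: "(LINT x|lborel. E (x - y) * FT \<phi> x)
        = (LINT \<xi>|lborel. 1 * (FT E \<xi> * \<phi> \<xi>) * cis (- 2 * pi * (y \<bullet> \<xi>)))" for y
      using lborel_integral_translate[of "\<lambda>x. E (x - y) * FT \<phi> x" y] FT_pairing[OF E \<phi>, of y]
      by (simp add: add.commute)
    have "(LINT x|lborel. measure_convolution \<kappa> E x * FT \<phi> x) = (LINT \<xi>|lborel. ?h \<xi> * FT E \<xi> * \<phi> \<xi>)"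
      unfolding conv symbol
      using Fubini_integral[OF int] Fubini_integral[OF int'] by (simp only: translate split_conv)
    then show ?thesis
      using integrable_snd[OF int] integrable_snd[OF int'] unfolding conv symbol by simp
  qed
  then show ?thesis
    unfolding has_weak_FT_def using measure_convolution_measurable[OF \<kappa> sets] by simp
qed

section \<open>Fractional Sobolev norms by heat subordination\<close>

definition bessel_weight :: "'a::euclidean_space \<Rightarrow> real" where
  "bessel_weight \<xi> = 1 + 4 * pi\<^sup>2 * (norm \<xi>)\<^sup>2"

lemma bessel_weight_pos: "bessel_weight \<xi> > 0"
  by (simp add: bessel_weight_def add_pos_nonneg)

lemma sobolev_norm_le_weak_FT:
  assumes G: "has_weak_FT G (\<lambda>\<xi>. of_real (bessel_weight \<xi> powr (s / 2)) * FT F \<xi>)"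
  shows "sobolev_norm u s F \<le> Lp_norm u G"
proof (cases "Lp_norm u G = top")
  case False
  then show ?thesis
    using G unfolding sobolev_norm_def has_weak_FT_def bessel_weight_def
    by (intro INF_lower) (auto simp: less_top)
qed simp

definition std_gauss_measure :: "'a::euclidean_space measure" where
  "std_gauss_measure = density lborel (\<lambda>z. ennreal (norm (gauss 1 z)))"

lemma sets_std_gauss_measure [simp, measurable_cong]: "sets std_gauss_measure = sets borel"
  by (simp add: std_gauss_measure_def)

lemma space_std_gauss_measure [simp]: "space std_gauss_measure = UNIV"
  by (simp add: std_gauss_measure_def)

lemma prob_space_std_gauss_measure: "prob_space (std_gauss_measure :: 'a::euclidean_space measure)"
proof (rule prob_spaceI)
  have "(\<integral>\<^sup>+ z. ennreal (norm (gauss 1 (z::'a))) \<partial>lborel) = 1"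
    using nn_integral_norm_gauss_powr[of 1 1, where ?'a='a] by simp
  then show "emeasure (std_gauss_measure :: 'a measure) (space std_gauss_measure) = 1"
    unfolding std_gauss_measure_def by (subst emeasure_density) auto
qed

lemma std_gauss_measure_characteristic:
  "(LINT z|std_gauss_measure. cis (- 2 * pi * (z \<bullet> \<xi>))) = gauss 1 (\<xi>::'a::euclidean_space)"
proof -
  have "(LINT z|std_gauss_measure. cis (- 2 * pi * (z \<bullet> \<xi>)))
      = (LINT z|lborel. norm (gauss 1 z) *\<^sub>R cis (- 2 * pi * (z \<bullet> \<xi>)))"
    unfolding std_gauss_measure_def by (subst integral_density) auto
  also have "\<dots> = FT (gauss 1) \<xi>"
    using gauss_of_real[of 1, where ?'a='a] by (simp add: FT_def scaleR_conv_of_real)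
  also have "\<dots> = gauss 1 \<xi>"
    using FT_gauss[of 1 \<xi>] by (simp add: FT_gauss_1_0)
  finally show ?thesis .
qed

text \<open>The mixture of the heat kernels \<open>exp (t \<Delta>)\<close> over times \<open>t\<close> distributed according to \<open>\<rho>\<close>.\<close>

definition heat_mixture :: "real measure \<Rightarrow> 'a::euclidean_space measure" where
  "heat_mixture \<rho> = distr (\<rho> \<Otimes>\<^sub>M std_gauss_measure) borel (\<lambda>(t, z). sqrt (4 * pi * \<bar>t\<bar>) *\<^sub>R z)"

lemma sets_heat_mixture [simp, measurable_cong]: "sets (heat_mixture \<rho>) = sets borel"
  by (simp add: heat_mixture_def)

lemma
  assumes "finite_measure \<rho>" and sets[measurable_cong]: "sets \<rho> = sets borel"
  shows finite_measure_heat_mixture: "finite_measure (heat_mixture \<rho> :: 'a::euclidean_space measure)"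
    and measure_heat_mixture: "measure (heat_mixture \<rho> :: 'a measure) UNIV = measure \<rho> UNIV"
    and heat_mixture_characteristic: "(LINT y|heat_mixture \<rho>. cis (- 2 * pi * (y \<bullet> (\<xi>::'a))))
       = of_real (LINT t|\<rho>. exp (- (4 * pi\<^sup>2 * \<bar>t\<bar> * (norm \<xi>)\<^sup>2)))"
proof -
  let ?G = "std_gauss_measure :: 'a measure" and ?s = "\<lambda>t z. sqrt (4 * pi * \<bar>t\<bar>) *\<^sub>R z"
  interpret finite_measure \<rho> by fact
  interpret G: prob_space ?G by (rule prob_space_std_gauss_measure)
  interpret P: pair_sigma_finite \<rho> ?G by standard
  have space: "space \<rho> = UNIV" using sets_eq_imp_space_eq[OF sets] by simp
  have mass: "emeasure (\<rho> \<Otimes>\<^sub>M ?G) UNIV = emeasure \<rho> UNIV"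
    using G.emeasure_pair_measure_Times[OF sets.top sets.top, of \<rho>] G.emeasure_space_1 by (simp add: space)
  interpret Q: finite_measure "\<rho> \<Otimes>\<^sub>M ?G"
    by (intro finite_measureI) (simp add: space_pair_measure space mass)
  have [measurable]: "(\<lambda>(t, z). ?s t z) \<in> (\<rho> \<Otimes>\<^sub>M ?G) \<rightarrow>\<^sub>M borel" by measurable
  show "finite_measure (heat_mixture \<rho> :: 'a measure)"
    unfolding heat_mixture_def by (rule Q.finite_measure_distr) measurable
  have "emeasure (heat_mixture \<rho> :: 'a measure) UNIV = emeasure \<rho> UNIV"
    unfolding heat_mixture_def by (subst emeasure_distr) (auto simp: space_pair_measure space mass)
  then show "measure (heat_mixture \<rho> :: 'a measure) UNIV = measure \<rho> UNIV"
    by (simp add: measure_def)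
  have int: "integrable (\<rho> \<Otimes>\<^sub>M ?G) (\<lambda>(t, z). cis (- 2 * pi * (?s t z \<bullet> \<xi>)))"
    by (rule Q.integrable_const_bound[of _ 1]) (auto simp: case_prod_beta)
  have "(LINT y|heat_mixture \<rho>. cis (- 2 * pi * (y \<bullet> \<xi>)))
      = (LINT p|(\<rho> \<Otimes>\<^sub>M ?G). (case p of (t, z) \<Rightarrow> cis (- 2 * pi * (?s t z \<bullet> \<xi>))))"
    unfolding heat_mixture_def
    by (rule trans[OF integral_distr], measurable, rule Bochner_Integration.integral_cong[OF refl], auto)
  also have "\<dots> = (LINT t|\<rho>. LINT z|?G. cis (- 2 * pi * (?s t z \<bullet> \<xi>)))"
    using P.integral_fst'[OF int] by simp
  also have "\<dots> = (LINT t|\<rho>. of_real (exp (- (4 * pi\<^sup>2 * \<bar>t\<bar> * (norm \<xi>)\<^sup>2))))"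
  proof (rule Bochner_Integration.integral_cong[OF refl])
    fix t
    show "(LINT z|?G. cis (- 2 * pi * (?s t z \<bullet> \<xi>))) = of_real (exp (- (4 * pi\<^sup>2 * \<bar>t\<bar> * (norm \<xi>)\<^sup>2)))"
      using std_gauss_measure_characteristic[of "?s t \<xi>"] gauss_of_real[of 1 "?s t \<xi>"]
      by (simp add: power_mult_distrib power2_eq_square mult_ac)
  qed
  finally show "(LINT y|heat_mixture \<rho>. cis (- 2 * pi * (y \<bullet> \<xi>)))
      = of_real (LINT t|\<rho>. exp (- (4 * pi\<^sup>2 * \<bar>t\<bar> * (norm \<xi>)\<^sup>2)))"
    by simp
qed

definition heat_average :: "real measure \<Rightarrow> ('a::euclidean_space \<Rightarrow> complex) \<Rightarrow> 'a \<Rightarrow> complex" where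
  "heat_average \<rho> E = measure_convolution (heat_mixture \<rho>) E"

lemma Lp_norm_heat_average_le:
  assumes "finite_measure \<rho>" "sets \<rho> = sets borel" and E: "rapid_decay E" and u: "u \<ge> 1"
  shows "Lp_norm u (heat_average \<rho> E) \<le> ennreal (measure \<rho> UNIV) * Lp_norm u E"
proof -
  obtain B where "\<And>x. norm (E x) \<le> B" using rapid_decay_bounded[OF E] by blast
  from Young_Lp_norm_measure_convolution[OF finite_measure_heat_mixture[OF assms(1,2)] sets_heat_mixture
      rapid_decay_measurable[OF E] this u]
  show ?thesis unfolding heat_average_def measure_heat_mixture[OF assms(1,2)] .
qed

lemma heat_average_measurable:
  assumes "finite_measure \<rho>" "sets \<rho> = sets borel" "rapid_decay E"
  shows "heat_average \<rho> E \<in> borel_measurable borel"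
  unfolding heat_average_def
  by (intro measure_convolution_measurable finite_measure_heat_mixture sets_heat_mixture
      rapid_decay_measurable assms)

lemma has_weak_FT_heat_average:
  assumes "finite_measure \<rho>" "sets \<rho> = sets borel" and E: "rapid_decay E"
  shows "has_weak_FT (heat_average \<rho> E) (\<lambda>\<xi>. of_real (LINT t|\<rho>. exp (- (4 * pi\<^sup>2 * \<bar>t\<bar> * (norm \<xi>)\<^sup>2))) * FT E \<xi>)"
  using has_weak_FT_measure_convolution[OF finite_measure_heat_mixture[OF assms(1,2)] sets_heat_mixture
      rapid_decay_integrable[OF E]]
  unfolding heat_average_def heat_mixture_characteristic[OF assms(1,2)] .

text \<open>The operator \<open>\<integral> g(t) exp (- t (1 - \<Delta>)) dt\<close>.\<close>

definition bessel_average :: "(real \<Rightarrow> real) \<Rightarrow> ('a::euclidean_space \<Rightarrow> complex) \<Rightarrow> 'a \<Rightarrow> complex" where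
  "bessel_average g = heat_average (density lborel (\<lambda>t. ennreal (g t * exp (- t))))"

lemma
  assumes "integrable lborel g" "\<And>t. 0 \<le> g t"
  shows finite_measure_density_lborel: "finite_measure (density lborel (\<lambda>t::real. ennreal (g t)))"
    and measure_density_lborel: "measure (density lborel (\<lambda>t. ennreal (g t))) UNIV = (LINT t|lborel. g t)"
proof -
  have [measurable]: "g \<in> borel_measurable borel" using borel_measurable_integrable[OF assms(1)] by simp
  have emeasure: "emeasure (density lborel (\<lambda>t. ennreal (g t))) UNIV = ennreal (LINT t|lborel. g t)"
    using nn_integral_eq_integral[OF assms(1)] assms(2) by (subst emeasure_density) auto
  show "finite_measure (density lborel (\<lambda>t. ennreal (g t)))"
    by (rule finite_measureI) (simp add: emeasure)
  show "measure (density lborel (\<lambda>t. ennreal (g t))) UNIV = (LINT t|lborel. g t)"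
    using emeasure assms(2) by (simp add: measure_def integral_nonneg_AE)
qed

lemma Lp_norm_bessel_average_le:
  assumes "integrable lborel (\<lambda>t. g t * exp (- t))" "\<And>t. 0 \<le> g t" and "rapid_decay E" "u \<ge> 1"
  shows "Lp_norm u (bessel_average g E) \<le> ennreal (LINT t|lborel. g t * exp (- t)) * Lp_norm u E"
  unfolding bessel_average_def using assms
  by (subst measure_density_lborel[symmetric]) (auto intro!: Lp_norm_heat_average_le finite_measure_density_lborel)

lemma bessel_average_measurable:
  assumes "integrable lborel (\<lambda>t. g t * exp (- t))" "\<And>t. 0 \<le> g t" "rapid_decay E"
  shows "bessel_average g E \<in> borel_measurable borel"
  unfolding bessel_average_def using assms by (intro heat_average_measurable finite_measure_density_lborel) auto

lemma has_weak_FT_bessel_average: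
  assumes [measurable]: "g \<in> borel_measurable borel" and int: "integrable lborel (\<lambda>t. g t * exp (- t))"
    and g: "\<And>t. 0 \<le> g t" "\<And>t. t < 0 \<Longrightarrow> g t = 0" and E: "rapid_decay E"
  shows "has_weak_FT (bessel_average g E)
      (\<lambda>\<xi>. of_real (LINT t|lborel. g t * exp (- (bessel_weight \<xi> * t))) * FT E \<xi>)"
proof -
  let ?\<rho> = "density lborel (\<lambda>t. ennreal (g t * exp (- t)))"
  have nonneg: "0 \<le> g t * exp (- t)" for t using g(1) by simp
  have "(LINT t|?\<rho>. exp (- (4 * pi\<^sup>2 * \<bar>t\<bar> * (norm \<xi>)\<^sup>2)))
      = (LINT t|lborel. g t * exp (- (bessel_weight \<xi> * t)))" for \<xi> :: 'a
  proof -
    have weight: "(g t * exp (- t)) *\<^sub>R exp (- (4 * pi\<^sup>2 * \<bar>t\<bar> * (norm \<xi>)\<^sup>2))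
        = g t * exp (- (bessel_weight \<xi> * t))" for t
      using g(2)[of t] by (cases "t < 0") (simp_all add: bessel_weight_def mult.assoc algebra_simps flip: exp_add)
    show ?thesis
      using nonneg by (subst integral_density) (measurable, auto simp only: weight)
  qed
  then show ?thesis
    using has_weak_FT_heat_average[OF finite_measure_density_lborel[OF int nonneg] _ E]
    by (simp add: bessel_average_def)
qed

text \<open>Integrating by parts the part \<open>t \<ge> \<tau>\<close> of
  \<open>\<Gamma>(1 - \<sigma>/2) l\<^bsup>\<sigma>/2\<^esup> = l \<integral> t\<^bsup>-\<sigma>/2\<^esup> exp (- l t) dt\<close> represents the power by the two kernels
  below and a boundary term at \<open>\<tau>\<close>.\<close>

definition near_kernel :: "real \<Rightarrow> real \<Rightarrow> real \<Rightarrow> real" where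
  "near_kernel \<sigma> \<tau> t = indicator {0..<\<tau>} t * t powr (- \<sigma> / 2)"

definition far_kernel :: "real \<Rightarrow> real \<Rightarrow> real \<Rightarrow> real" where
  "far_kernel \<sigma> \<tau> t = indicator {\<tau>..} t * (\<sigma> / 2 * t powr (- \<sigma> / 2 - 1))"

lemma near_kernel_nonneg: "0 \<le> near_kernel \<sigma> \<tau> t"
  by (simp add: near_kernel_def)

lemma far_kernel_nonneg: "0 \<le> \<sigma> \<Longrightarrow> 0 \<le> far_kernel \<sigma> \<tau> t"
  by (simp add: far_kernel_def)

lemma near_kernel_measurable [measurable]: "near_kernel \<sigma> \<tau> \<in> borel_measurable borel"
  unfolding near_kernel_def[abs_def] by measurable

lemma far_kernel_measurable [measurable]: "far_kernel \<sigma> \<tau> \<in> borel_measurable borel"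
  unfolding far_kernel_def[abs_def] by measurable

lemma has_bochner_integral_Gamma:
  fixes a l :: real
  assumes a: "a > 0" and l: "l > 0"
  shows "has_bochner_integral lborel
      (\<lambda>t. indicator {0..} t * t powr (a - 1) * exp (- (l * t))) (Gamma a * l powr (- a))"
proof (rule has_bochner_integral_nn_integral)
  let ?I = "\<integral>\<^sup>+ t. ennreal (indicator {0..} t * t powr (a - 1) * exp (- (l * t))) \<partial>lborel"
  have "ennreal (Gamma a) = (\<integral>\<^sup>+ t. ennreal (indicator {0..} t * t powr (a - 1) / exp t) \<partial>lborel)"
    using Gamma_conv_nn_integral_real[OF a] .
  also have "\<dots> = ennreal \<bar>l\<bar>
      * (\<integral>\<^sup>+ t. ennreal (indicator {0..} (0 + l * t) * (0 + l * t) powr (a - 1) / exp (0 + l * t)) \<partial>lborel)"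
    using l by (intro nn_integral_real_affine) auto
  also have "\<dots> = (\<integral>\<^sup>+ t. ennreal (l powr a)
      * ennreal (indicator {0..} t * t powr (a - 1) * exp (- (l * t))) \<partial>lborel)"
  proof (subst nn_integral_cmult[symmetric], measurable, intro nn_integral_cong)
    fix t
    show "ennreal \<bar>l\<bar> * ennreal (indicator {0..} (0 + l * t) * (0 + l * t) powr (a - 1) / exp (0 + l * t))
      = ennreal (l powr a) * ennreal (indicator {0..} t * t powr (a - 1) * exp (- (l * t)))"
      using l by (cases "t \<ge> 0")
        (auto simp: ennreal_mult[symmetric] powr_mult powr_diff exp_minus field_simps zero_le_mult_iff
            indicator_def)
  qed
  also have "\<dots> = ennreal (l powr a) * ?I"
    by (rule nn_integral_cmult) measurable
  finally have Gamma: "ennreal (Gamma a) = ennreal (l powr a) * ?I" .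
  have "ennreal (Gamma a * l powr (- a)) = ennreal (l powr (- a)) * ennreal (Gamma a)"
    using a by (simp add: ennreal_mult[symmetric] less_imp_le mult.commute)
  also have "\<dots> = ?I"
    unfolding Gamma mult.assoc[symmetric] using l by (simp add: ennreal_mult[symmetric] powr_minus)
  finally show "?I = ennreal (Gamma a * l powr (- a))" ..
qed (use a in \<open>auto intro!: AE_I2 mult_nonneg_nonneg simp: less_imp_le\<close>)

context
  fixes \<sigma> \<tau> l :: real
  assumes \<sigma>: "0 \<le> \<sigma>" "\<sigma> < 2" and \<tau>: "\<tau> > 0" and l: "l > 0"
begin

lemma has_bochner_integral_powr_exp:
  "l' > 0 \<Longrightarrow> has_bochner_integral lborel (\<lambda>t. indicator {0..} t * t powr (- \<sigma> / 2) * exp (- (l' * t)))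
     (Gamma (1 - \<sigma> / 2) * l' powr (- (1 - \<sigma> / 2)))"
  using has_bochner_integral_Gamma[of "1 - \<sigma> / 2" l'] \<sigma> by simp

lemma integrable_near_kernel_exp: "integrable lborel (\<lambda>t. near_kernel \<sigma> \<tau> t * exp (- (l * t)))"
  by (rule Bochner_Integration.integrable_bound[OF integrable.intros[OF has_bochner_integral_powr_exp[OF l]]])
     (auto simp: near_kernel_def indicator_def)

lemma integrable_tail_powr_exp: "integrable lborel (\<lambda>t. indicator {\<tau>..} t * t powr (- \<sigma> / 2) * exp (- (l * t)))"
  using \<tau> by (intro Bochner_Integration.integrable_bound[OF
      integrable.intros[OF has_bochner_integral_powr_exp[OF l]]])
     (auto simp: indicator_def)

lemma has_bochner_integral_far_kernel_parts:
  "has_bochner_integral lborel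
     (\<lambda>t. far_kernel \<sigma> \<tau> t * exp (- (l * t)) + l * (indicator {\<tau>..} t * t powr (- \<sigma> / 2) * exp (- (l * t))))
     (\<tau> powr (- \<sigma> / 2) * exp (- (l * \<tau>)))"
proof (rule has_bochner_integral_nn_integral)
  let ?F = "\<lambda>t. - (t powr (- \<sigma> / 2) * exp (- (l * t)))"
  let ?f = "\<lambda>t. \<sigma> / 2 * t powr (- \<sigma> / 2 - 1) * exp (- (l * t)) + l * (t powr (- \<sigma> / 2) * exp (- (l * t)))"
  have "((\<lambda>t. exp (- (l * t))) \<longlongrightarrow> 0) at_top"
    using l by (intro filterlim_compose[OF exp_at_bot] filterlim_compose[OF filterlim_uminus_at_bot_at_top]
        filterlim_tendsto_pos_mult_at_top[OF tendsto_const] filterlim_ident)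
  then have majorant: "((\<lambda>t. \<tau> powr (- \<sigma> / 2) * exp (- (l * t))) \<longlongrightarrow> 0) at_top"
    by (rule tendsto_mult_right_zero)
  have "\<forall>\<^sub>F t in at_top. norm (?F t) \<le> \<tau> powr (- \<sigma> / 2) * exp (- (l * t))"
    using eventually_ge_at_top[of \<tau>] by eventually_elim (use \<tau> \<sigma> in \<open>auto intro!: powr_mono2'\<close>)
  then have lim: "(?F \<longlongrightarrow> 0) at_top"
    by (rule Lim_null_comparison[OF _ majorant])
  have "(\<integral>\<^sup>+ t. ennreal (?f t) * indicator {\<tau>..} t \<partial>lborel) = ennreal (0 - ?F \<tau>)"
  proof (rule nn_integral_FTC_atLeast[OF _ _ _ lim])
    fix t assume t: "\<tau> \<le> t"
    show "(?F has_real_derivative ?f t) (at t)"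
      using t \<tau> by (auto intro!: derivative_eq_intros simp: powr_diff field_simps)
    show "0 \<le> ?f t"
      using \<sigma> l by (intro add_nonneg_nonneg mult_nonneg_nonneg) auto
  qed measurable
  moreover have "ennreal (far_kernel \<sigma> \<tau> t * exp (- (l * t))
      + l * (indicator {\<tau>..} t * t powr (- \<sigma> / 2) * exp (- (l * t))))
      = ennreal (?f t) * indicator {\<tau>..} t" for t
    by (simp add: far_kernel_def indicator_def)
  ultimately show "(\<integral>\<^sup>+ t. ennreal (far_kernel \<sigma> \<tau> t * exp (- (l * t))
      + l * (indicator {\<tau>..} t * t powr (- \<sigma> / 2) * exp (- (l * t)))) \<partial>lborel)
          = ennreal (\<tau> powr (- \<sigma> / 2) * exp (- (l * \<tau>)))"
    by simp
qed (use \<sigma> l in \<open>auto intro!: AE_I2 add_nonneg_nonneg mult_nonneg_nonneg far_kernel_nonneg\<close>)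

lemma integrable_far_kernel_exp: "integrable lborel (\<lambda>t. far_kernel \<sigma> \<tau> t * exp (- (l * t)))"
  using Bochner_Integration.integrable_diff[OF integrable.intros[OF has_bochner_integral_far_kernel_parts]
      integrable_mult_right[OF integrable_tail_powr_exp, of l]] by simp

lemma integral_far_kernel_exp:
  "(LINT t|lborel. far_kernel \<sigma> \<tau> t * exp (- (l * t))) = \<tau> powr (- \<sigma> / 2) * exp (- (l * \<tau>))
     - l * (LINT t|lborel. indicator {\<tau>..} t * t powr (- \<sigma> / 2) * exp (- (l * t)))"
  using has_bochner_integral_integral_eq[OF has_bochner_integral_far_kernel_parts]
    integrable_far_kernel_exp integrable_tail_powr_exp by simp

lemma integral_far_kernel_exp_le: "(LINT t|lborel. far_kernel \<sigma> \<tau> t * exp (- (l * t))) \<le> \<tau> powr (- \<sigma> / 2)"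
proof -
  have "l * (LINT t|lborel. indicator {\<tau>..} t * t powr (- \<sigma> / 2) * exp (- (l * t))) \<ge> 0"
    using l by (intro mult_nonneg_nonneg integral_nonneg_AE) auto
  moreover have "\<tau> powr (- \<sigma> / 2) * exp (- (l * \<tau>)) \<le> \<tau> powr (- \<sigma> / 2)"
    using l \<tau> by (simp add: mult_left_le)
  ultimately show ?thesis unfolding integral_far_kernel_exp by linarith
qed

lemma integral_near_kernel_exp_le:
  "(LINT t|lborel. near_kernel \<sigma> \<tau> t * exp (- (l * t))) \<le> exp 1 * Gamma (1 - \<sigma> / 2) * \<tau> powr (1 - \<sigma> / 2)"
proof -
  let ?h = "\<lambda>t. indicator {0..} t * t powr (- \<sigma> / 2) * exp (- (1 / \<tau> * t))"
  have "1 / \<tau> > 0" using \<tau> by simp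
  note h = has_bochner_integral_powr_exp[OF this]
  have "(LINT t|lborel. near_kernel \<sigma> \<tau> t * exp (- (l * t))) \<le> (LINT t|lborel. exp 1 * ?h t)"
  proof (rule integral_mono[OF integrable_near_kernel_exp integrable_mult_right[OF integrable.intros[OF h]]])
    fix t
    show "near_kernel \<sigma> \<tau> t * exp (- (l * t)) \<le> exp 1 * ?h t"
    proof (cases "0 \<le> t \<and> t < \<tau>")
      case True
      have "exp (- (l * t)) \<le> 1" using l True by simp
      also have "\<dots> \<le> exp 1 * exp (- (1 / \<tau> * t))"
        using True \<tau> by (simp add: exp_add[symmetric] field_simps)
      finally have "t powr (- \<sigma> / 2) * exp (- (l * t)) \<le> t powr (- \<sigma> / 2) * (exp 1 * exp (- (1 / \<tau> * t)))"
        by (intro mult_left_mono) auto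
      then show ?thesis using True by (simp add: near_kernel_def mult_ac)
    qed (auto simp: near_kernel_def indicator_def)
  qed
  also have "\<dots> = exp 1 * (Gamma (1 - \<sigma> / 2) * (1 / \<tau>) powr (- (1 - \<sigma> / 2)))"
    using has_bochner_integral_integral_eq[OF h] by simp
  also have "(1 / \<tau>) powr (- (1 - \<sigma> / 2)) = \<tau> powr (1 - \<sigma> / 2)"
    using \<tau> by (simp add: powr_divide powr_minus del: minus_diff_eq)
  finally show ?thesis by (simp add: mult.assoc)
qed

lemma powr_heat_representation:
  "Gamma (1 - \<sigma> / 2) * l powr (\<sigma> / 2) = l * (LINT t|lborel. near_kernel \<sigma> \<tau> t * exp (- (l * t)))
     + \<tau> powr (- \<sigma> / 2) * exp (- (l * \<tau>)) - (LINT t|lborel. far_kernel \<sigma> \<tau> t * exp (- (l * t)))"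
proof -
  let ?tail = "\<lambda>t. indicator {\<tau>..} t * t powr (- \<sigma> / 2) * exp (- (l * t))"
  have "indicator {0..} t * t powr (- \<sigma> / 2) * exp (- (l * t))
      = near_kernel \<sigma> \<tau> t * exp (- (l * t)) + ?tail t" for t
    using \<tau> by (auto simp: near_kernel_def indicator_def)
  then have split: "Gamma (1 - \<sigma> / 2) * l powr (- (1 - \<sigma> / 2))
      = (LINT t|lborel. near_kernel \<sigma> \<tau> t * exp (- (l * t))) + (LINT t|lborel. ?tail t)"
    using has_bochner_integral_integral_eq[OF has_bochner_integral_powr_exp[OF l]]
      integrable_near_kernel_exp integrable_tail_powr_exp by simp
  have "Gamma (1 - \<sigma> / 2) * l powr (\<sigma> / 2) = l * (Gamma (1 - \<sigma> / 2) * l powr (- (1 - \<sigma> / 2)))"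
    using l powr_add[of l 1 "- (1 - \<sigma> / 2)"] by simp
  then show ?thesis
    unfolding split integral_far_kernel_exp by (simp add: distrib_left)
qed

end

definition bessel_lift :: "nat \<Rightarrow> ('a::euclidean_space \<Rightarrow> complex) \<Rightarrow> ('a \<Rightarrow> complex) \<Rightarrow> bool" where
  "bessel_lift M F E \<longleftrightarrow> rapid_decay E \<and> (\<forall>\<xi>. FT E \<xi> = of_real (bessel_weight \<xi> ^ M) * FT F \<xi>)"

lemma bessel_weight_powr_eq:
  assumes \<sigma>: "0 \<le> \<sigma>" "\<sigma> < 2" and \<tau>: "\<tau> > 0"
  shows "bessel_weight \<xi> powr ((2 * real M + \<sigma>) / 2) = bessel_weight \<xi> ^ M * (1 / Gamma (1 - \<sigma> / 2) *
    (bessel_weight \<xi> * (LINT t|lborel. near_kernel \<sigma> \<tau> t * exp (- (bessel_weight \<xi> * t)))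
     + \<tau> powr (- \<sigma> / 2) * exp (- \<tau>) * exp (- (4 * pi\<^sup>2 * \<tau> * (norm \<xi>)\<^sup>2))
     - (LINT t|lborel. far_kernel \<sigma> \<tau> t * exp (- (bessel_weight \<xi> * t)))))"
proof -
  let ?l = "bessel_weight \<xi>"
  have "\<tau> powr (- \<sigma> / 2) * exp (- \<tau>) * exp (- (4 * pi\<^sup>2 * \<tau> * (norm \<xi>)\<^sup>2)) = \<tau> powr (- \<sigma> / 2) * exp (- (?l * \<tau>))"
    by (simp add: bessel_weight_def algebra_simps flip: exp_add)
  moreover have "?l powr ((2 * real M + \<sigma>) / 2) = ?l ^ M * ?l powr (\<sigma> / 2)"
    using bessel_weight_pos[of \<xi>] by (simp add: add_divide_distrib powr_add powr_realpow)
  moreover have "?l powr (\<sigma> / 2)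
      = 1 / Gamma (1 - \<sigma> / 2) * (?l * (LINT t|lborel. near_kernel \<sigma> \<tau> t * exp (- (?l * t)))
      + \<tau> powr (- \<sigma> / 2) * exp (- (?l * \<tau>)) - (LINT t|lborel. far_kernel \<sigma> \<tau> t * exp (- (?l * t))))"
    unfolding powr_heat_representation[OF \<sigma> \<tau> bessel_weight_pos, symmetric]
    using less_imp_neq[OF Gamma_real_pos[of "1 - \<sigma> / 2"]] \<sigma> by simp
  ultimately show ?thesis by (simp only:)
qed

lemma has_weak_FT_fractional_lift:
  assumes \<sigma>: "0 \<le> \<sigma>" "\<sigma> < 2" and \<tau>: "\<tau> > 0" and E0: "bessel_lift M F E0" and E1: "bessel_lift (Suc M) F E1"
  shows "has_weak_FT (\<lambda>x. of_real (1 / Gamma (1 - \<sigma> / 2)) * (bessel_average (near_kernel \<sigma> \<tau>) E1 x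
      + (of_real (\<tau> powr (- \<sigma> / 2) * exp (- \<tau>)) * heat_average (return borel \<tau>) E0 x
      + (- 1) * bessel_average (far_kernel \<sigma> \<tau>) E0 x)))
    (\<lambda>\<xi>. of_real (bessel_weight \<xi> powr ((2 * real M + \<sigma>) / 2)) * FT F \<xi>)"
    (is "has_weak_FT ?G ?h")
proof -
  let ?\<Gamma> = "Gamma (1 - \<sigma> / 2)" and ?N = "\<lambda>l. LINT t|lborel. near_kernel \<sigma> \<tau> t * exp (- (l * t))"
    and ?R = "\<lambda>l. LINT t|lborel. far_kernel \<sigma> \<tau> t * exp (- (l * t))"
  have decay: "rapid_decay E0" "rapid_decay E1" and
    FT: "FT E0 \<xi> = of_real (bessel_weight \<xi> ^ M) * FT F \<xi>"
      "FT E1 \<xi> = of_real (bessel_weight \<xi> ^ Suc M) * FT F \<xi>" for \<xi>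
    using E0 E1 unfolding bessel_lift_def by blast+
  have near: "has_weak_FT (bessel_average (near_kernel \<sigma> \<tau>) E1) (\<lambda>\<xi>. of_real (?N (bessel_weight \<xi>)) * FT E1 \<xi>)"
    using integrable_near_kernel_exp[OF \<sigma> \<tau> zero_less_one]
    by (intro has_weak_FT_bessel_average near_kernel_nonneg near_kernel_measurable decay)
      (auto simp: near_kernel_def)
  have far: "has_weak_FT (bessel_average (far_kernel \<sigma> \<tau>) E0) (\<lambda>\<xi>. of_real (?R (bessel_weight \<xi>)) * FT E0 \<xi>)"
    using integrable_far_kernel_exp[OF \<sigma> \<tau> zero_less_one] \<tau>
    by (intro has_weak_FT_bessel_average far_kernel_nonneg far_kernel_measurable decay \<sigma>)
      (auto simp: far_kernel_def)
  have boundary: "has_weak_FT (heat_average (return borel \<tau>) E0)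
      (\<lambda>\<xi>. of_real (exp (- (4 * pi\<^sup>2 * \<tau> * (norm \<xi>)\<^sup>2))) * FT E0 \<xi>)"
    using has_weak_FT_heat_average[OF prob_space.finite_measure[OF prob_space_return] _ decay(1), of \<tau> borel] \<tau>
    by (simp add: integral_return)
  have "has_weak_FT ?G (\<lambda>\<xi>. of_real (1 / ?\<Gamma>) * (of_real (?N (bessel_weight \<xi>)) * FT E1 \<xi>
      + (of_real (\<tau> powr (- \<sigma> / 2) * exp (- \<tau>)) * (of_real (exp (- (4 * pi\<^sup>2 * \<tau> * (norm \<xi>)\<^sup>2))) * FT E0 \<xi>)
      + (- 1) * (of_real (?R (bessel_weight \<xi>)) * FT E0 \<xi>))))"
    by (intro has_weak_FT_cmult has_weak_FT_add near far boundary)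
  moreover have "of_real (1 / ?\<Gamma>) * (of_real (?N (bessel_weight \<xi>)) * FT E1 \<xi>
      + (of_real (\<tau> powr (- \<sigma> / 2) * exp (- \<tau>)) * (of_real (exp (- (4 * pi\<^sup>2 * \<tau> * (norm \<xi>)\<^sup>2))) * FT E0 \<xi>)
      + (- 1) * (of_real (?R (bessel_weight \<xi>)) * FT E0 \<xi>))) = ?h \<xi>" for \<xi>
  proof -
    have "of_real g * (of_real n * (of_real (l ^ Suc M) * f)
        + (of_real c * (of_real e * (of_real (l ^ M) * f)) + (- 1) * (of_real r * (of_real (l ^ M) * f))))
        = of_real (l ^ M * (g * (l * n + c * e - r))) * f" for g n l c e r :: real and f :: complex
      by (simp add: algebra_simps)
    then show ?thesis unfolding FT bessel_weight_powr_eq[OF \<sigma> \<tau>] .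
  qed
  ultimately show ?thesis by (simp only:)
qed

lemma Lp_norm_near_average_le:
  assumes \<sigma>: "0 \<le> \<sigma>" "\<sigma> < 2" and \<tau>: "\<tau> > 0" and E: "rapid_decay E" and u: "u \<ge> 1"
  shows "Lp_norm u (bessel_average (near_kernel \<sigma> \<tau>) E)
      \<le> ennreal (exp 1 * Gamma (1 - \<sigma> / 2) * \<tau> powr (1 - \<sigma> / 2)) * Lp_norm u E"
  using Lp_norm_bessel_average_le[OF integrable_near_kernel_exp[OF \<sigma> \<tau> zero_less_one, unfolded mult_1]
      near_kernel_nonneg E u]
  by (rule order_trans)
    (use integral_near_kernel_exp_le[OF \<sigma> \<tau> zero_less_one] in \<open>auto intro!: mult_right_mono ennreal_leI\<close>)

lemma Lp_norm_far_average_le: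
  assumes \<sigma>: "0 \<le> \<sigma>" "\<sigma> < 2" and \<tau>: "\<tau> > 0" and E: "rapid_decay E" and u: "u \<ge> 1"
  shows "Lp_norm u (bessel_average (far_kernel \<sigma> \<tau>) E) \<le> ennreal (\<tau> powr (- \<sigma> / 2)) * Lp_norm u E"
  using Lp_norm_bessel_average_le[OF integrable_far_kernel_exp[OF \<sigma> \<tau> zero_less_one, unfolded mult_1]
      far_kernel_nonneg[OF \<sigma>(1)] E u]
  by (rule order_trans)
    (use integral_far_kernel_exp_le[OF \<sigma> \<tau> zero_less_one] in \<open>auto intro!: mult_right_mono ennreal_leI\<close>)

theorem sobolev_norm_interpolation:
  assumes \<sigma>: "0 \<le> \<sigma>" "\<sigma> < 2" and \<tau>: "\<tau> > 0" and u: "u \<ge> 1"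
    and E0: "bessel_lift M F E0" and E1: "bessel_lift (Suc M) F E1"
  shows "sobolev_norm u (2 * real M + \<sigma>) F \<le> ennreal (1 / Gamma (1 - \<sigma> / 2)) *
    (ennreal (exp 1 * Gamma (1 - \<sigma> / 2) * \<tau> powr (1 - \<sigma> / 2)) * Lp_norm u E1
     + 2 * ennreal (\<tau> powr (- \<sigma> / 2)) * Lp_norm u E0)"
proof -
  let ?\<Gamma> = "Gamma (1 - \<sigma> / 2)" and ?c = "\<tau> powr (- \<sigma> / 2) * exp (- \<tau>)"
  let ?N = "bessel_average (near_kernel \<sigma> \<tau>) E1" and ?R = "bessel_average (far_kernel \<sigma> \<tau>) E0"
    and ?D = "heat_average (return borel \<tau>) E0"
  have \<Gamma>: "?\<Gamma> > 0" using \<sigma> by simp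
  have decay: "rapid_decay E0" "rapid_decay E1" using E0 E1 unfolding bessel_lift_def by blast+
  note near_integrable = integrable_near_kernel_exp[OF \<sigma> \<tau> zero_less_one, unfolded mult_1]
  note far_integrable = integrable_far_kernel_exp[OF \<sigma> \<tau> zero_less_one, unfolded mult_1]
  note point_mass = prob_space.finite_measure[OF prob_space_return, of \<tau> borel]
  note meas = bessel_average_measurable[OF near_integrable near_kernel_nonneg decay(2)]
    bessel_average_measurable[OF far_integrable far_kernel_nonneg[OF \<sigma>(1)] decay(1)]
    heat_average_measurable[OF point_mass _ decay(1)]
  have "Lp_norm u ?D \<le> Lp_norm u E0"
    using Lp_norm_heat_average_le[OF point_mass _ decay(1) u]
    by (simp add: measure_return)
  moreover have "?c \<le> \<tau> powr (- \<sigma> / 2)" using \<tau> by (simp add: mult_left_le)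
  ultimately have boundary: "ennreal ?c * Lp_norm u ?D \<le> ennreal (\<tau> powr (- \<sigma> / 2)) * Lp_norm u E0"
    by (intro mult_mono ennreal_leI) auto
  have "sobolev_norm u (2 * real M + \<sigma>) F
      \<le> Lp_norm u (\<lambda>x. of_real (1 / ?\<Gamma>) * (?N x + (of_real ?c * ?D x + (- 1) * ?R x)))"
    by (rule sobolev_norm_le_weak_FT[OF has_weak_FT_fractional_lift[OF \<sigma> \<tau> E0 E1]])
  also have "\<dots> = ennreal (1 / ?\<Gamma>) * Lp_norm u (\<lambda>x. ?N x + (of_real ?c * ?D x + (- 1) * ?R x))"
    using \<Gamma> u meas by (subst Lp_norm_cmult) (auto simp: norm_divide)
  also have "\<dots> \<le> ennreal (1 / ?\<Gamma>)
      * (Lp_norm u ?N + (Lp_norm u (\<lambda>x. of_real ?c * ?D x) + Lp_norm u (\<lambda>x. (- 1) * ?R x)))"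
    using meas u by (intro mult_left_mono
        order_trans[OF Minkowski_Lp_norm add_left_mono[OF Minkowski_Lp_norm]]) auto
  also have "Lp_norm u (\<lambda>x. of_real ?c * ?D x) = ennreal ?c * Lp_norm u ?D"
    using meas u by (subst Lp_norm_cmult) (auto simp: norm_mult)
  also have "Lp_norm u (\<lambda>x. (- 1) * ?R x) = Lp_norm u ?R"
    using meas u by (subst Lp_norm_cmult) auto
  also have "ennreal (1 / ?\<Gamma>) * (Lp_norm u ?N + (ennreal ?c * Lp_norm u ?D + Lp_norm u ?R))
      \<le> ennreal (1 / ?\<Gamma>) * (ennreal (exp 1 * ?\<Gamma> * \<tau> powr (1 - \<sigma> / 2)) * Lp_norm u E1
          + (ennreal (\<tau> powr (- \<sigma> / 2)) * Lp_norm u E0 + ennreal (\<tau> powr (- \<sigma> / 2)) * Lp_norm u E0))"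
    by (intro mult_left_mono add_mono boundary Lp_norm_near_average_le Lp_norm_far_average_le \<sigma> \<tau> decay u) simp
  finally show ?thesis by (simp only: mult_2 distrib_right)
qed

section \<open>Sobolev norms of functions with bounded derivatives\<close>

text \<open>\<open>derivs_bounded W U j A f\<close>: the iterated partial derivatives of \<open>f\<close> of order \<open>i \<le> j\<close> exist
  everywhere and are bounded on \<open>U\<close> by \<open>W ^ i * A\<close>.\<close>

fun derivs_bounded :: "real \<Rightarrow> 'a::euclidean_space set \<Rightarrow> nat \<Rightarrow> ('a \<Rightarrow> real) \<Rightarrow> ('a \<Rightarrow> complex) \<Rightarrow> bool" where
  "derivs_bounded W U 0 A f \<longleftrightarrow> f \<in> borel_measurable borel \<and> (\<forall>x\<in>U. norm (f x) \<le> A x)"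
| "derivs_bounded W U (Suc j) A f \<longleftrightarrow> f \<in> borel_measurable borel \<and> (\<forall>x\<in>U. norm (f x) \<le> A x) \<and>
     (\<forall>b\<in>Basis. \<exists>f'. (f has_directional_derivative f') b \<and> derivs_bounded W U j (\<lambda>x. W * A x) f')"

lemma derivs_bounded_measurable: "derivs_bounded W U j A f \<Longrightarrow> f \<in> borel_measurable borel"
  by (cases j) auto

lemma derivs_bounded_norm_le: "derivs_bounded W U j A f \<Longrightarrow> x \<in> U \<Longrightarrow> norm (f x) \<le> A x"
  by (cases j) auto

lemma derivs_bounded_SucE:
  assumes "derivs_bounded W U (Suc j) A f" "b \<in> Basis"
  obtains f' where "(f has_directional_derivative f') b" "derivs_bounded W U j (\<lambda>x. W * A x) f'"
  using assms unfolding derivs_bounded.simps by blast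

lemma derivs_bounded_SucI:
  assumes "f \<in> borel_measurable borel" "\<And>x. x \<in> U \<Longrightarrow> norm (f x) \<le> A x"
    and "\<And>b. b \<in> Basis \<Longrightarrow> \<exists>f'. (f has_directional_derivative f') b \<and> derivs_bounded W U j (\<lambda>x. W * A x) f'"
  shows "derivs_bounded W U (Suc j) A f"
  using assms by simp

lemma derivs_bounded_mono:
  assumes "derivs_bounded W U j A f" "0 \<le> W" "W \<le> W'" "V \<subseteq> U" "\<And>x. x \<in> V \<Longrightarrow> A x \<le> A' x"
  shows "derivs_bounded W' V j A' f"
  using assms
proof (induction j arbitrary: A A' f)
  case 0
  then show ?case by (auto intro: order_trans)
next
  case (Suc j)
  show ?case
  proof (rule derivs_bounded_SucI)
    show "norm (f x) \<le> A' x" if "x \<in> V" for x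
      using derivs_bounded_norm_le[OF Suc.prems(1), of x] Suc.prems(4) Suc.prems(5)[OF that] that by fastforce
    fix b :: 'a assume "b \<in> Basis"
    then obtain f' where f': "(f has_directional_derivative f') b" "derivs_bounded W U j (\<lambda>x. W * A x) f'"
      using derivs_bounded_SucE[OF Suc.prems(1)] by blast
    have "derivs_bounded W' V j (\<lambda>x. W' * A' x) f'"
    proof (rule Suc.IH[OF f'(2) Suc.prems(2,3,4)])
      fix x assume x: "x \<in> V"
      then have "0 \<le> A x"
        using derivs_bounded_norm_le[OF Suc.prems(1), of x] Suc.prems(4) norm_ge_zero order_trans by blast
      then show "W * A x \<le> W' * A' x" using Suc.prems(2,3) Suc.prems(5)[OF x] by (intro mult_mono) auto
    qed
    then show "\<exists>f'. (f has_directional_derivative f') b \<and> derivs_bounded W' V j (\<lambda>x. W' * A' x) f'"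
      using f'(1) by blast
  qed (rule derivs_bounded_measurable[OF Suc.prems(1)])
qed

lemma derivs_bounded_SucD: "derivs_bounded W U (Suc j) A f \<Longrightarrow> derivs_bounded W U j A f"
proof (induction j arbitrary: A f)
  case (Suc j)
  then show ?case
    by (intro derivs_bounded_SucI derivs_bounded_measurable[OF Suc.prems] derivs_bounded_norm_le[OF Suc.prems])
       (auto elim!: derivs_bounded_SucE[OF Suc.prems])
qed simp

lemma derivs_bounded_add:
  "derivs_bounded W U j A f \<Longrightarrow> derivs_bounded W U j B g \<Longrightarrow> derivs_bounded W U j (\<lambda>x. A x + B x) (\<lambda>x. f x + g x)"
proof (induction j arbitrary: A B f g)
  case 0
  then show ?case by (auto intro: norm_triangle_mono)
next
  case (Suc j)
  show ?case
  proof (rule derivs_bounded_SucI)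
    fix b :: 'a assume b: "b \<in> Basis"
    obtain f' g' where f': "(f has_directional_derivative f') b" "derivs_bounded W U j (\<lambda>x. W * A x) f'"
      and g': "(g has_directional_derivative g') b" "derivs_bounded W U j (\<lambda>x. W * B x) g'"
      using derivs_bounded_SucE[OF Suc.prems(1) b] derivs_bounded_SucE[OF Suc.prems(2) b] by metis
    show "\<exists>h'. ((\<lambda>x. f x + g x) has_directional_derivative h') b \<and> derivs_bounded W U j (\<lambda>x. W * (A x + B x)) h'"
      using has_directional_derivative_add[OF f'(1) g'(1)] Suc.IH[OF f'(2) g'(2)] unfolding distrib_left by blast
  qed (use Suc.prems[THEN derivs_bounded_norm_le] Suc.prems[THEN derivs_bounded_measurable] in
      \<open>auto intro: norm_triangle_mono\<close>)
qed

lemma derivs_bounded_cmult: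
  "derivs_bounded W U j A f \<Longrightarrow> derivs_bounded W U j (\<lambda>x. norm c * A x) (\<lambda>x. c * f x)"
proof (induction j arbitrary: A f)
  case 0
  then show ?case by (auto simp: norm_mult mult_left_mono)
next
  case (Suc j)
  show ?case
  proof (rule derivs_bounded_SucI)
    fix b :: 'a assume "b \<in> Basis"
    then obtain f' where f': "(f has_directional_derivative f') b" "derivs_bounded W U j (\<lambda>x. W * A x) f'"
      using derivs_bounded_SucE[OF Suc.prems] by blast
    show "\<exists>h'. ((\<lambda>x. c * f x) has_directional_derivative h') b \<and> derivs_bounded W U j (\<lambda>x. W * (norm c * A x)) h'"
      using has_directional_derivative_cmult[OF f'(1)] Suc.IH[OF f'(2)] unfolding mult.left_commute[of W] by blast
  qed (use derivs_bounded_norm_le[OF Suc.prems] derivs_bounded_measurable[OF Suc.prems] in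
      \<open>auto simp: norm_mult mult_left_mono\<close>)
qed

lemma derivs_bounded_mult:
  assumes "0 \<le> W" "derivs_bounded W U j A f" "derivs_bounded W U j B g"
  shows "derivs_bounded W U j (\<lambda>x. 2 ^ j * (A x * B x)) (\<lambda>x. f x * g x)"
  using assms(2,3)
proof (induction j arbitrary: A B f g)
  case 0
  then show ?case by (auto simp: norm_mult intro!: mult_mono order_trans[OF norm_ge_zero])
next
  case (Suc j)
  show ?case
  proof (rule derivs_bounded_SucI)
    fix x assume x: "x \<in> U"
    have "norm (f x * g x) \<le> A x * B x"
      unfolding norm_mult using derivs_bounded_norm_le[OF Suc.prems(1) x] derivs_bounded_norm_le[OF Suc.prems(2) x]
      by (intro mult_mono) (auto intro: order_trans[OF norm_ge_zero])
    moreover have "(1::real) \<le> 2 ^ Suc j" by (rule one_le_power) simp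
    ultimately have "1 * norm (f x * g x) \<le> 2 ^ Suc j * (A x * B x)"
      by (intro mult_mono) auto
    then show "norm (f x * g x) \<le> 2 ^ Suc j * (A x * B x)" by simp
  next
    fix b :: 'a assume b: "b \<in> Basis"
    obtain f' g' where f': "(f has_directional_derivative f') b" "derivs_bounded W U j (\<lambda>x. W * A x) f'"
      and g': "(g has_directional_derivative g') b" "derivs_bounded W U j (\<lambda>x. W * B x) g'"
      using derivs_bounded_SucE[OF Suc.prems(1) b] derivs_bounded_SucE[OF Suc.prems(2) b] by metis
    have "derivs_bounded W U j (\<lambda>x. 2 ^ j * (A x * (W * B x)) + 2 ^ j * ((W * A x) * B x))
        (\<lambda>x. f x * g' x + f' x * g x)"
      by (intro derivs_bounded_add Suc.IH f' g' derivs_bounded_SucD[OF Suc.prems(1)]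
          derivs_bounded_SucD[OF Suc.prems(2)])
    also have "(\<lambda>x. 2 ^ j * (A x * (W * B x)) + 2 ^ j * ((W * A x) * B x)) = (\<lambda>x. W * (2 ^ Suc j * (A x * B x)))"
      by (auto simp: algebra_simps)
    finally show "\<exists>h'. ((\<lambda>x. f x * g x) has_directional_derivative h') b
        \<and> derivs_bounded W U j (\<lambda>x. W * (2 ^ Suc j * (A x * B x))) h'"
      using has_directional_derivative_mult[OF f'(1) g'(1)] by blast
  qed (use Suc.prems[THEN derivs_bounded_measurable] in auto)
qed

lemma derivs_bounded_const:
  assumes "0 \<le> W" "\<And>x. x \<in> U \<Longrightarrow> norm c \<le> A x"
  shows "derivs_bounded W U j A (\<lambda>_. c)"
  using assms(2)
proof (induction j arbitrary: A c)
  case (Suc j)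
  have "0 \<le> A x" if "x \<in> U" for x using Suc.prems[OF that] norm_ge_zero order_trans by blast
  then have "derivs_bounded W U j (\<lambda>x. W * A x) (\<lambda>_. 0)"
    using assms(1) by (intro Suc.IH) auto
  then show ?case
    using Suc.prems has_directional_derivative_const[of c] by (intro derivs_bounded_SucI) auto
qed auto

lemma derivs_bounded_sum:
  assumes "finite S" "0 \<le> W" "\<And>b. b \<in> S \<Longrightarrow> derivs_bounded W U j (A b) (f b)"
  shows "derivs_bounded W U j (\<lambda>x. \<Sum>b\<in>S. A b x) (\<lambda>x. \<Sum>b\<in>S. f b x)"
  using assms(1,3)
proof (induction S rule: finite_induct)
  case empty
  show ?case using derivs_bounded_const[OF assms(2), of U 0 "\<lambda>_. 0" j] by simp
next
  case (insert b S)
  have "derivs_bounded W U j (\<lambda>x. A b x + (\<Sum>b\<in>S. A b x)) (\<lambda>x. f b x + (\<Sum>b\<in>S. f b x))"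
    using insert by (intro derivs_bounded_add) auto
  then show ?case using insert(1,2) by simp
qed

lemma derivs_bounded_affine:
  assumes "0 \<le> W" "f \<in> borel_measurable borel" "\<And>x. x \<in> U \<Longrightarrow> norm (f x) \<le> A x"
    and "\<And>b. b \<in> Basis \<Longrightarrow> (f has_directional_derivative (\<lambda>_. c b)) b"
    and "\<And>x b. x \<in> U \<Longrightarrow> b \<in> Basis \<Longrightarrow> norm (c b) \<le> W * A x"
  shows "derivs_bounded W U j A f"
proof (cases j)
  case (Suc i)
  then show ?thesis
    using assms by (auto intro!: derivs_bounded_SucI exI[of _ "\<lambda>_. c _"] derivs_bounded_const)
qed (use assms in auto)

lemma derivs_bounded_restrict:
  assumes "closed U" "derivs_bounded W U j A f" "\<And>x. x \<notin> U \<Longrightarrow> f x = 0"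
  shows "derivs_bounded W UNIV j (\<lambda>x. if x \<in> U then A x else 0) f"
  using assms(2,3)
proof (induction j arbitrary: A f)
  case (Suc j)
  show ?case
  proof (rule derivs_bounded_SucI)
    fix b :: 'a assume "b \<in> Basis"
    then obtain f' where f': "(f has_directional_derivative f') b" "derivs_bounded W U j (\<lambda>x. W * A x) f'"
      using derivs_bounded_SucE[OF Suc.prems(1)] by blast
    have "derivs_bounded W UNIV j (\<lambda>x. if x \<in> U then W * A x else 0) f'"
      using has_directional_derivative_eq_0[OF f'(1) assms(1) Suc.prems(2)] by (intro Suc.IH f')
    also have "(\<lambda>x. if x \<in> U then W * A x else 0) = (\<lambda>x. W * (if x \<in> U then A x else 0))" by auto
    finally show "\<exists>f'. (f has_directional_derivative f') b
        \<and> derivs_bounded W UNIV j (\<lambda>x. W * (if x \<in> U then A x else 0)) f'"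
      using f'(1) by blast
  qed (use derivs_bounded_norm_le[OF Suc.prems(1)] derivs_bounded_measurable[OF Suc.prems(1)] Suc.prems(2) in auto)
qed auto

lemma derivs_bounded_FT:
  assumes "rapid_decay f" shows "\<exists>C. derivs_bounded 1 UNIV j (\<lambda>_. C) (FT f)"
  using assms
proof (induction j arbitrary: f)
  case 0
  then show ?case using norm_FT_le[OF rapid_decay_integrable[OF 0]] rapid_decay_measurable[OF 0] by auto
next
  case (Suc j)
  note [measurable] = rapid_decay_measurable[OF Suc.prems]
  let ?f' = "\<lambda>b x. (- 2 * pi * \<i>) * (complex_of_real (x \<bullet> b) * f x)"
  have "\<forall>b. \<exists>C. derivs_bounded 1 UNIV j (\<lambda>_. C) (FT (?f' b))"
    by (intro allI Suc.IH rapid_decay_cmult rapid_decay_inner_mult Suc.prems)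
  then obtain C where C: "\<And>b. derivs_bounded 1 UNIV j (\<lambda>_. C b) (FT (?f' b))" by metis
  define K where "K = max (LINT x|lborel. norm (f x)) (Max (C ` Basis))"
  have "derivs_bounded 1 UNIV (Suc j) (\<lambda>_. K) (FT f)"
  proof (rule derivs_bounded_SucI)
    show "norm (FT f x) \<le> K" for x
      using norm_FT_le[OF rapid_decay_integrable[OF Suc.prems], of x] by (simp add: K_def)
    fix b :: 'a assume "b \<in> Basis"
    then have "C b \<le> 1 * K" by (simp add: K_def le_max_iff_disj)
    then have "derivs_bounded 1 UNIV j (\<lambda>_. 1 * K) (FT (?f' b))"
      by (intro derivs_bounded_mono[OF C]) auto
    then show "\<exists>f'. (FT f has_directional_derivative f') b \<and> derivs_bounded 1 UNIV j (\<lambda>_. 1 * K) f'"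
      using FT_has_directional_derivative[OF Suc.prems] by blast
  qed measurable
  then show ?case by blast
qed

lemma derivs_bounded_rapid_decay:
  assumes f: "derivs_bounded W UNIV j A f" and A: "\<And>x. A x \<le> B" and supp: "\<And>x. norm x > R \<Longrightarrow> f x = 0"
  shows "rapid_decay f"
  using derivs_bounded_norm_le[OF f] A supp
  by (intro rapid_decay_compact_support[OF derivs_bounded_measurable[OF f]]) (auto intro: order_trans)

lemma second_derivative_bounded:
  fixes F :: "'a::euclidean_space \<Rightarrow> complex"
  assumes F: "derivs_bounded W UNIV (Suc (Suc j)) A F" and W: "0 \<le> W" and A: "\<And>x. A x \<le> B"
    and supp: "\<And>x. norm x > R \<Longrightarrow> F x = 0" and b: "b \<in> Basis"
  shows "\<exists>F''. derivs_bounded W UNIV j (\<lambda>x. W\<^sup>2 * A x) F'' \<and> rapid_decay F'' \<and> (\<forall>x. norm x > R \<longrightarrow> F'' x = 0) \<and>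
     (\<forall>\<xi>. FT F'' \<xi> = - of_real (4 * pi\<^sup>2 * (\<xi> \<bullet> b)\<^sup>2) * FT F \<xi>)"
proof -
  obtain F' where F': "(F has_directional_derivative F') b" "derivs_bounded W UNIV (Suc j) (\<lambda>x. W * A x) F'"
    using derivs_bounded_SucE[OF F b] by blast
  obtain F'' where F'': "(F' has_directional_derivative F'') b" "derivs_bounded W UNIV j (\<lambda>x. W * (W * A x)) F''"
    using derivs_bounded_SucE[OF F'(2) b] by blast
  have supp': "F' x = 0" if "norm x > R" for x
    using has_directional_derivative_eq_0[OF F'(1) closed_cball[of 0 R]] supp that by auto
  have supp'': "F'' x = 0" if "norm x > R" for x
    using has_directional_derivative_eq_0[OF F''(1) closed_cball[of 0 R]] supp' that by auto
  have decay: "rapid_decay F" "rapid_decay F'" "rapid_decay F''"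
    using derivs_bounded_rapid_decay[OF F A supp] derivs_bounded_rapid_decay[OF F'(2) mult_left_mono[OF A W] supp']
      derivs_bounded_rapid_decay[OF F''(2) mult_left_mono[OF mult_left_mono[OF A W] W] supp''] by blast+
  have "FT F'' \<xi> = - of_real (4 * pi\<^sup>2 * (\<xi> \<bullet> b)\<^sup>2) * FT F \<xi>" for \<xi>
    unfolding FT_directional_derivative[OF decay(2,3) F''(1)] FT_directional_derivative[OF decay(1,2) F'(1)]
    by (simp add: power2_eq_square algebra_simps)
  then show ?thesis
    using F''(2) decay(3) supp'' by (auto simp: power2_eq_square mult.assoc)
qed

lemma bessel_lift_one:
  fixes F :: "'a::euclidean_space \<Rightarrow> complex"
  assumes F: "derivs_bounded W UNIV (Suc (Suc j)) A F" and W: "0 \<le> W" and A: "\<And>x. A x \<le> B"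
    and supp: "\<And>x. norm x > R \<Longrightarrow> F x = 0"
  obtains E where "derivs_bounded W UNIV j (\<lambda>x. (1 + real DIM('a) * W\<^sup>2) * A x) E" "\<And>x. norm x > R \<Longrightarrow> E x = 0"
    "\<And>\<xi>. FT E \<xi> = of_real (bessel_weight \<xi>) * FT F \<xi>"
proof -
  have "\<forall>b\<in>Basis. \<exists>G. derivs_bounded W UNIV j (\<lambda>x. W\<^sup>2 * A x) G \<and> rapid_decay G \<and> (\<forall>x. norm x > R \<longrightarrow> G x = 0) \<and>
     (\<forall>\<xi>. FT G \<xi> = - of_real (4 * pi\<^sup>2 * (\<xi> \<bullet> b)\<^sup>2) * FT F \<xi>)"
    using second_derivative_bounded[OF F W A supp] by blast
  then obtain G where G: "\<And>b. b \<in> Basis \<Longrightarrow> derivs_bounded W UNIV j (\<lambda>x. W\<^sup>2 * A x) (G b)"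
    "\<And>b. b \<in> Basis \<Longrightarrow> rapid_decay (G b)" "\<And>b x. b \<in> Basis \<Longrightarrow> norm x > R \<Longrightarrow> G b x = 0"
    "\<And>b \<xi>. b \<in> Basis \<Longrightarrow> FT (G b) \<xi> = - of_real (4 * pi\<^sup>2 * (\<xi> \<bullet> b)\<^sup>2) * FT F \<xi>"
    by (subst (asm) bchoice_iff) blast
  let ?E = "\<lambda>x. F x + (- 1) * (\<Sum>b\<in>Basis. G b x)"
  have "derivs_bounded W UNIV j (\<lambda>x. A x + norm (- 1 :: complex) * (\<Sum>b\<in>(Basis::'a set). W\<^sup>2 * A x)) ?E"
    by (intro derivs_bounded_add derivs_bounded_cmult derivs_bounded_sum
        derivs_bounded_SucD[OF derivs_bounded_SucD[OF F]] G W)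
       auto
  moreover have "A x + norm (- 1 :: complex) * (\<Sum>b\<in>(Basis::'a set). W\<^sup>2 * A x)
      = (1 + real DIM('a) * W\<^sup>2) * A x" for x
    by (simp add: algebra_simps)
  ultimately have bounded: "derivs_bounded W UNIV j (\<lambda>x. (1 + real DIM('a) * W\<^sup>2) * A x) ?E" by simp
  have "FT ?E \<xi> = of_real (bessel_weight \<xi>) * FT F \<xi>" for \<xi>
  proof -
    have "FT ?E \<xi> = FT F \<xi> + (- 1) * (\<Sum>b\<in>Basis. FT (G b) \<xi>)"
      using G(2)[THEN rapid_decay_integrable] rapid_decay_integrable[OF derivs_bounded_rapid_decay[OF F A supp]]
      by (simp only: FT_add FT_cmult FT_sum integrable_mult_right Bochner_Integration.integrable_sum)
    also have "(\<Sum>b\<in>Basis. FT (G b) \<xi>) = - of_real (4 * pi\<^sup>2 * (\<Sum>b\<in>Basis. (\<xi> \<bullet> b)\<^sup>2)) * FT F \<xi>"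
      by (simp only: G(4) of_real_mult of_real_sum sum_distrib_left sum_distrib_right sum_negf mult_minus_left
          cong: sum.cong)
    also have "(\<Sum>b\<in>Basis. (\<xi> \<bullet> b)\<^sup>2) = (norm \<xi>)\<^sup>2"
      unfolding power2_norm_eq_inner by (subst (2) euclidean_inner) (simp add: power2_eq_square)
    finally show ?thesis by (simp add: bessel_weight_def algebra_simps)
  qed
  then show ?thesis
    using that[OF bounded] supp G(3) by simp
qed

lemma bessel_lift_exists:
  fixes F :: "'a::euclidean_space \<Rightarrow> complex"
  assumes F: "derivs_bounded W UNIV (2 * M + j) A F" and W: "0 \<le> W" and A: "\<And>x. A x \<le> B"
    and supp: "\<And>x. norm x > R \<Longrightarrow> F x = 0"
  shows "\<exists>E. bessel_lift M F E \<and> derivs_bounded W UNIV j (\<lambda>x. (1 + real DIM('a) * W\<^sup>2) ^ M * A x) E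
    \<and> (\<forall>x. norm x > R \<longrightarrow> E x = 0)"
  using F
proof (induction M arbitrary: j)
  case 0
  then show ?case
    using supp derivs_bounded_rapid_decay[OF 0 A supp] by (intro exI[of _ F]) (auto simp: bessel_lift_def)
next
  case (Suc M)
  let ?d = "1 + real DIM('a) * W\<^sup>2"
  have d: "?d > 0" by (simp add: add_pos_nonneg)
  have "derivs_bounded W UNIV (2 * M + Suc (Suc j)) A F" using Suc.prems by simp
  from Suc.IH[OF this] obtain E where E: "bessel_lift M F E"
    "derivs_bounded W UNIV (Suc (Suc j)) (\<lambda>x. ?d ^ M * A x) E"
    "\<And>x. norm x > R \<Longrightarrow> E x = 0" by blast
  have bound: "?d ^ M * A x \<le> ?d ^ M * B" for x using A d by (intro mult_left_mono) auto
  obtain E' where E': "derivs_bounded W UNIV j (\<lambda>x. ?d * (?d ^ M * A x)) E'" "\<And>x. norm x > R \<Longrightarrow> E' x = 0"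
    "\<And>\<xi>. FT E' \<xi> = of_real (bessel_weight \<xi>) * FT E \<xi>"
    using bessel_lift_one[OF E(2) W bound E(3)] by blast
  have "rapid_decay E'"
    using mult_left_mono[OF bound less_imp_le[OF d]] by (rule derivs_bounded_rapid_decay[OF E'(1) _ E'(2)])
  then have "bessel_lift (Suc M) F E'"
    using E(1) E'(3) by (simp add: bessel_lift_def)
  then show ?case using E'(1,2) by (auto simp: mult.assoc)
qed

lemma Lp_norm_le_cmult:
  assumes [measurable]: "A \<in> borel_measurable borel" and u: "u > 0" and k: "k \<ge> 0"
    and E: "\<And>x. norm (E x) \<le> k * A x"
  shows "Lp_norm u E \<le> ennreal k * Lp_norm u (\<lambda>x. complex_of_real (A x))"
proof -
  have "norm (E x) \<le> norm (of_real k * complex_of_real (A x))" for x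
    using E[of x] by (simp add: norm_mult abs_mult[symmetric] del: of_real_mult)
  then have "Lp_norm u E \<le> Lp_norm u (\<lambda>x. of_real k * complex_of_real (A x))"
    using u by (rule Lp_norm_mono[rotated])
  also have "\<dots> = ennreal k * Lp_norm u (\<lambda>x. complex_of_real (A x))"
    using u k by (subst Lp_norm_cmult) auto
  finally show ?thesis .
qed

lemma bessel_lift_Lp_norm_le:
  fixes F :: "'a::euclidean_space \<Rightarrow> complex"
  assumes u: "u \<ge> 1" and W: "W \<ge> 1" and [measurable]: "A \<in> borel_measurable borel"
    and A: "\<And>x. 0 \<le> A x" "\<And>x. A x \<le> B"
    and F: "derivs_bounded W UNIV (2 * k + j) A F" and supp: "\<And>x. norm x > R \<Longrightarrow> F x = 0"
  obtains E where "bessel_lift k F E"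
    "Lp_norm u E \<le> ennreal ((1 + real DIM('a)) ^ k * W powr (2 * real k)) * Lp_norm u (\<lambda>x. complex_of_real (A x))"
proof -
  let ?d = "1 + real DIM('a) * W\<^sup>2" and ?D = "1 + real DIM('a)"
  have "?d \<le> ?D * W\<^sup>2" using W by (simp add: distrib_right)
  then have "?d ^ k \<le> (?D * W\<^sup>2) ^ k" by (intro power_mono) auto
  also have "\<dots> = ?D ^ k * W powr real (2 * k)"
    using W by (simp only: powr_realpow[OF less_le_trans[OF zero_less_one]] power_mult_distrib power_mult)
  finally have d: "?d ^ k \<le> ?D ^ k * W powr (2 * real k)" by simp
  obtain E where E: "bessel_lift k F E" "derivs_bounded W UNIV j (\<lambda>x. ?d ^ k * A x) E"
    using bessel_lift_exists[OF F _ A(2) supp] W by fastforce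
  have "Lp_norm u E \<le> ennreal (?D ^ k * W powr (2 * real k)) * Lp_norm u (\<lambda>x. complex_of_real (A x))"
    using u derivs_bounded_norm_le[OF E(2)] mult_right_mono[OF d A(1)]
    by (intro Lp_norm_le_cmult) (auto intro: order_trans)
  with E(1) show thesis by (rule that)
qed

text \<open>Splitting the heat integral at time \<open>W powr (- 2)\<close> balances the two contributions.\<close>

lemma sobolev_constants_le:
  fixes W \<sigma> G D :: real
  assumes W: "W \<ge> 1" and G: "0 < G" and D: "1 \<le> D"
  defines "\<tau> \<equiv> W powr (- 2)"
  shows "1 / G * (exp 1 * G * \<tau> powr (1 - \<sigma> / 2) * (D ^ Suc M * W powr (2 * real (Suc M)))
      + 2 * \<tau> powr (- \<sigma> / 2) * (D ^ M * W powr (2 * real M)))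
    \<le> (exp 1 + 2 / G) * D ^ Suc M * W powr (2 * real M + \<sigma>)"
proof -
  have near: "\<tau> powr (1 - \<sigma> / 2) * W powr (2 * real (Suc M)) = W powr (2 * real M + \<sigma>)"
    and far: "\<tau> powr (- \<sigma> / 2) * W powr (2 * real M) = W powr (2 * real M + \<sigma>)"
    by (simp_all add: \<tau>_def powr_powr powr_add[symmetric] algebra_simps)
  have "1 / G * (exp 1 * G * \<tau> powr (1 - \<sigma> / 2) * (D ^ Suc M * W powr (2 * real (Suc M)))
      + 2 * \<tau> powr (- \<sigma> / 2) * (D ^ M * W powr (2 * real M)))
    = exp 1 * D ^ Suc M * (\<tau> powr (1 - \<sigma> / 2) * W powr (2 * real (Suc M)))
        + 2 / G * D ^ M * (\<tau> powr (- \<sigma> / 2) * W powr (2 * real M))"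
    using G by (simp add: field_simps)
  also have "\<dots> \<le> exp 1 * D ^ Suc M * W powr (2 * real M + \<sigma>) + 2 / G * D ^ Suc M * W powr (2 * real M + \<sigma>)"
    unfolding near far using G D by (intro add_mono mult_right_mono mult_left_mono power_increasing) auto
  finally show ?thesis by (simp only: distrib_right)
qed

theorem sobolev_norm_le_derivs_bounded:
  fixes F :: "'a::euclidean_space \<Rightarrow> complex"
  assumes u: "u \<ge> 1" and \<sigma>: "0 \<le> \<sigma>" "\<sigma> < 2" and W: "W \<ge> 1"
    and A_meas: "A \<in> borel_measurable borel" and A: "\<And>x. 0 \<le> A x" "\<And>x. A x \<le> B"
    and F: "derivs_bounded W UNIV (2 * M + 2) A F" and supp: "\<And>x. norm x > R \<Longrightarrow> F x = 0"
  shows "sobolev_norm u (2 * real M + \<sigma>) F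
    \<le> ennreal ((exp 1 + 2 / Gamma (1 - \<sigma> / 2)) * (1 + real DIM('a)) ^ Suc M * W powr (2 * real M + \<sigma>))
        * Lp_norm u (\<lambda>x. complex_of_real (A x))"
proof -
  let ?\<Gamma> = "Gamma (1 - \<sigma> / 2)" and ?D = "1 + real DIM('a)" and ?\<tau> = "W powr (- 2)"
    and ?L = "Lp_norm u (\<lambda>x. complex_of_real (A x))"
  have \<Gamma>: "?\<Gamma> > 0" using \<sigma> by simp
  have F': "derivs_bounded W UNIV (2 * Suc M + 0) A F" using F by simp
  obtain E0 where E0: "bessel_lift M F E0" "Lp_norm u E0 \<le> ennreal (?D ^ M * W powr (2 * real M)) * ?L"
    by (rule bessel_lift_Lp_norm_le[OF u W A_meas A F supp])
  obtain E1 where E1: "bessel_lift (Suc M) F E1"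
    "Lp_norm u E1 \<le> ennreal (?D ^ Suc M * W powr (2 * real (Suc M))) * ?L"
    by (rule bessel_lift_Lp_norm_le[OF u W A_meas A F' supp])
  have "sobolev_norm u (2 * real M + \<sigma>) F \<le> ennreal (1 / ?\<Gamma>) *
    (ennreal (exp 1 * ?\<Gamma> * ?\<tau> powr (1 - \<sigma> / 2)) * Lp_norm u E1 + 2 * ennreal (?\<tau> powr (- \<sigma> / 2)) * Lp_norm u E0)"
    using W by (intro sobolev_norm_interpolation[OF \<sigma> _ u E0(1) E1(1)]) simp
  also have "\<dots> \<le> ennreal (1 / ?\<Gamma>) *
    (ennreal (exp 1 * ?\<Gamma> * ?\<tau> powr (1 - \<sigma> / 2)) * (ennreal (?D ^ Suc M * W powr (2 * real (Suc M))) * ?L)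
     + 2 * ennreal (?\<tau> powr (- \<sigma> / 2)) * (ennreal (?D ^ M * W powr (2 * real M)) * ?L))"
    by (intro mult_left_mono add_mono E0(2) E1(2)) auto
  also have "\<dots> = ennreal (1 / ?\<Gamma> * (exp 1 * ?\<Gamma> * ?\<tau> powr (1 - \<sigma> / 2) * (?D ^ Suc M * W powr (2 * real (Suc M)))
     + 2 * ?\<tau> powr (- \<sigma> / 2) * (?D ^ M * W powr (2 * real M)))) * ?L"
  proof -
    have "ennreal g * (ennreal a * (ennreal b * L) + 2 * ennreal c * (ennreal d * L))
        = ennreal (g * (a * b + 2 * c * d)) * L"
      if "0 \<le> g" "0 \<le> a" "0 \<le> b" "0 \<le> c" "0 \<le> d" for g a b c d L
      using that by (simp add: ennreal_mult ennreal_plus distrib_left distrib_right mult.assoc)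
    then show ?thesis using \<Gamma> by (simp only: powr_ge_zero zero_le_power mult_nonneg_nonneg divide_nonneg_nonneg
        less_imp_le exp_ge_zero zero_le_one of_nat_0_le_iff add_nonneg_nonneg)
  qed
  also have "\<dots> \<le> ennreal ((exp 1 + 2 / ?\<Gamma>) * ?D ^ Suc M * W powr (2 * real M + \<sigma>)) * ?L"
    by (intro mult_right_mono ennreal_leI sobolev_constants_le[OF W \<Gamma>]) auto
  finally show ?thesis .
qed

section \<open>Sobolev size of Gaussian multipliers\<close>

definition sectorial_form :: "real \<Rightarrow> ('a::euclidean_space \<Rightarrow> 'a \<Rightarrow> complex) \<Rightarrow> bool" where
  "sectorial_form W B \<longleftrightarrow> 1 \<le> W \<and> bounded_bilinear B \<and> (\<forall>x y. B x y = B y x) \<and>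
     (\<forall>x. (norm x)\<^sup>2 \<le> Re (B x x)) \<and> (\<forall>x y. norm (B x y) \<le> W * sqrt (Re (B x x)) * norm y)"

lemma sectorial_formD:
  assumes "sectorial_form W B"
  shows "1 \<le> W" "bounded_bilinear B" "B x y = B y x" "(norm x)\<^sup>2 \<le> Re (B x x)" "0 \<le> Re (B x x)"
    "norm (B x y) \<le> W * sqrt (Re (B x x)) * norm y"
proof -
  show "(norm x)\<^sup>2 \<le> Re (B x x)" using assms by (simp add: sectorial_form_def)
  then show "0 \<le> Re (B x x)" by (rule order_trans[OF zero_le_power2])
qed (use assms in \<open>auto simp: sectorial_form_def\<close>)

lemma continuous_on_sectorial_form:
  assumes "sectorial_form W B" "continuous_on S f" "continuous_on S g"
  shows "continuous_on S (\<lambda>x. B (f x) (g x))"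
  using bounded_bilinear.continuous_on[OF sectorial_formD(2)[OF assms(1)] assms(2,3)] .

lemma sectorial_form_norm_le:
  assumes B: "sectorial_form W B"
  shows "norm (B x y) \<le> W\<^sup>2 * norm x * norm y"
proof -
  let ?r = "sqrt (Re (B x x))"
  note W = sectorial_formD(1)[OF B]
  have "?r \<le> W * norm x"
  proof (cases "?r = 0")
    case False
    then have r: "?r > 0" using sectorial_formD(5)[OF B, of x] by (simp add: order_less_le)
    have "?r * ?r \<le> norm (B x x)" using sectorial_formD(5)[OF B, of x] complex_Re_le_cmod by simp
    also have "\<dots> \<le> ?r * (W * norm x)" using sectorial_formD(6)[OF B, of x x] by (simp add: mult_ac)
    finally show ?thesis by (rule mult_left_le_imp_le[OF _ r])
  qed (use W in simp)
  then have "W * ?r * norm y \<le> W * (W * norm x) * norm y"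
    using W by (intro mult_right_mono mult_left_mono) auto
  then show ?thesis
    using sectorial_formD(6)[OF B, of x y] by (simp add: power2_eq_square mult.assoc)
qed

lemma form_gauss_scale_has_directional_derivative:
  assumes B: "sectorial_form W B"
  shows "((\<lambda>\<xi>. form_gauss B a (c *\<^sub>R \<xi>)) has_directional_derivative
    (\<lambda>\<xi>. (- (2 * of_real c) * B (c *\<^sub>R \<xi> - a) b) * form_gauss B a (c *\<^sub>R \<xi>))) b"
  using has_directional_derivative_exp[OF has_directional_derivative_cmult[OF
      has_directional_derivative_bounded_bilinear[OF sectorial_formD(2)[OF B], of c a b], of "- 1"]]
  unfolding sectorial_formD(3)[OF B, of b]
  by (simp add: form_gauss_def scaleR_conv_of_real algebra_simps)

lemma form_slope_has_directional_derivative: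
  assumes B: "sectorial_form W B"
  shows "((\<lambda>\<xi>. - (2 * of_real c) * B (c *\<^sub>R \<xi> - a) b) has_directional_derivative
    (\<lambda>_. - (2 * of_real c) * B (c *\<^sub>R b') b)) b'"
  unfolding has_directional_derivative_def
proof
  fix \<xi>
  interpret bounded_bilinear B by (rule sectorial_formD(2)[OF B])
  have "- (2 * of_real c) * B (c *\<^sub>R (\<xi> + t *\<^sub>R b') - a) b
      = - (2 * of_real c) * B (c *\<^sub>R \<xi> - a) b + of_real t * (- (2 * of_real c) * B (c *\<^sub>R b') b)" for t
    by (simp add: add_left diff_left scaleR_left scaleR_conv_of_real algebra_simps)
  then show "((\<lambda>t. - (2 * of_real c) * B (c *\<^sub>R (\<xi> + t *\<^sub>R b') - a) b) has_vector_derivative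
      - (2 * of_real c) * B (c *\<^sub>R b') b) (at 0)"
    by (auto intro!: derivative_eq_intros simp del: mult_minus_left)
qed

lemma one_plus_le_exp:
  fixes \<delta> q :: real
  assumes \<delta>: "\<delta> > 0" and q: "q \<ge> 0"
  shows "1 + q \<le> (1 + 1 / \<delta>) * exp (\<delta> * q)"
proof -
  have "\<delta> * q \<le> exp (\<delta> * q)" using exp_ge_add_one_self[of "\<delta> * q"] by linarith
  then have "q \<le> 1 / \<delta> * exp (\<delta> * q)" using \<delta> by (simp add: field_simps)
  moreover have "1 \<le> exp (\<delta> * q)" using \<delta> q by simp
  ultimately show ?thesis unfolding distrib_right by linarith
qed

text \<open>Away from the origin the dilation factor \<open>c\<close> is controlled by \<open>c *\<^sub>R \<xi> - a\<close>, so that the losses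
  are polynomial in the form and uniform in \<open>c\<close>.\<close>

lemma form_slope_bounds:
  fixes a :: "'a::euclidean_space"
  assumes B: "sectorial_form W B" and c: "c > 0" and \<xi>: "norm \<xi> \<ge> 1/2" and b: "norm b \<le> 1" "norm b' \<le> 1"
  defines "q \<equiv> Re (B (c *\<^sub>R \<xi> - a) (c *\<^sub>R \<xi> - a))"
  shows "norm (- (2 * of_real c) * B (c *\<^sub>R \<xi> - a) b) \<le> W * (16 * (1 + norm a)\<^sup>2 * (1 + q))"
    and "norm (- (2 * of_real c) * B (c *\<^sub>R b') b) \<le> W\<^sup>2 * (16 * (1 + norm a)\<^sup>2 * (1 + q))"
proof -
  define r where "r = sqrt q"
  note W = sectorial_formD(1)[OF B]
  have q: "q \<ge> 0" unfolding q_def by (rule sectorial_formD(5)[OF B])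
  have r: "r \<ge> 0" "r\<^sup>2 = q" using q by (auto simp: r_def)
  have r1: "r \<le> 1 + q" using r q sum_squares_bound[of r 1] by simp
  have "c * norm \<xi> \<le> norm (c *\<^sub>R \<xi> - a) + norm a"
    using norm_triangle_ineq[of "c *\<^sub>R \<xi> - a" a] c by simp
  moreover have "norm (c *\<^sub>R \<xi> - a) \<le> r"
    unfolding r_def q_def by (rule real_le_rsqrt[OF sectorial_formD(4)[OF B]])
  moreover have "c * (1/2) \<le> c * norm \<xi>" using c \<xi> by (intro mult_left_mono) auto
  ultimately have "c * (1/2) \<le> r + norm a" by linarith
  then have cr: "c \<le> 2 * (r + norm a)" by simp
  have "norm (- (2 * of_real c) * B (c *\<^sub>R \<xi> - a) b) \<le> 2 * c * (W * r * norm b)"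
    using sectorial_formD(6)[OF B, of "c *\<^sub>R \<xi> - a" b] c by (simp add: norm_mult r_def q_def)
  also have "\<dots> \<le> 2 * (2 * (r + norm a)) * (W * r * 1)"
    using cr c r W b by (intro mult_mono) auto
  also have "\<dots> = W * (4 * (q + norm a * r))" using r(2) by (simp add: power2_eq_square algebra_simps)
  also have "\<dots> \<le> W * (4 * ((1 + q) + norm a * (1 + q)))"
    using W r1 by (intro mult_left_mono add_mono) auto
  also have "\<dots> = W * (4 * (1 + norm a) * (1 + q))" by (simp add: algebra_simps)
  also have "\<dots> \<le> W * (16 * (1 + norm a)\<^sup>2 * (1 + q))"
    using W q by (intro mult_left_mono mult_right_mono mult_mono self_le_power) auto
  finally show "norm (- (2 * of_real c) * B (c *\<^sub>R \<xi> - a) b) \<le> W * (16 * (1 + norm a)\<^sup>2 * (1 + q))" .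
  have "c\<^sup>2 \<le> (2 * (r + norm a))\<^sup>2" using cr c by (intro power_mono) auto
  also have "\<dots> \<le> 8 * q + 8 * (norm a)\<^sup>2"
    using sum_squares_bound[of r "norm a"] r(2) by (simp add: power2_eq_square algebra_simps)
  also have "\<dots> \<le> 8 * (1 + norm a)\<^sup>2 * (1 + q)" using q by (simp add: power2_sum algebra_simps)
  finally have c2: "c\<^sup>2 \<le> 8 * (1 + norm a)\<^sup>2 * (1 + q)" .
  have "norm (- (2 * of_real c) * B (c *\<^sub>R b') b) \<le> 2 * c * (W\<^sup>2 * norm (c *\<^sub>R b') * norm b)"
    using sectorial_form_norm_le[OF B, of "c *\<^sub>R b'" b] c by (simp add: norm_mult)
  also have "\<dots> = 2 * (W\<^sup>2 * c\<^sup>2) * (norm b' * norm b)" using c by (simp add: power2_eq_square)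
  also have "\<dots> \<le> 2 * (W\<^sup>2 * (8 * (1 + norm a)\<^sup>2 * (1 + q))) * (1 * 1)"
    using b c2 q by (intro mult_mono) auto
  finally show "norm (- (2 * of_real c) * B (c *\<^sub>R b') b) \<le> W\<^sup>2 * (16 * (1 + norm a)\<^sup>2 * (1 + q))"
    by (simp add: mult_ac)
qed

lemma norm_form_gauss: "norm (form_gauss B a \<xi>) = exp (- Re (B (\<xi> - a) (\<xi> - a)))"
  by (simp add: form_gauss_def)

lemma norm_form_gauss_le:
  assumes B: "sectorial_form W B" and \<theta>: "0 \<le> \<theta>" and K: "1 \<le> K"
  shows "norm (form_gauss B a \<xi>) \<le> K * exp (- ((1 - \<theta>) * Re (B (\<xi> - a) (\<xi> - a))))"
proof -
  have "(1 - \<theta>) * Re (B (\<xi> - a) (\<xi> - a)) \<le> Re (B (\<xi> - a) (\<xi> - a))"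
    using mult_nonneg_nonneg[OF \<theta> sectorial_formD(5)[OF B]] by (simp add: left_diff_distrib)
  then have "1 * exp (- Re (B (\<xi> - a) (\<xi> - a))) \<le> K * exp (- ((1 - \<theta>) * Re (B (\<xi> - a) (\<xi> - a))))"
    using K by (intro mult_mono) auto
  then show ?thesis by (simp add: norm_form_gauss)
qed

lemma form_gauss_measurable:
  assumes "sectorial_form W B" shows "(\<lambda>\<xi>. form_gauss B a (c *\<^sub>R \<xi>)) \<in> borel_measurable borel"
  unfolding form_gauss_def
  by (intro borel_measurable_continuous_onI continuous_intros continuous_on_sectorial_form[OF assms])

lemma derivs_bounded_form_slope:
  assumes B: "sectorial_form W B" and c: "c > 0" and \<delta>: "\<delta> > 0"
    and K: "16 * (1 + norm a)\<^sup>2 * (1 + 1 / \<delta>) \<le> K" and b: "b \<in> Basis"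
  shows "derivs_bounded W {\<xi>. 1/2 \<le> norm \<xi>} j (\<lambda>\<xi>. W * (K * exp (\<delta> * Re (B (c *\<^sub>R \<xi> - a) (c *\<^sub>R \<xi> - a)))))
    (\<lambda>\<xi>. - (2 * of_real c) * B (c *\<^sub>R \<xi> - a) b)"
proof -
  let ?q = "\<lambda>\<xi>. Re (B (c *\<^sub>R \<xi> - a) (c *\<^sub>R \<xi> - a))"
  note W = sectorial_formD(1)[OF B]
  have loss: "16 * (1 + norm a)\<^sup>2 * (1 + ?q \<xi>) \<le> K * exp (\<delta> * ?q \<xi>)" for \<xi>
  proof -
    have "16 * (1 + norm a)\<^sup>2 * (1 + ?q \<xi>) \<le> 16 * (1 + norm a)\<^sup>2 * ((1 + 1 / \<delta>) * exp (\<delta> * ?q \<xi>))"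
      by (intro mult_left_mono one_plus_le_exp \<delta> sectorial_formD(5)[OF B]) auto
    also have "\<dots> \<le> K * exp (\<delta> * ?q \<xi>)"
      unfolding mult.assoc[symmetric] by (intro mult_right_mono K) auto
    finally show ?thesis .
  qed
  show ?thesis
  proof (rule derivs_bounded_affine[where c="\<lambda>b'. - (2 * of_real c) * B (c *\<^sub>R b') b"])
    show "(\<lambda>\<xi>. - (2 * of_real c) * B (c *\<^sub>R \<xi> - a) b) \<in> borel_measurable borel"
      by (intro borel_measurable_continuous_onI continuous_intros continuous_on_sectorial_form[OF B])
    fix \<xi> :: 'a assume \<xi>: "\<xi> \<in> {\<xi>. 1/2 \<le> norm \<xi>}"
    have "W * (16 * (1 + norm a)\<^sup>2 * (1 + ?q \<xi>)) \<le> W * (K * exp (\<delta> * ?q \<xi>))"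
      and "W\<^sup>2 * (16 * (1 + norm a)\<^sup>2 * (1 + ?q \<xi>)) \<le> W\<^sup>2 * (K * exp (\<delta> * ?q \<xi>))"
      using W by (intro mult_left_mono loss; simp)+
    then have bounds: "norm (- (2 * of_real c) * B (c *\<^sub>R \<xi> - a) b) \<le> W * (K * exp (\<delta> * ?q \<xi>))"
      "b' \<in> Basis \<Longrightarrow> norm (- (2 * of_real c) * B (c *\<^sub>R b') b) \<le> W * (W * (K * exp (\<delta> * ?q \<xi>)))" for b'
      using form_slope_bounds[OF B c, of \<xi> b b a] form_slope_bounds[OF B c, of \<xi> b b' a] \<xi> b
      by (auto simp: power2_eq_square mult.assoc norm_Basis)
    show "norm (- (2 * of_real c) * B (c *\<^sub>R \<xi> - a) b) \<le> W * (K * exp (\<delta> * ?q \<xi>))" by (rule bounds)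
    show "norm (- (2 * of_real c) * B (c *\<^sub>R b') b) \<le> W * (W * (K * exp (\<delta> * ?q \<xi>)))" if "b' \<in> Basis" for b'
      using that by (rule bounds)
  qed (use W form_slope_has_directional_derivative[OF B] in auto)
qed

lemma derivs_bounded_form_gauss:
  assumes B: "sectorial_form W B" and c: "c > 0" and \<delta>: "\<delta> > 0"
    and K: "16 * (1 + norm a)\<^sup>2 * (1 + 1 / \<delta>) \<le> K"
  shows "derivs_bounded W {\<xi>. 1/2 \<le> norm \<xi>} j
    (\<lambda>\<xi>. (2 ^ j * K) ^ j * exp (- ((1 - real j * \<delta>) * Re (B (c *\<^sub>R \<xi> - a) (c *\<^sub>R \<xi> - a)))))
    (\<lambda>\<xi>. form_gauss B a (c *\<^sub>R \<xi>))"
proof (induction j)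
  let ?q = "\<lambda>\<xi>. Re (B (c *\<^sub>R \<xi> - a) (c *\<^sub>R \<xi> - a))"
  case 0
  show ?case using form_gauss_measurable[OF B] by (simp add: norm_form_gauss)
next
  let ?q = "\<lambda>\<xi>. Re (B (c *\<^sub>R \<xi> - a) (c *\<^sub>R \<xi> - a))"
  case (Suc j)
  let ?A = "\<lambda>\<xi>. (2 ^ Suc j * K) ^ Suc j * exp (- ((1 - real (Suc j) * \<delta>) * ?q \<xi>))"
  note W = sectorial_formD(1)[OF B]
  have "1 * 1 * 1 \<le> 16 * (1 + norm a)\<^sup>2 * (1 + 1 / \<delta>)" using \<delta> by (intro mult_mono one_le_power) auto
  then have K1: "1 \<le> K" using K by linarith
  have K_mono: "2 ^ j * K * (2 ^ j * K) ^ j \<le> (2 ^ Suc j * K) ^ Suc j"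
    using K1 by (simp only: power_Suc[symmetric]) (intro power_mono mult_right_mono, auto)
  show ?case
  proof (rule derivs_bounded_SucI)
    have "1 \<le> (2 ^ Suc j * K) ^ Suc j"
      using K1 mult_mono[of 1 "2 ^ Suc j" 1 K] one_le_power[of "2::real" "Suc j"] by (intro one_le_power) simp
    then show "norm (form_gauss B a (c *\<^sub>R \<xi>)) \<le> ?A \<xi>" for \<xi>
      using \<delta> by (intro norm_form_gauss_le[OF B]) auto
    fix b :: 'a assume b: "b \<in> Basis"
    have "derivs_bounded W {\<xi>. 1/2 \<le> norm \<xi>} j
        (\<lambda>\<xi>. 2 ^ j * (W * (K * exp (\<delta> * ?q \<xi>)) * ((2 ^ j * K) ^ j * exp (- ((1 - real j * \<delta>) * ?q \<xi>)))))
        (\<lambda>\<xi>. (- (2 * of_real c) * B (c *\<^sub>R \<xi> - a) b) * form_gauss B a (c *\<^sub>R \<xi>))"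
      using W by (intro derivs_bounded_mult derivs_bounded_form_slope[OF B c \<delta> K b] Suc.IH) simp
    then have "derivs_bounded W {\<xi>. 1/2 \<le> norm \<xi>} j (\<lambda>\<xi>. W * ?A \<xi>)
        (\<lambda>\<xi>. (- (2 * of_real c) * B (c *\<^sub>R \<xi> - a) b) * form_gauss B a (c *\<^sub>R \<xi>))"
    proof (rule derivs_bounded_mono)
      fix \<xi>
      have "2 ^ j * (W * (K * exp (\<delta> * ?q \<xi>)) * ((2 ^ j * K) ^ j * exp (- ((1 - real j * \<delta>) * ?q \<xi>))))
          = W * ((2 ^ j * K * (2 ^ j * K) ^ j) * exp (- ((1 - real (Suc j) * \<delta>) * ?q \<xi>)))"
        by (simp add: algebra_simps flip: exp_add)
      also have "\<dots> \<le> W * ?A \<xi>"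
        using W K_mono by (intro mult_left_mono mult_right_mono) auto
      finally show "2 ^ j * (W * (K * exp (\<delta> * ?q \<xi>)) * ((2 ^ j * K) ^ j * exp (- ((1 - real j * \<delta>) * ?q \<xi>))))
          \<le> W * ?A \<xi>" .
    qed (use W in auto)
    then show "\<exists>f'. ((\<lambda>\<xi>. form_gauss B a (c *\<^sub>R \<xi>)) has_directional_derivative f') b
        \<and> derivs_bounded W {\<xi>. 1/2 \<le> norm \<xi>} j (\<lambda>\<xi>. W * ?A \<xi>) f'"
      using form_gauss_scale_has_directional_derivative[OF B] by blast
  qed (rule form_gauss_measurable[OF B])
qed

definition annulus :: "'a::real_normed_vector set" where
  "annulus = {\<xi>. 1/2 \<le> norm \<xi> \<and> norm \<xi> \<le> 2}"

lemma closed_annulus: "closed annulus"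
  unfolding annulus_def by (intro closed_Collect_conj closed_Collect_le continuous_intros)

lemma annulus_sets [measurable]: "(annulus :: 'a::euclidean_space set) \<in> sets borel"
  by (rule borel_closed[OF closed_annulus])

definition shell_gauss :: "('a::euclidean_space \<Rightarrow> 'a \<Rightarrow> complex) \<Rightarrow> 'a \<Rightarrow> real \<Rightarrow> 'a \<Rightarrow> real" where
  "shell_gauss B a c \<xi> = (if \<xi> \<in> annulus then exp (- (Re (B (c *\<^sub>R \<xi> - a) (c *\<^sub>R \<xi> - a)) / 2)) else 0)"

definition shell_norm :: "real \<Rightarrow> ('a::euclidean_space \<Rightarrow> 'a \<Rightarrow> complex) \<Rightarrow> 'a \<Rightarrow> ennreal" where
  "shell_norm u B a = (SUP k::int. Lp_norm u (\<lambda>\<xi>. complex_of_real (shell_gauss B a (2 powr real_of_int k) \<xi>)))"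

lemma shell_gauss_measurable:
  assumes "sectorial_form W B" shows "shell_gauss B a c \<in> borel_measurable borel"
proof -
  have [measurable]: "(\<lambda>\<xi>. B (c *\<^sub>R \<xi> - a) (c *\<^sub>R \<xi> - a)) \<in> borel_measurable borel"
    by (intro borel_measurable_continuous_onI continuous_intros continuous_on_sectorial_form[OF assms])
  show ?thesis unfolding shell_gauss_def[abs_def] by measurable
qed

lemma derivs_bounded_form_gauss_cutoff:
  assumes B: "sectorial_form W B" and c: "c > 0" and \<delta>: "\<delta> = 1 / (2 * real J)" and J: "J > 0"
    and \<phi>: "derivs_bounded 1 UNIV J (\<lambda>_. L) \<phi>" and supp: "\<And>\<xi>. \<xi> \<notin> annulus \<Longrightarrow> \<phi> \<xi> = 0"
  shows "derivs_bounded W UNIV J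
    (\<lambda>\<xi>. (2 ^ J * ((2 ^ J * (16 * (1 + norm a)\<^sup>2 * (1 + 1 / \<delta>))) ^ J * L)) * shell_gauss B a c \<xi>)
    (\<lambda>\<xi>. form_gauss B a (c *\<^sub>R \<xi>) * \<phi> \<xi>)"
proof -
  let ?q = "\<lambda>\<xi>. Re (B (c *\<^sub>R \<xi> - a) (c *\<^sub>R \<xi> - a))" and ?K = "(2 ^ J * (16 * (1 + norm a)\<^sup>2 * (1 + 1 / \<delta>))) ^ J"
  note W = sectorial_formD(1)[OF B]
  have \<delta>_pos: "\<delta> > 0" and half: "1 - real J * \<delta> = 1/2" using J by (auto simp: \<delta>)
  have "derivs_bounded W annulus J (\<lambda>\<xi>. ?K * exp (- ((1 - real J * \<delta>) * ?q \<xi>))) (\<lambda>\<xi>. form_gauss B a (c *\<^sub>R \<xi>))"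
    using W by (intro derivs_bounded_mono[OF derivs_bounded_form_gauss[OF B c \<delta>_pos order_refl]])
      (auto simp: annulus_def)
  moreover have "derivs_bounded W annulus J (\<lambda>_. L) \<phi>"
    using W by (intro derivs_bounded_mono[OF \<phi>]) auto
  ultimately have "derivs_bounded W annulus J (\<lambda>\<xi>. 2 ^ J * (?K * exp (- ((1 - real J * \<delta>) * ?q \<xi>)) * L))
      (\<lambda>\<xi>. form_gauss B a (c *\<^sub>R \<xi>) * \<phi> \<xi>)"
    using W by (intro derivs_bounded_mult) auto
  from derivs_bounded_restrict[OF closed_annulus this] supp
  have "derivs_bounded W UNIV J
      (\<lambda>\<xi>. if \<xi> \<in> annulus then 2 ^ J * (?K * exp (- ((1 - real J * \<delta>) * ?q \<xi>)) * L) else 0)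
      (\<lambda>\<xi>. form_gauss B a (c *\<^sub>R \<xi>) * \<phi> \<xi>)" by simp
  then show ?thesis
    unfolding half by (rule derivs_bounded_mono) (use W in \<open>auto simp: shell_gauss_def\<close>)
qed

lemma sobolev_norm_form_gauss_cutoff_le:
  fixes \<phi> :: "'a::euclidean_space \<Rightarrow> complex"
  assumes \<phi>: "derivs_bounded 1 UNIV (2 * M + 2) (\<lambda>_. L) \<phi>" and supp: "\<And>\<xi>. \<xi> \<notin> annulus \<Longrightarrow> \<phi> \<xi> = 0"
    and u: "u \<ge> 1" and \<sigma>: "0 \<le> \<sigma>" "\<sigma> < 2"
  obtains D where "D \<ge> 0"
    "\<And>W B c. sectorial_form W B \<Longrightarrow> 0 < c \<Longrightarrow> sobolev_norm u (2 * real M + \<sigma>) (\<lambda>\<xi>. form_gauss B a (c *\<^sub>R \<xi>) * \<phi> \<xi>)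
      \<le> ennreal (D * W powr (2 * real M + \<sigma>)) * Lp_norm u (\<lambda>\<xi>. complex_of_real (shell_gauss B a c \<xi>))"
proof -
  define J where "J = 2 * M + 2"
  have L: "L \<ge> 0" using derivs_bounded_norm_le[OF \<phi>, of 0] norm_ge_zero order_trans by blast
  define K where "K = 2 ^ J * ((2 ^ J * (16 * (1 + norm a)\<^sup>2 * (1 + 1 / (1 / (2 * real J))))) ^ J * L)"
  define D where "D = (exp 1 + 2 / Gamma (1 - \<sigma> / 2)) * (1 + real DIM('a)) ^ Suc M"
  have K: "K \<ge> 0" using L by (simp add: K_def)
  have D: "D \<ge> 0" using \<sigma> by (simp add: D_def add_nonneg_nonneg)
  show thesis
  proof
    show "D * K \<ge> 0" using D K by simp
    fix W c :: real and B :: "'a \<Rightarrow> 'a \<Rightarrow> complex"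
    assume B: "sectorial_form W B" and c: "0 < c"
    let ?S = "\<lambda>\<xi>. complex_of_real (shell_gauss B a c \<xi>)"
    note shell_gauss_measurable[OF B, measurable]
    have range: "0 \<le> K * shell_gauss B a c \<xi>" "K * shell_gauss B a c \<xi> \<le> K" for \<xi>
      using K sectorial_formD(5)[OF B] by (auto simp: shell_gauss_def intro: mult_left_le)
    have "derivs_bounded W UNIV J (\<lambda>\<xi>. K * shell_gauss B a c \<xi>) (\<lambda>\<xi>. form_gauss B a (c *\<^sub>R \<xi>) * \<phi> \<xi>)"
      unfolding K_def by (rule derivs_bounded_form_gauss_cutoff[OF B c refl _ \<phi>[folded J_def] supp])
        (auto simp: J_def)
    then have "sobolev_norm u (2 * real M + \<sigma>) (\<lambda>\<xi>. form_gauss B a (c *\<^sub>R \<xi>) * \<phi> \<xi>)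
        \<le> ennreal (D * W powr (2 * real M + \<sigma>)) * Lp_norm u (\<lambda>\<xi>. complex_of_real (K * shell_gauss B a c \<xi>))"
      unfolding D_def J_def using supp u \<sigma> sectorial_formD(1)[OF B]
      by (intro sobolev_norm_le_derivs_bounded[where B=K and R=2] range) (auto simp: annulus_def)
    also have "\<dots> = ennreal (D * W powr (2 * real M + \<sigma>)) * (ennreal K * Lp_norm u ?S)"
      using K u Lp_norm_cmult[of u ?S "of_real K"] by simp
    also have "\<dots> = ennreal (D * K * W powr (2 * real M + \<sigma>)) * Lp_norm u ?S"
      using D K by (simp add: ennreal_mult mult_ac)
    finally show "sobolev_norm u (2 * real M + \<sigma>) (\<lambda>\<xi>. form_gauss B a (c *\<^sub>R \<xi>) * \<phi> \<xi>)
        \<le> ennreal (D * K * W powr (2 * real M + \<sigma>)) * Lp_norm u ?S" .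
  qed
qed

proposition A_norm_form_gauss_le:
  fixes \<Theta> :: "real^'n^'l \<Rightarrow> complex" and a :: "real^'n^'l"
  assumes \<Theta>: "rapid_decay \<Theta>" and supp: "\<And>\<xi>. \<xi> \<notin> annulus \<Longrightarrow> FT \<Theta> \<xi> = 0"
    and u: "u \<ge> 1" and s: "s \<ge> 0"
  obtains C where "C \<ge> 0"
    "\<And>W B. sectorial_form W B \<Longrightarrow> A_norm \<Theta> u s (form_gauss B a) \<le> ennreal (C * W powr s) * shell_norm u B a"
proof -
  define M where "M = nat \<lfloor>s / 2\<rfloor>"
  define \<sigma> where "\<sigma> = s - 2 * real M"
  have "real M = of_int \<lfloor>s / 2\<rfloor>" using s by (simp add: M_def)
  then have \<sigma>: "0 \<le> \<sigma>" "\<sigma> < 2" "2 * real M + \<sigma> = s" unfolding \<sigma>_def by linarith+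
  obtain L where L: "derivs_bounded 1 UNIV (2 * M + 2) (\<lambda>_. L) (FT \<Theta>)" using derivs_bounded_FT[OF \<Theta>] by blast
  obtain D where D: "D \<ge> 0" "\<And>W B c. sectorial_form W B \<Longrightarrow> 0 < c \<Longrightarrow>
      sobolev_norm u s (\<lambda>\<xi>. form_gauss B a (c *\<^sub>R \<xi>) * FT \<Theta> \<xi>)
        \<le> ennreal (D * W powr s) * Lp_norm u (\<lambda>\<xi>. complex_of_real (shell_gauss B a c \<xi>))"
    by (rule sobolev_norm_form_gauss_cutoff_le[OF L supp u \<sigma>(1,2), of a, unfolded \<sigma>(3)]) blast+
  show thesis
  proof
    fix W and B :: "real^'n^'l \<Rightarrow> real^'n^'l \<Rightarrow> complex"
    assume B: "sectorial_form W B"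
    have "sobolev_norm u s (\<lambda>\<xi>. form_gauss B a ((2 powr real_of_int k) *\<^sub>R \<xi>) * FT \<Theta> \<xi>)
        \<le> ennreal (D * W powr s) * shell_norm u B a" for k :: int
      unfolding shell_norm_def by (rule order_trans[OF D(2)[OF B]]) (auto intro!: mult_left_mono SUP_upper)
    then show "A_norm \<Theta> u s (form_gauss B a) \<le> ennreal (D * W powr s) * shell_norm u B a"
      unfolding A_norm_def by (rule SUP_least)
  qed (rule D(1))
qed

definition sector_weight :: "real \<Rightarrow> complex \<Rightarrow> bool" where
  "sector_weight W z \<longleftrightarrow> 1 \<le> Re z \<and> (norm z)\<^sup>2 \<le> W\<^sup>2 * Re z"

lemma sector_weight_Re_pos: "sector_weight W z \<Longrightarrow> 0 < Re z"
  by (simp add: sector_weight_def)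

lemma sector_weight_norm_mult_le:
  assumes "sector_weight W z" "0 \<le> W"
  shows "norm z * norm y \<le> W * sqrt (Re z * (norm y)\<^sup>2)"
proof -
  have "(norm z * norm y)\<^sup>2 \<le> W\<^sup>2 * (Re z * (norm y)\<^sup>2)"
    using assms mult_right_mono[of "(norm z)\<^sup>2" "W\<^sup>2 * Re z" "(norm y)\<^sup>2"]
    by (simp add: sector_weight_def power_mult_distrib mult.assoc)
  then have "sqrt ((norm z * norm y)\<^sup>2) \<le> sqrt (W\<^sup>2 * (Re z * (norm y)\<^sup>2))" by (rule real_sqrt_le_mono)
  then show ?thesis using assms(2) by (simp add: real_sqrt_mult)
qed

lemma Re_weight_form:
  "Re (weight_form w v \<eta> \<eta>) = pi * ((\<Sum>i\<in>UNIV. Re (w i) * (norm (\<eta> $ i))\<^sup>2) + Re v * (norm (\<Sum>i\<in>UNIV. \<eta> $ i))\<^sup>2)"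
  by (simp add: weight_form_def power2_norm_eq_inner)

lemma norm_sum_vec_le: "norm (\<Sum>i\<in>UNIV. \<zeta> $ i) \<le> real CARD('l) * norm (\<zeta> :: real^'n^'l)"
  using sum_norm_bound[of UNIV "\<lambda>i. \<zeta> $ i" "norm \<zeta>"] Finite_Cartesian_Product.norm_nth_le[of \<zeta>] by simp

lemma norm_weight_form_le:
  fixes \<eta> \<zeta> :: "real^'n^'l"
  shows "norm (weight_form w v \<eta> \<zeta>)
    \<le> pi * ((\<Sum>i\<in>UNIV. norm (w i) * norm (\<eta> $ i)) + real CARD('l) * (norm v * norm (\<Sum>i\<in>UNIV. \<eta> $ i))) * norm \<zeta>"
proof -
  let ?l = "real CARD('l)" and ?S = "\<lambda>\<eta>::real^'n^'l. \<Sum>i\<in>UNIV. \<eta> $ i"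
  have "norm (\<Sum>i\<in>UNIV. w i * of_real (\<eta> $ i \<bullet> \<zeta> $ i)) \<le> (\<Sum>i\<in>UNIV. norm (w i) * norm (\<eta> $ i) * norm \<zeta>)"
  proof (rule sum_norm_le)
    fix i
    have "\<bar>\<eta> $ i \<bullet> \<zeta> $ i\<bar> \<le> norm (\<eta> $ i) * norm (\<zeta> $ i)" by (rule Cauchy_Schwarz_ineq2)
    also have "\<dots> \<le> norm (\<eta> $ i) * norm \<zeta>" by (intro mult_left_mono Finite_Cartesian_Product.norm_nth_le) auto
    finally show "norm (w i * of_real (\<eta> $ i \<bullet> \<zeta> $ i)) \<le> norm (w i) * norm (\<eta> $ i) * norm \<zeta>"
      by (simp add: norm_mult mult.assoc mult_left_mono)
  qed
  moreover have "norm (v * of_real (?S \<eta> \<bullet> ?S \<zeta>)) \<le> ?l * (norm v * norm (?S \<eta>)) * norm \<zeta>"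
  proof -
    have "\<bar>?S \<eta> \<bullet> ?S \<zeta>\<bar> \<le> norm (?S \<eta>) * norm (?S \<zeta>)" by (rule Cauchy_Schwarz_ineq2)
    also have "\<dots> \<le> norm (?S \<eta>) * (?l * norm \<zeta>)" by (intro mult_left_mono norm_sum_vec_le) auto
    finally have "norm v * \<bar>?S \<eta> \<bullet> ?S \<zeta>\<bar> \<le> norm v * (norm (?S \<eta>) * (?l * norm \<zeta>))" by (rule mult_left_mono) simp
    then show ?thesis by (simp add: norm_mult mult_ac)
  qed
  ultimately have "norm ((\<Sum>i\<in>UNIV. w i * of_real (\<eta> $ i \<bullet> \<zeta> $ i)) + v * of_real (?S \<eta> \<bullet> ?S \<zeta>))
      \<le> (\<Sum>i\<in>UNIV. norm (w i) * norm (\<eta> $ i) * norm \<zeta>) + ?l * (norm v * norm (?S \<eta>)) * norm \<zeta>"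
    by (rule norm_triangle_mono)
  also have "\<dots> = ((\<Sum>i\<in>UNIV. norm (w i) * norm (\<eta> $ i)) + ?l * (norm v * norm (?S \<eta>))) * norm \<zeta>"
    by (simp add: sum_distrib_right distrib_right)
  finally show ?thesis
    by (simp add: weight_form_def norm_mult mult.assoc mult_left_mono)
qed

lemma bounded_bilinear_weight_form:
  "bounded_bilinear (weight_form w v :: real^'n^'l \<Rightarrow> real^'n^'l \<Rightarrow> complex)"
proof
  fix \<eta> \<eta>' \<zeta> \<zeta>' :: "real^'n^'l" and r :: real
  show "weight_form w v (\<eta> + \<eta>') \<zeta> = weight_form w v \<eta> \<zeta> + weight_form w v \<eta>' \<zeta>"
    and "weight_form w v \<eta> (\<zeta> + \<zeta>') = weight_form w v \<eta> \<zeta> + weight_form w v \<eta> \<zeta>'"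
    by (simp_all add: weight_form_def inner_add_left inner_add_right sum.distrib algebra_simps)
  show "weight_form w v (r *\<^sub>R \<eta>) \<zeta> = r *\<^sub>R weight_form w v \<eta> \<zeta>"
    and "weight_form w v \<eta> (r *\<^sub>R \<zeta>) = r *\<^sub>R weight_form w v \<eta> \<zeta>"
    by (simp_all add: weight_form_def scaleR_conv_of_real[where 'a=complex] sum_distrib_left algebra_simps flip:
        scaleR_sum_right)
  let ?K = "pi * ((\<Sum>i\<in>UNIV. norm (w i)) + real CARD('l) * (norm v * real CARD('l)))"
  have "norm (weight_form w v \<eta> \<zeta>) \<le> norm \<eta> * norm \<zeta> * ?K" for \<eta> \<zeta> :: "real^'n^'l"
  proof -
    have "(\<Sum>i\<in>UNIV. norm (w i) * norm (\<eta> $ i)) + real CARD('l) * (norm v * norm (\<Sum>i\<in>UNIV. \<eta> $ i))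
        \<le> (\<Sum>i\<in>UNIV. norm (w i) * norm \<eta>) + real CARD('l) * (norm v * (real CARD('l) * norm \<eta>))"
      by (intro add_mono sum_mono mult_left_mono Finite_Cartesian_Product.norm_nth_le norm_sum_vec_le) auto
    then have "pi * ((\<Sum>i\<in>UNIV. norm (w i) * norm (\<eta> $ i)) + real CARD('l) * (norm v * norm (\<Sum>i\<in>UNIV. \<eta> $ i)))
        * norm \<zeta>
        \<le> pi * ((\<Sum>i\<in>UNIV. norm (w i) * norm \<eta>) + real CARD('l) * (norm v * (real CARD('l) * norm \<eta>))) * norm \<zeta>"
      by (intro mult_right_mono mult_left_mono) auto
    also have "\<dots> = norm \<eta> * norm \<zeta> * ?K"
      by (simp add: sum_distrib_left sum_distrib_right algebra_simps)
    finally show ?thesis by (rule order_trans[OF norm_weight_form_le])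
  qed
  then show "\<exists>K. \<forall>\<eta> \<zeta> :: real^'n^'l. norm (weight_form w v \<eta> \<zeta>) \<le> norm \<eta> * norm \<zeta> * K" by blast
qed

lemma sectorial_weight_form:
  assumes W: "1 \<le> W" and w: "\<And>i. sector_weight W (w i)" and v: "sector_weight W v"
  shows "sectorial_form (2 * pi * real CARD('l) * W) (weight_form w v :: real^'n^'l \<Rightarrow> real^'n^'l \<Rightarrow> complex)"
  unfolding sectorial_form_def
proof (intro conjI allI bounded_bilinear_weight_form)
  let ?l = "real CARD('l)" and ?S = "\<lambda>\<eta>::real^'n^'l. \<Sum>i\<in>UNIV. \<eta> $ i"
  have "1 * 1 * 1 \<le> 2 * pi * ?l" using pi_ge_two by (intro mult_mono) (auto simp: Suc_leI)
  then show "1 \<le> 2 * pi * ?l * W" using mult_mono[of 1 "2 * pi * ?l" 1 W] W by simp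
  fix \<eta> \<zeta> :: "real^'n^'l"
  show "weight_form w v \<eta> \<zeta> = weight_form w v \<zeta> \<eta>" by (simp add: weight_form_def inner_commute)
  let ?s = "\<Sum>i\<in>UNIV. Re (w i) * (norm (\<eta> $ i))\<^sup>2" and ?t = "Re v * (norm (?S \<eta>))\<^sup>2"
    and ?q = "Re (weight_form w v \<eta> \<eta>)"
  have nonneg: "0 \<le> Re (w i) * (norm (\<eta> $ i))\<^sup>2" "0 \<le> ?t" for i
    using sector_weight_Re_pos[OF w] sector_weight_Re_pos[OF v] by (auto simp: less_imp_le)
  then have "1 * (?s + ?t) \<le> pi * (?s + ?t)"
    using pi_ge_two by (intro mult_right_mono add_nonneg_nonneg sum_nonneg) auto
  then have q: "?s + ?t \<le> ?q" by (simp add: Re_weight_form)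
  have term_le: "Re (w i) * (norm (\<eta> $ i))\<^sup>2 \<le> ?q" "?t \<le> ?q" for i
    using q nonneg member_le_sum[of i UNIV "\<lambda>i. Re (w i) * (norm (\<eta> $ i))\<^sup>2"]
        sum_nonneg[of UNIV "\<lambda>i. Re (w i) * (norm (\<eta> $ i))\<^sup>2"]
    by fastforce+
  have "(norm \<eta>)\<^sup>2 = (\<Sum>i\<in>UNIV. 1 * (norm (\<eta> $ i))\<^sup>2)" by (simp add: norm_vec_def L2_set_def sum_nonneg)
  also have "\<dots> \<le> ?s" using w by (intro sum_mono mult_right_mono) (auto simp: sector_weight_def)
  finally show "(norm \<eta>)\<^sup>2 \<le> ?q" using q nonneg(2) by linarith
  have weighted: "norm z * norm y \<le> W * sqrt ?q"
    if "sector_weight W z" "Re z * (norm y)\<^sup>2 \<le> ?q" for z and y :: "real^'n"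
    using W by (intro order_trans[OF sector_weight_norm_mult_le[OF that(1)] mult_left_mono] real_sqrt_le_mono
        that(2)) auto
  have "norm (weight_form w v \<eta> \<zeta>)
      \<le> pi * ((\<Sum>i\<in>UNIV. norm (w i) * norm (\<eta> $ i)) + ?l * (norm v * norm (?S \<eta>))) * norm \<zeta>"
    by (rule norm_weight_form_le)
  also have "\<dots> \<le> pi * ((\<Sum>i\<in>(UNIV::'l set). W * sqrt ?q) + ?l * (W * sqrt ?q)) * norm \<zeta>"
    by (intro mult_right_mono mult_left_mono add_mono sum_mono weighted w v term_le) auto
  finally show "norm (weight_form w v \<eta> \<zeta>) \<le> 2 * pi * ?l * W * sqrt ?q * norm \<zeta>" by (simp add: algebra_simps)
qed

lemma emeasure_lborel_cball_eq_measure: "emeasure lborel (cball (x::'a::euclidean_space) r)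
    = ennreal (measure lborel (cball x r))"
  using emeasure_lborel_cball_finite[of x r] by (simp add: emeasure_eq_ennreal_measure less_top)

lemma Lp_norm_shell_gauss_le:
  fixes a :: "'a::euclidean_space"
  assumes u: "u > 0" and M: "M \<ge> 0" and le: "\<And>\<xi>. \<xi> \<in> annulus
      \<Longrightarrow> exp (- (Re (B (c *\<^sub>R \<xi> - a) (c *\<^sub>R \<xi> - a)) / 2)) \<le> M"
  shows "Lp_norm u (\<lambda>\<xi>. complex_of_real (shell_gauss B a c \<xi>))
      \<le> ennreal (M * measure lborel (cball (0::'a) 2) powr (1 / u))"
proof -
  let ?V = "measure lborel (cball (0::'a) 2)"
  have "(\<integral>\<^sup>+ \<xi>. ennreal (norm (complex_of_real (shell_gauss B a c \<xi>)) powr u) \<partial>lborel)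
      \<le> (\<integral>\<^sup>+ \<xi>. ennreal (M powr u) * indicator (cball (0::'a) 2) \<xi> \<partial>lborel)"
  proof (rule nn_integral_mono)
    fix \<xi> :: 'a
    show "ennreal (norm (complex_of_real (shell_gauss B a c \<xi>)) powr u)
        \<le> ennreal (M powr u) * indicator (cball 0 2) \<xi>"
      using le[of \<xi>] u by (auto simp: shell_gauss_def annulus_def intro!: ennreal_leI powr_mono2)
  qed
  also have "\<dots> = ennreal ((M * ?V powr (1 / u)) powr u)"
    using u by (simp add: nn_integral_cmult_indicator emeasure_lborel_cball_eq_measure powr_mult powr_powr
        ennreal_mult)
  finally show ?thesis using u M by (subst Lp_norm_le_iff) auto
qed

lemma shell_norm_le_const:
  fixes a :: "'a::euclidean_space"
  assumes B: "sectorial_form W B" and u: "u > 0"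
  shows "shell_norm u B a \<le> ennreal (measure lborel (cball (0::'a) 2) powr (1 / u))"
  unfolding shell_norm_def
proof (rule SUP_least)
  fix k :: int
  show "Lp_norm u (\<lambda>\<xi>. complex_of_real (shell_gauss B a (2 powr real_of_int k) \<xi>))
      \<le> ennreal (measure lborel (cball (0::'a) 2) powr (1 / u))"
    using Lp_norm_shell_gauss_le[OF u zero_le_one, of B "2 powr real_of_int k" a] sectorial_formD(5)[OF B] by simp
qed

lemma lborel_nn_integral_affine:
  fixes f :: "'a::euclidean_space \<Rightarrow> ennreal"
  assumes [measurable]: "f \<in> borel_measurable borel" and c: "c > 0"
  shows "(\<integral>\<^sup>+ x. f (c *\<^sub>R x - a) \<partial>lborel) = ennreal ((1 / c) ^ DIM('a)) * (\<integral>\<^sup>+ x. f x \<partial>lborel)"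
proof -
  have "(\<integral>\<^sup>+ x. f x \<partial>lborel) = (\<integral>\<^sup>+ x. f x \<partial>density (distr lborel borel (\<lambda>x. - a + c *\<^sub>R x)) (\<lambda>_. \<bar>c\<bar> ^ DIM('a)))"
    using c by (subst lborel_affine[of c "- a"]) auto
  also have "\<dots> = ennreal (c ^ DIM('a)) * (\<integral>\<^sup>+ x. f (c *\<^sub>R x - a) \<partial>lborel)"
    using c by (simp add: nn_integral_density nn_integral_distr nn_integral_cmult)
  finally have "ennreal ((1 / c) ^ DIM('a)) * (\<integral>\<^sup>+ x. f x \<partial>lborel)
     = ennreal ((1 / c) ^ DIM('a) * c ^ DIM('a)) * (\<integral>\<^sup>+ x. f (c *\<^sub>R x - a) \<partial>lborel)"
    using c by (simp add: ennreal_mult mult.assoc)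
  also have "(1 / c) ^ DIM('a) * c ^ DIM('a) = 1" using c by (simp add: power_mult_distrib[symmetric])
  finally show ?thesis by simp
qed

lemma nn_integral_exp_weight_form:
  assumes w: "\<And>i. 0 < Re (w i)" and v: "0 < Re v" and r: "0 < r"
  shows "(\<integral>\<^sup>+ \<eta>. ennreal (exp (- (r * Re (weight_form w v \<eta> (\<eta> :: real^'n^'l))))) \<partial>lborel)
    = ennreal ((\<Prod>i\<in>UNIV. (r * Re (w i)) powr (- (real CARD('n) / 2)))
        * (1 + Re v * (\<Sum>i\<in>UNIV. 1 / Re (w i))) powr (- (real CARD('n) / 2)))"
proof -
  let ?b = "\<lambda>i. complex_of_real (r * Re (w i))" and ?v = "complex_of_real (r * Re v)"
  let ?h = "\<lambda>\<eta>::real^'n^'l. exp (- (r * Re (weight_form w v \<eta> \<eta>)))"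
  have "weight_form ?b ?v \<eta> \<eta> = of_real (r * Re (weight_form w v \<eta> \<eta>))" for \<eta> :: "real^'n^'l"
    unfolding Re_weight_form by (simp add: weight_form_def power2_norm_eq_inner sum_distrib_left algebra_simps)
  then have h: "(\<Prod>i\<in>UNIV. gauss (?b i) (\<eta> $ i)) * gauss ?v (\<Sum>i\<in>UNIV. \<eta> $ i)
      = complex_of_real (?h \<eta>)" for \<eta> :: "real^'n^'l"
    by (simp only: exp_weight_form[symmetric] exp_of_real[symmetric] of_real_minus)
  have b: "0 < Re (?b i)" "0 < Re ?v" for i using w v r by auto
  have "integrable lborel (\<lambda>\<eta>::real^'n^'l. complex_of_real (?h \<eta>))"
    unfolding h[symmetric]
  proof (rule Bochner_Integration.integrable_bound[OF integrable_vec_prod[of "\<lambda>i. gauss (?b i)"]])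
    show "AE \<eta> in lborel. norm ((\<Prod>i\<in>UNIV. gauss (?b i) (\<eta> $ i)) * gauss ?v (\<Sum>i\<in>UNIV. \<eta> $ i))
        \<le> norm (\<Prod>i\<in>UNIV. gauss (?b i) ((\<eta> :: real^'n^'l) $ i))"
      using b(2) by (intro AE_I2) (simp add: norm_mult norm_gauss mult_left_le)
  qed (use b(1) in \<open>auto intro!: integrable_gauss\<close>)
  then have int: "integrable lborel ?h" by (simp only: complex_of_real_integrable_eq)
  have "(\<integral>\<^sup>+ \<eta>. ennreal (?h \<eta>) \<partial>lborel) = ennreal (LINT \<eta>|lborel. ?h \<eta>)"
    using int by (intro nn_integral_eq_integral) auto
  also have "(LINT \<eta>|lborel. ?h \<eta>) = norm (LINT \<eta>|lborel. complex_of_real (?h \<eta>))"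
    by (simp add: integral_nonneg_AE)
  also have "\<dots> = (\<Prod>i\<in>(UNIV::'l set). norm (?b i) powr (- (real CARD('n) / 2)))
      * norm (1 + (\<Sum>i\<in>UNIV. 1 / ?b i) * ?v) powr (- (real CARD('n) / 2))"
    unfolding h[symmetric] using norm_gauss_form_integral[of ?b ?v "0 :: real^'n"] b by (simp add: gauss_def)
  also have "1 + (\<Sum>i\<in>UNIV. 1 / ?b i) * ?v = of_real (1 + Re v * (\<Sum>i\<in>UNIV. 1 / Re (w i)))"
    using r by (simp add: sum_distrib_left sum_distrib_right mult.commute)
  finally show ?thesis
    using w v r by (simp add: sum_nonneg less_imp_le abs_of_nonneg norm_mult del: of_real_add)
qed

lemma Lp_norm_shell_gauss_weight_form_le:
  fixes a :: "real^'n^'l"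
  assumes u: "0 < u" and c: "1/4 \<le> c" and w: "\<And>i. 0 < Re (w i)" and v: "0 < Re v"
  shows "Lp_norm u (\<lambda>\<xi>. complex_of_real (shell_gauss (weight_form w v) a c \<xi>))
    \<le> ennreal ((4 ^ DIM(real^'n^'l) * ((\<Prod>i\<in>UNIV. (u / 2 * Re (w i)) powr (- (real CARD('n) / 2)))
        * (1 + Re v * (\<Sum>i\<in>UNIV. 1 / Re (w i))) powr (- (real CARD('n) / 2)))) powr (1 / u))"
proof -
  let ?h = "\<lambda>\<eta>::real^'n^'l. exp (- (u / 2 * Re (weight_form w v \<eta> \<eta>)))"
  let ?X = "(\<Prod>i\<in>(UNIV::'l set). (u / 2 * Re (w i)) powr (- (real CARD('n) / 2)))
      * (1 + Re v * (\<Sum>i\<in>UNIV. 1 / Re (w i))) powr (- (real CARD('n) / 2))"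
  have X: "0 \<le> ?X" by (intro mult_nonneg_nonneg prod_nonneg) auto
  have c0: "0 < c" using c by simp
  have [measurable]: "?h \<in> borel_measurable borel"
    by (intro borel_measurable_continuous_onI continuous_intros
        bounded_bilinear.continuous_on[OF bounded_bilinear_weight_form])
  then have [measurable]: "(\<lambda>\<eta>. ennreal (?h \<eta>)) \<in> borel_measurable borel" by (rule measurable_compose) simp
  have "(\<integral>\<^sup>+ \<xi>. ennreal (norm (complex_of_real (shell_gauss (weight_form w v) a c \<xi>)) powr u) \<partial>lborel)
      \<le> (\<integral>\<^sup>+ \<xi>. ennreal (?h (c *\<^sub>R \<xi> - a)) \<partial>lborel)"
    by (intro nn_integral_mono ennreal_leI) (simp add: shell_gauss_def powr_def mult.commute)
  also have "\<dots> = ennreal ((1 / c) ^ DIM(real^'n^'l)) * (\<integral>\<^sup>+ \<eta>. ennreal (?h \<eta>) \<partial>lborel)"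
    using c0 by (intro lborel_nn_integral_affine) measurable
  also have "\<dots> \<le> ennreal (4 ^ DIM(real^'n^'l)) * (\<integral>\<^sup>+ \<eta>. ennreal (?h \<eta>) \<partial>lborel)"
    using c c0 by (intro mult_right_mono ennreal_leI power_mono) (auto simp: field_simps)
  also have "\<dots> = ennreal (((4 ^ DIM(real^'n^'l) * ?X) powr (1 / u)) powr u)"
    using nn_integral_exp_weight_form[OF w v, of "u / 2", where ?'n='n and ?'l='l] X u
    by (simp add: powr_powr ennreal_mult[symmetric])
  finally show ?thesis using u by (subst Lp_norm_le_iff) auto
qed

lemma Re_weight_form_ge:
  assumes "\<And>i. 0 \<le> Re (w i)" and v: "0 \<le> Re v"
  shows "Re v * (norm (\<Sum>i\<in>UNIV. \<eta> $ i))\<^sup>2 \<le> Re (weight_form w v \<eta> \<eta>)"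
proof -
  have "1 * (Re v * (norm (\<Sum>i\<in>UNIV. \<eta> $ i))\<^sup>2)
      \<le> pi * ((\<Sum>i\<in>UNIV. Re (w i) * (norm (\<eta> $ i))\<^sup>2) + Re v * (norm (\<Sum>i\<in>UNIV. \<eta> $ i))\<^sup>2)"
    using assms pi_ge_two by (intro mult_mono add_increasing sum_nonneg) auto
  then show ?thesis by (simp add: Re_weight_form)
qed

text \<open>For small \<open>c\<close> the dilated annulus stays away from the diagonal point \<open>a = (e, \<dots>, e)\<close> in the
  direction that \<open>v\<close> penalizes.\<close>

lemma Lp_norm_shell_gauss_diagonal_le:
  fixes a :: "real^'n^'l"
  assumes u: "0 < u" and c: "0 < c" "c < 1/4" and w: "\<And>i. 0 \<le> Re (w i)" and v: "0 \<le> Re v"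
    and a: "\<And>i. a $ i = e" "norm e = 1"
  shows "Lp_norm u (\<lambda>\<xi>. complex_of_real (shell_gauss (weight_form w v) a c \<xi>))
    \<le> ennreal (exp (- (Re v / 8)) * measure lborel (cball (0 :: real^'n^'l) 2) powr (1 / u))"
proof (rule Lp_norm_shell_gauss_le[OF u])
  fix \<xi> :: "real^'n^'l" assume "\<xi> \<in> annulus"
  then have \<xi>: "norm \<xi> \<le> 2" by (simp add: annulus_def)
  let ?l = "real CARD('l)" and ?S = "\<Sum>i\<in>UNIV. (c *\<^sub>R \<xi> - a) $ i"
  have "norm (\<Sum>i\<in>UNIV. \<xi> $ i) \<le> ?l * 2"
    using norm_sum_vec_le[of \<xi>] mult_left_mono[OF \<xi>, of ?l] by linarith
  then have "c * norm (\<Sum>i\<in>UNIV. \<xi> $ i) \<le> 1/4 * (?l * 2)"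
    using c by (intro mult_mono) auto
  moreover have "?S = c *\<^sub>R (\<Sum>i\<in>UNIV. \<xi> $ i) - ?l *\<^sub>R e"
    by (simp add: sum_subtractf scaleR_sum_right a sum_constant_scaleR del: sum_constant)
  then have "norm (?l *\<^sub>R e) - norm (c *\<^sub>R (\<Sum>i\<in>UNIV. \<xi> $ i)) \<le> norm ?S"
    by (metis norm_minus_commute norm_triangle_ineq2)
  then have "?l - c * norm (\<Sum>i\<in>UNIV. \<xi> $ i) \<le> norm ?S" using c by (simp add: a(2))
  moreover have "1 \<le> ?l" by (simp add: Suc_leI)
  ultimately have "1/2 \<le> norm ?S" by linarith
  then have "(1/2)\<^sup>2 \<le> (norm ?S)\<^sup>2" by (intro power_mono) auto
  then have "Re v * (1/2)\<^sup>2 \<le> Re v * (norm ?S)\<^sup>2" using v by (intro mult_left_mono)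
  then have "Re v / 4 \<le> Re (weight_form w v (c *\<^sub>R \<xi> - a) (c *\<^sub>R \<xi> - a))"
    using Re_weight_form_ge[where w=w, OF w v, of "c *\<^sub>R \<xi> - a"] by (simp add: power2_eq_square)
  then show "exp (- (Re (weight_form w v (c *\<^sub>R \<xi> - a) (c *\<^sub>R \<xi> - a)) / 2)) \<le> exp (- (Re v / 8))" by simp
qed simp

lemma power2_powr: "0 < x \<Longrightarrow> (x\<^sup>2) powr \<alpha> = (x::real) powr (2 * \<alpha>)"
  by (simp add: powr_powr flip: powr_numeral)

lemma powr_le_exp:
  fixes x \<nu> :: real
  assumes x: "0 \<le> x" and \<nu>: "0 < \<nu>"
  shows "x powr \<nu> \<le> \<nu> powr \<nu> * exp x"
proof -
  have "(x / \<nu>) powr \<nu> \<le> exp (x / \<nu>) powr \<nu>"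
    using x \<nu> exp_ge_add_one_self[of "x / \<nu>"] by (intro powr_mono2) (linarith | simp)+
  then show ?thesis using x \<nu> by (simp add: powr_divide exp_powr_real field_simps)
qed

lemma exp_neg_square_le:
  fixes W \<mu> :: real
  assumes \<mu>: "0 < \<mu>" and W: "0 < W"
  shows "exp (- (W\<^sup>2 / 8)) \<le> (4 * \<mu>) powr (\<mu> / 2) * W powr (- \<mu>)"
proof -
  have "W powr \<mu> / 8 powr (\<mu> / 2) \<le> (\<mu> / 2) powr (\<mu> / 2) * exp (W\<^sup>2 / 8)"
    using powr_le_exp[of "W\<^sup>2 / 8" "\<mu> / 2"] \<mu> W by (simp add: powr_divide power2_powr)
  moreover have "(4 * \<mu>) powr (\<mu> / 2) = (\<mu> / 2) powr (\<mu> / 2) * 8 powr (\<mu> / 2)"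
    by (simp flip: powr_mult)
  ultimately show ?thesis
    using W by (simp add: exp_minus powr_minus divide_simps) (simp add: mult_ac)
qed

lemma exponent_le_of_powr_le:
  fixes \<alpha> \<beta> c C :: real
  assumes c: "c > 0" and le: "\<And>W. W \<ge> 1 \<Longrightarrow> c * W powr \<alpha> \<le> C * W powr \<beta>"
  shows "\<alpha> \<le> \<beta>"
proof (rule ccontr)
  assume "\<not> \<alpha> \<le> \<beta>"
  then have d: "\<alpha> - \<beta> > 0" by simp
  have C: "C > 0" using le[of 1] c by simp
  define W where "W = (1 + C / c) powr (1 / (\<alpha> - \<beta>))"
  have W: "W \<ge> 1" using C c d by (simp add: W_def ge_one_powr_ge_zero)
  have "W powr (\<alpha> - \<beta>) = 1 + C / c" using C c d by (simp add: W_def powr_powr add_pos_pos)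
  moreover have "c * W powr (\<alpha> - \<beta>) \<le> C"
    using le[OF W] W by (simp add: powr_diff field_simps)
  ultimately have "c * (1 + C / c) \<le> C" by simp
  then show False using c by (simp add: distrib_left)
qed

lemma prod_if_powr:
  fixes x :: real
  assumes "x > 0"
  shows "(\<Prod>i\<in>(UNIV::'l::finite set). if i \<in> I then x powr e i else 1) = x powr (\<Sum>i\<in>I. e i)"
  using assms by (simp add: prod.If_cases powr_sum)

definition bump_weight :: "'l set \<Rightarrow> real \<Rightarrow> 'l \<Rightarrow> complex"
  where "bump_weight I W i = (if i \<in> I then of_real (W\<^sup>2) else 1)"

text \<open>\<open>1 + W\<^sup>2 \<cdot> (\<Sum>i. 1 / Re (bump_weight I W i))\<close> has the order of magnitude \<open>W\<close> to twice this power.\<close>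

definition bump_exponent :: "'l set \<Rightarrow> real"
  where "bump_exponent I = (if I = UNIV then 0 else 1)"

lemma one_plus_sum_bump_weight_bounds:
  fixes I :: "'l::finite set"
  assumes W: "1 \<le> W"
  defines "T \<equiv> 1 + W\<^sup>2 * (\<Sum>i\<in>UNIV. 1 / Re (bump_weight I W i))"
  shows "W powr (2 * bump_exponent I) \<le> T" "T \<le> (1 + real CARD('l)) * W powr (2 * bump_exponent I)"
proof -
  have W2: "1 \<le> W\<^sup>2" using W by (rule one_le_power)
  have "(\<Sum>i\<in>UNIV. 1 / Re (bump_weight I W i)) = (\<Sum>i\<in>UNIV. if i \<in> I then 1 / W\<^sup>2 else 1)"
    by (intro sum.cong) (auto simp: bump_weight_def)
  then have T: "T = 1 + real (card I) + W\<^sup>2 * real (card (- I))"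
    using W by (simp add: T_def sum.If_cases distrib_left)
  have card: "real CARD('l) = real (card I) + real (card (- I))"
    using card_Un_disjoint[of I "- I"] by simp
  have "W powr (2 * bump_exponent I) \<le> T \<and> T \<le> (1 + real CARD('l)) * W powr (2 * bump_exponent I)"
  proof (cases "I = UNIV")
    case True
    then show ?thesis using W by (simp add: T bump_exponent_def)
  next
    case False
    then have "1 \<le> real (card (- I))" by (auto simp: Suc_le_eq card_gt_0_iff)
    then have "W\<^sup>2 * 1 \<le> W\<^sup>2 * real (card (- I))" by (intro mult_left_mono) auto
    moreover have "1 * real (card I) \<le> W\<^sup>2 * real (card I)" using W2 by (intro mult_right_mono) auto
    moreover have "(1 + real CARD('l)) * W\<^sup>2 = W\<^sup>2 + W\<^sup>2 * real (card I) + W\<^sup>2 * real (card (- I))"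
      by (simp add: card algebra_simps)
    ultimately have "W\<^sup>2 \<le> T \<and> T \<le> (1 + real CARD('l)) * W\<^sup>2" unfolding T using W2 by linarith
    then show ?thesis using False W by (simp add: bump_exponent_def)
  qed
  then show "W powr (2 * bump_exponent I) \<le> T" "T \<le> (1 + real CARD('l)) * W powr (2 * bump_exponent I)" by auto
qed

lemma dual_weight_bump_bounds:
  fixes I :: "'l::finite set"
  assumes W: "1 \<le> W"
  defines "\<beta> \<equiv> dual_weight (bump_weight I W)"
  shows "norm (1 + \<beta> * of_real (W\<^sup>2)) \<le> (1 + real CARD('l)) * W powr (2 * bump_exponent I)"
    and "Re (\<beta> / (1 + \<beta> * of_real (W\<^sup>2))) \<le> 1 / W\<^sup>2"
proof -
  define b where "b = (\<Sum>i\<in>UNIV. 1 / Re (bump_weight I W i)) / 2"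
  have \<beta>: "\<beta> = of_real b" by (simp add: \<beta>_def b_def dual_weight_def sum_divide_distrib mult.commute)
  have b: "0 \<le> b" using W by (auto simp: b_def bump_weight_def intro!: sum_nonneg)
  then have bW: "0 \<le> b * W\<^sup>2" by simp
  have denom: "1 + \<beta> * of_real (W\<^sup>2) = of_real (1 + b * W\<^sup>2)" by (simp add: \<beta>)
  have "norm (1 + \<beta> * of_real (W\<^sup>2)) \<le> 1 + W\<^sup>2 * (\<Sum>i\<in>UNIV. 1 / Re (bump_weight I W i))"
    unfolding denom norm_of_real using bW by (simp add: b_def mult.commute)
  also have "\<dots> \<le> (1 + real CARD('l)) * W powr (2 * bump_exponent I)"
    by (rule one_plus_sum_bump_weight_bounds(2)[OF W])
  finally show "norm (1 + \<beta> * of_real (W\<^sup>2)) \<le> (1 + real CARD('l)) * W powr (2 * bump_exponent I)" .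
  have "Re (\<beta> / (1 + \<beta> * of_real (W\<^sup>2))) = b / (1 + b * W\<^sup>2)"
    unfolding denom by (simp only: \<beta> of_real_divide[symmetric] Re_complex_of_real)
  also have "\<dots> \<le> 1 / W\<^sup>2"
  proof -
    have "0 < 1 + b * W\<^sup>2" "0 < W\<^sup>2" using W bW by (auto intro: add_pos_nonneg)
    then show ?thesis by (simp add: pos_divide_le_eq pos_le_divide_eq)
  qed
  finally show "Re (\<beta> / (1 + \<beta> * of_real (W\<^sup>2))) \<le> 1 / W\<^sup>2" .
qed

lemma Lp_norm_shell_gauss_bump_le:
  fixes a :: "real^'n^'l" and I :: "'l set"
  assumes W: "1 \<le> W" and u: "0 < u" and c: "1/4 \<le> c"
  shows "Lp_norm u (\<lambda>\<xi>. complex_of_real (shell_gauss (weight_form (bump_weight I W) (of_real (W\<^sup>2))) a c \<xi>))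
    \<le> ennreal ((4 ^ DIM(real^'n^'l) * ((u / 2) powr (- (real CARD('n) / 2))) ^ CARD('l)) powr (1 / u)
        * W powr (- (real CARD('n) * (real (card I) + bump_exponent I) / u)))"
proof -
  let ?n = "real CARD('n)" and ?w = "bump_weight I W" and ?\<theta> = "bump_exponent I"
  let ?T = "1 + W\<^sup>2 * (\<Sum>i\<in>UNIV. 1 / Re (?w i))"
    and ?K = "4 ^ DIM(real^'n^'l) * ((u / 2) powr (- (?n / 2))) ^ CARD('l)"
  have W0: "0 < W" using W by simp
  have "(u / 2 * Re (?w i)) powr (- (?n / 2))
      = (u / 2) powr (- (?n / 2)) * (if i \<in> I then W powr (- ?n) else 1)" for i
    using W0 power2_powr[of W "- (?n / 2)"] powr_mult[of "u / 2" "W\<^sup>2"] by (simp add: bump_weight_def)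
  then have prod: "(\<Prod>i\<in>UNIV. (u / 2 * Re (?w i)) powr (- (?n / 2)))
      = ((u / 2) powr (- (?n / 2))) ^ CARD('l) * W powr (- (?n * real (card I)))"
    using prod_if_powr[OF W0, of I "\<lambda>_. - ?n"]
    by (simp only: prod.distrib prod_constant sum_constant) (simp add: mult.commute)
  have "0 < W powr (2 * ?\<theta>)" using W0 by simp
  then have T: "?T powr (- (?n / 2)) \<le> W powr (- (?n * ?\<theta>))"
    using powr_mono2'[OF _ _ one_plus_sum_bump_weight_bounds(1)[OF W, of I], of "- (?n / 2)"]
    by (simp add: powr_powr mult_ac)
  have "Lp_norm u (\<lambda>\<xi>. complex_of_real (shell_gauss (weight_form ?w (of_real (W\<^sup>2))) a c \<xi>))
      \<le> ennreal ((4 ^ DIM(real^'n^'l)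
          * ((\<Prod>i\<in>UNIV. (u / 2 * Re (?w i)) powr (- (?n / 2))) * ?T powr (- (?n / 2)))) powr (1 / u))"
    using Lp_norm_shell_gauss_weight_form_le[OF u c, of ?w "of_real (W\<^sup>2)" a] W0 by (simp add: bump_weight_def)
  also have "\<dots> \<le> ennreal ((?K * W powr (- (?n * (real (card I) + ?\<theta>)))) powr (1 / u))"
  proof (intro ennreal_leI powr_mono2)
    have "4 ^ DIM(real^'n^'l) * ((\<Prod>i\<in>UNIV. (u / 2 * Re (?w i)) powr (- (?n / 2))) * ?T powr (- (?n / 2)))
        \<le> ?K * W powr (- (?n * real (card I))) * W powr (- (?n * ?\<theta>))"
      unfolding prod mult.assoc by (intro mult_left_mono T) auto
    then show "4 ^ DIM(real^'n^'l) * ((\<Prod>i\<in>UNIV. (u / 2 * Re (?w i)) powr (- (?n / 2))) * ?T powr (- (?n / 2)))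
        \<le> ?K * W powr (- (?n * (real (card I) + ?\<theta>)))"
      by (simp only: distrib_left minus_add_distrib powr_add mult.assoc)
  qed (use u in \<open>auto simp: prod_nonneg\<close>)
  finally show ?thesis
    by (simp only: powr_mult powr_powr mult_minus_left times_divide_eq_right mult_1_right minus_divide_left)
qed

lemma shell_norm_bump_le:
  fixes a :: "real^'n^'l" and I :: "'l set"
  assumes u: "0 < u" and a: "\<And>i. a $ i = e" "norm e = 1"
  obtains K where "0 \<le> K"
    "\<And>W. 1 \<le> W \<Longrightarrow> shell_norm u (weight_form (bump_weight I W) (of_real (W\<^sup>2))) a
      \<le> ennreal (K * W powr (- (real CARD('n) * (real (card I) + bump_exponent I) / u)))"
proof -
  define \<mu> where "\<mu> = real CARD('n) * (real (card I) + bump_exponent I) / u"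
  define K where "K = (4 ^ DIM(real^'n^'l) * ((u / 2) powr (- (real CARD('n) / 2))) ^ CARD('l)) powr (1 / u)"
  define L where "L = (4 * \<mu>) powr (\<mu> / 2) * measure lborel (cball (0 :: real^'n^'l) 2) powr (1 / u)"
  have "0 < real (card I) + bump_exponent I" by (auto simp: bump_exponent_def add_nonneg_pos)
  then have \<mu>: "0 < \<mu>" using u by (simp add: \<mu>_def)
  show thesis
  proof
    show "0 \<le> max K L" by (simp add: K_def le_max_iff_disj)
    fix W :: real assume W: "1 \<le> W"
    have L: "exp (- (W\<^sup>2 / 8)) * measure lborel (cball (0 :: real^'n^'l) 2) powr (1 / u) \<le> L * W powr (- \<mu>)"
      using mult_right_mono[OF exp_neg_square_le[OF \<mu>, of W],
          of "measure lborel (cball (0 :: real^'n^'l) 2) powr (1 / u)"] W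
      by (simp add: L_def mult_ac)
    have "Lp_norm u (\<lambda>\<xi>. complex_of_real (shell_gauss (weight_form (bump_weight I W) (of_real (W\<^sup>2))) a (2 powr real_of_int k) \<xi>))
        \<le> ennreal (max K L * W powr (- \<mu>))" for k :: int
    proof (cases "1/4 \<le> 2 powr real_of_int k")
      case True
      then have "Lp_norm u (\<lambda>\<xi>. complex_of_real (shell_gauss (weight_form (bump_weight I W) (of_real (W\<^sup>2))) a (2 powr real_of_int k) \<xi>))
          \<le> ennreal (K * W powr (- \<mu>))"
        unfolding K_def \<mu>_def by (rule Lp_norm_shell_gauss_bump_le[OF W u])
      then show ?thesis by (rule order_trans) (intro ennreal_leI mult_right_mono, auto)
    next
      case False
      then have "Lp_norm u (\<lambda>\<xi>. complex_of_real (shell_gauss (weight_form (bump_weight I W) (of_real (W\<^sup>2))) a (2 powr real_of_int k) \<xi>))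
          \<le> ennreal (exp (- (W\<^sup>2 / 8)) * measure lborel (cball (0 :: real^'n^'l) 2) powr (1 / u))"
        using Lp_norm_shell_gauss_diagonal_le[OF u _ _ _ _ a, of "2 powr real_of_int k" "bump_weight I W"
            "of_real (W\<^sup>2)"] W
        by (simp add: bump_weight_def)
      also have "\<dots> \<le> ennreal (max K L * W powr (- \<mu>))"
        by (intro ennreal_leI order_trans[OF L] mult_right_mono) auto
      finally show ?thesis .
    qed
    then show "shell_norm u (weight_form (bump_weight I W) (of_real (W\<^sup>2))) a
        \<le> ennreal (max K L * W powr (- (real CARD('n) * (real (card I) + bump_exponent I) / u)))"
      unfolding shell_norm_def \<mu>_def by (intro SUP_least)
  qed
qed

section \<open>Testing the multiplier inequality\<close>

lemma dual_weight_pos: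
  assumes w: "\<And>i. 0 < Re (w i)" and v: "0 < Re v"
  shows "0 < Re (dual_weight w)" "0 < Re (1 + dual_weight w * v)"
    "0 < Re (dual_weight w / (1 + dual_weight w * v))"
proof -
  show \<beta>: "0 < Re (dual_weight w)"
    unfolding dual_weight_def Re_complex_of_real using w by (intro sum_pos) auto
  have Re_mult: "Re (dual_weight w * z) = Re (dual_weight w) * Re z" for z by (simp add: dual_weight_def)
  show denom: "0 < Re (1 + dual_weight w * v)"
    unfolding plus_complex.sel one_complex.sel Re_mult using \<beta> v by (simp add: add_pos_pos)
  show "0 < Re (dual_weight w / (1 + dual_weight w * v))"
    using Re_mult[of "1 / (1 + dual_weight w * v)"] \<beta> Re_inverse_pos[OF denom] by simp
qed

lemma Lp_norm_modulated_gauss: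
  assumes w: "0 < Re w" and r: "0 < r"
  shows "Lp_norm r (modulated_gauss a (1 / cnj w) :: real^'n \<Rightarrow> complex)
    = ennreal (r powr (- (real CARD('n) / (2 * r))) * ((norm w)\<^sup>2 / Re w) powr (real CARD('n) / (2 * r)))"
proof -
  have w': "0 < Re (1 / cnj w)" using w by (intro Re_inverse_pos) simp
  have "Re (1 / cnj w) = inverse ((norm w)\<^sup>2 / Re w)" using w by (simp add: Re_divide cmod_power2)
  then have "(r * Re (1 / cnj w)) powr (- (real CARD('n) / (2 * r)))
      = r powr (- (real CARD('n) / (2 * r))) * ((norm w)\<^sup>2 / Re w) powr (real CARD('n) / (2 * r))"
    unfolding powr_mult by (simp only: powr_minus inverse_powr inverse_inverse_eq)
  then show ?thesis
    using Lp_norm_gauss[OF w' r, where ?'a="real^'n"] by (simp add: Lp_norm_def norm_modulated_gauss)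
qed

definition gauss_input :: "real \<Rightarrow> ('l \<Rightarrow> real) \<Rightarrow> ('l::finite \<Rightarrow> complex) \<Rightarrow> real"
  where "gauss_input n p w = (\<Prod>i\<in>UNIV. ((norm (w i))\<^sup>2 / Re (w i)) powr (n / (2 * p i)))"

definition gauss_output :: "real \<Rightarrow> real \<Rightarrow> ('l::finite \<Rightarrow> complex) \<Rightarrow> complex \<Rightarrow> real"
  where "gauss_output n q w v = (\<Prod>i\<in>UNIV. (norm (w i) / (2 * Re (w i))) powr (n / 2))
    * norm (1 + dual_weight w * v) powr (- (n / 2))
        * Re (dual_weight w / (1 + dual_weight w * v)) powr (- (n / (2 * q)))"

lemma gauss_input_nonneg: "0 \<le> gauss_input n p w"
  unfolding gauss_input_def by (intro prod_nonneg) auto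

lemma gauss_output_nonneg: "0 \<le> gauss_output n q w v"
  unfolding gauss_output_def by (intro mult_nonneg_nonneg prod_nonneg) auto

lemma prod_Lp_norm_modulated_gauss:
  fixes a :: "real^'n^'l"
  assumes w: "\<And>i. 0 < Re (w i)" and p: "\<And>i. 0 < p i"
  shows "(\<Prod>i\<in>UNIV. Lp_norm (p i) (modulated_gauss (a $ i) (1 / cnj (w i)) :: real^'n \<Rightarrow> complex))
    = ennreal ((\<Prod>i\<in>UNIV. p i powr (- (real CARD('n) / (2 * p i)))) * gauss_input (real CARD('n)) p w)"
  by (simp only: Lp_norm_modulated_gauss[OF w p] prod_ennreal mult_nonneg_nonneg powr_ge_zero prod.distrib
      gauss_input_def)

lemma Lp_norm_T_mult_form_gauss:
  fixes a :: "real^'n^'l"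
  assumes q: "0 < q" and w: "\<And>i. 0 < Re (w i)" and v: "0 < Re v"
  shows "Lp_norm q (T_mult (form_gauss (weight_form w v) a) (\<lambda>i. modulated_gauss (a $ i) (1 / cnj (w i))) :: real^'n \<Rightarrow> complex)
    = ennreal (q powr (- (real CARD('n) / (2 * q))) * gauss_output (real CARD('n)) q w v)"
proof -
  let ?\<omega> = "dual_weight w / (1 + dual_weight w * v)"
  let ?K = "(\<Prod>i\<in>UNIV. (norm (w i) / (2 * Re (w i))) powr (real CARD('n) / 2))
      * norm (1 + dual_weight w * v) powr (- (real CARD('n) / 2))"
  have K: "0 \<le> ?K" by (intro mult_nonneg_nonneg prod_nonneg) auto
  have "Lp_norm q (T_mult (form_gauss (weight_form w v) a) (\<lambda>i. modulated_gauss (a $ i) (1 / cnj (w i))) :: real^'n \<Rightarrow> complex)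
      = Lp_norm q (\<lambda>x. of_real ?K * gauss ?\<omega> (x :: real^'n))"
    using K norm_T_mult_form_gauss[OF w v, where a=a]
    by (simp add: Lp_norm_def norm_mult del: of_real_mult of_real_prod)
  also have "\<dots> = ennreal ?K * Lp_norm q (gauss ?\<omega> :: real^'n \<Rightarrow> complex)"
    using K q by (subst Lp_norm_cmult) (auto simp del: of_real_mult of_real_prod)
  also have "\<dots> = ennreal (?K * (q * Re ?\<omega>) powr (- (real CARD('n) / (2 * q))))"
    using K Lp_norm_gauss[OF dual_weight_pos(3)[where w=w, OF w v] q, where ?'a="real^'n"]
    by (simp add: ennreal_mult)
  finally show ?thesis by (simp only: powr_mult gauss_output_def mult_ac)
qed

lemma gauss_input_two_weights:
  assumes W: "0 < W" and width: "\<And>i. (norm (w i))\<^sup>2 / Re (w i) = (if i \<in> I then W\<^sup>2 else 1)"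
  shows "gauss_input n p w = W powr (n * (\<Sum>i\<in>I. 1 / p i))"
proof -
  have "((norm (w i))\<^sup>2 / Re (w i)) powr (n / (2 * p i)) = (if i \<in> I then W powr (n / p i) else 1)" for i
    using W unfolding width by (simp add: power2_powr)
  then show ?thesis
    unfolding gauss_input_def using prod_if_powr[OF W, of I] by (simp add: sum_distrib_left)
qed

lemma gauss_output_two_weights_ge:
  fixes w :: "'l::finite \<Rightarrow> complex"
  assumes W: "0 < W" and n: "0 \<le> n" and q: "0 < q" and w: "\<And>i. 0 < Re (w i)" and v: "0 < Re v"
    and ratio: "\<And>i. norm (w i) / Re (w i) = (if i \<in> I then W powr \<gamma> else 1)"
    and denom: "norm (1 + dual_weight w * v) \<le> A * W powr (2 * \<theta>)"
    and decay: "Re (dual_weight w / (1 + dual_weight w * v)) \<le> B / W\<^sup>2"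
  shows "((1/2) powr (n / 2)) ^ CARD('l) * A powr (- (n / 2)) * B powr (- (n / (2 * q)))
      * W powr (n * (\<gamma> * real (card I) / 2 - \<theta> + 1 / q)) \<le> gauss_output n q w v"
proof -
  have "(norm (w i) / (2 * Re (w i))) powr (n / 2)
      = (1/2) powr (n / 2) * (if i \<in> I then W powr (\<gamma> * n / 2) else 1)" for i
  proof -
    have "norm (w i) / (2 * Re (w i)) = 1/2 * (norm (w i) / Re (w i))" by simp
    then show ?thesis by (simp only: ratio powr_mult) (simp add: powr_powr)
  qed
  then have ratios: "(\<Prod>i\<in>UNIV. (norm (w i) / (2 * Re (w i))) powr (n / 2))
      = ((1/2) powr (n / 2)) ^ CARD('l) * W powr (n * \<gamma> * real (card I) / 2)"
    using prod_if_powr[OF W, of I "\<lambda>_. \<gamma> * n / 2"]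
    by (simp only: prod.distrib prod_constant sum_constant) (simp add: mult_ac)
  have "0 < norm (1 + dual_weight w * v)"
    using dual_weight_pos(2)[where w=w, OF w v] complex_Re_le_cmod less_le_trans by blast
  then have denominator: "A powr (- (n / 2)) * W powr (- (n * \<theta>)) \<le> norm (1 + dual_weight w * v) powr (- (n / 2))"
    using powr_mono2'[OF _ _ denom, of "- (n / 2)"] n by (simp add: powr_mult powr_powr mult_ac)
  have "B powr (- (n / (2 * q))) * W powr (n / q) = (B / W\<^sup>2) powr (- (n / (2 * q)))"
    using W by (simp add: powr_divide power2_powr powr_minus field_simps)
  then have width: "B powr (- (n / (2 * q))) * W powr (n / q)
      \<le> Re (dual_weight w / (1 + dual_weight w * v)) powr (- (n / (2 * q)))"
    using powr_mono2'[OF _ dual_weight_pos(3)[where w=w, OF w v] decay, of "- (n / (2 * q))"] q n by simp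
  have "n * (\<gamma> * real (card I) / 2 - \<theta> + 1 / q) = n * \<gamma> * real (card I) / 2 + - (n * \<theta>) + n / q"
    by (simp add: algebra_simps)
  then have "((1/2) powr (n / 2)) ^ CARD('l) * A powr (- (n / 2)) * B powr (- (n / (2 * q)))
      * W powr (n * (\<gamma> * real (card I) / 2 - \<theta> + 1 / q))
      = ((1/2) powr (n / 2)) ^ CARD('l) * W powr (n * \<gamma> * real (card I) / 2)
        * (A powr (- (n / 2)) * W powr (- (n * \<theta>))) * (B powr (- (n / (2 * q))) * W powr (n / q))"
    by (simp only: powr_add mult_ac)
  also have "\<dots> \<le> gauss_output n q w v"
    unfolding gauss_output_def ratios by (intro mult_mono denominator width order_refl mult_nonneg_nonneg) auto
  finally show ?thesis .
qed

lemma Re_divide_one_plus_le: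
  assumes \<beta>: "0 < \<beta>" and z: "Re z = 1"
  shows "Re (of_real \<beta> / (1 + of_real \<beta> * z)) \<le> (1 + \<beta>) / \<beta> / (norm z)\<^sup>2"
proof -
  have z_pos: "0 < \<beta>\<^sup>2 * (norm z)\<^sup>2" using \<beta> z by (auto simp: complex_eq_iff)
  have "\<beta>\<^sup>2 * (norm z)\<^sup>2 \<le> (norm (1 + of_real \<beta> * z))\<^sup>2"
    using \<beta> z unfolding cmod_power2 by (simp add: power2_eq_square algebra_simps)
  then have "\<beta> * (1 + \<beta>) / (norm (1 + of_real \<beta> * z))\<^sup>2 \<le> \<beta> * (1 + \<beta>) / (\<beta>\<^sup>2 * (norm z)\<^sup>2)"
    using \<beta> z_pos by (intro divide_left_mono mult_pos_pos) auto
  also have "\<dots> = (1 + \<beta>) / \<beta> / (norm z)\<^sup>2"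
    using \<beta> by (simp add: power2_eq_square)
  finally show ?thesis
    using z by (simp add: Re_divide cmod_power2)
qed

locale bounded_multipliers =
  fixes \<Theta> :: "real^'n^'l \<Rightarrow> complex" and p :: "'l \<Rightarrow> real" and q u s C :: real
  assumes \<Theta>: "schwartz \<Theta>"
    and \<Theta>_supp: "\<forall>\<xi>. FT \<Theta> \<xi> \<noteq> 0 \<longrightarrow> 1/2 \<le> norm \<xi> \<and> norm \<xi> \<le> 2"
    and p: "\<forall>i. 1 < p i"
    and q: "1 / q = (\<Sum>i\<in>UNIV. 1 / p i)"
    and u: "1 < u"
    and s: "0 < s"
    and bound: "\<forall>m :: real^'n^'l \<Rightarrow> complex.
         m \<in> borel_measurable lborel \<and> bounded (range m) \<and> A_norm \<Theta> u s m < top \<longrightarrow>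
         (\<forall>f :: 'l \<Rightarrow> real^'n \<Rightarrow> complex. (\<forall>i. schwartz (f i)) \<longrightarrow>
            Lp_norm q (T_mult m f) \<le> ennreal C * A_norm \<Theta> u s m * (\<Prod>i\<in>UNIV. Lp_norm (p i) (f i)))"
begin

lemma p_pos: "0 < p i"
  using p by (meson less_trans zero_less_one)

lemma q_pos: "0 < q"
proof -
  have "0 < (\<Sum>i\<in>UNIV. 1 / p i)" using p_pos by (intro sum_pos) auto
  then show ?thesis by (simp flip: q)
qed

lemma T_mult_form_gauss_le:
  fixes a :: "real^'n^'l"
  obtains D where "0 \<le> D"
    "\<And>W B (f :: 'l \<Rightarrow> real^'n \<Rightarrow> complex). sectorial_form W B \<Longrightarrow> (\<And>i. schwartz (f i)) \<Longrightarrow>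
      Lp_norm q (T_mult (form_gauss B a) f)
          \<le> ennreal (D * W powr s) * shell_norm u B a * (\<Prod>i\<in>UNIV. Lp_norm (p i) (f i))"
proof -
  have supp: "FT \<Theta> \<xi> = 0" if "\<xi> \<notin> annulus" for \<xi>
    using \<Theta>_supp that by (auto simp: annulus_def)
  obtain D where D: "0 \<le> D"
    "\<And>W (B :: real^'n^'l \<Rightarrow> real^'n^'l \<Rightarrow> complex). sectorial_form W B
        \<Longrightarrow> A_norm \<Theta> u s (form_gauss B a) \<le> ennreal (D * W powr s) * shell_norm u B a"
    using A_norm_form_gauss_le[OF schwartz_imp_rapid_decay[OF \<Theta>] supp less_imp_le[OF u] less_imp_le[OF s]] by blast
  show thesis
  proof
    show "0 \<le> max C 0 * D" using D(1) by simp
    fix W and B :: "real^'n^'l \<Rightarrow> real^'n^'l \<Rightarrow> complex" and f :: "'l \<Rightarrow> real^'n \<Rightarrow> complex"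
    assume B: "sectorial_form W B" and f: "\<And>i. schwartz (f i)"
    have "shell_norm u B a < top"
      using order_le_less_trans[OF shell_norm_le_const[OF B] ennreal_less_top] u by simp
    then have fin: "A_norm \<Theta> u s (form_gauss B a) < top"
      using D(2)[OF B] by (auto simp: ennreal_mult_less_top elim!: order_le_less_trans)
    have meas: "form_gauss B a \<in> borel_measurable lborel"
      using form_gauss_measurable[OF B, of a 1] by simp
    have "norm (form_gauss B a \<xi>) \<le> 1" for \<xi>
      using sectorial_formD(5)[OF B] by (simp add: norm_form_gauss)
    then have "bounded (range (form_gauss B a))" by (auto simp: bounded_iff)
    then have "Lp_norm q (T_mult (form_gauss B a) f)
        \<le> ennreal C * A_norm \<Theta> u s (form_gauss B a) * (\<Prod>i\<in>UNIV. Lp_norm (p i) (f i))"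
      using bound f fin meas by blast
    also have "\<dots> \<le> ennreal (max C 0) * (ennreal (D * W powr s) * shell_norm u B a)
        * (\<Prod>i\<in>UNIV. Lp_norm (p i) (f i))"
      by (intro mult_right_mono mult_mono D(2)[OF B] ennreal_leI) auto
    finally show "Lp_norm q (T_mult (form_gauss B a) f)
        \<le> ennreal (max C 0 * D * W powr s) * shell_norm u B a * (\<Prod>i\<in>UNIV. Lp_norm (p i) (f i))"
      using D(1) by (simp add: ennreal_mult mult.assoc)
  qed
qed

lemma gauss_output_le:
  fixes a :: "real^'n^'l"
  obtains D where "0 \<le> D"
    "\<And>W w v. 1 \<le> W \<Longrightarrow> (\<And>i. sector_weight W (w i)) \<Longrightarrow> sector_weight W v \<Longrightarrow>
      ennreal (gauss_output (real CARD('n)) q w v)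
        \<le> ennreal (D * W powr s * gauss_input (real CARD('n)) p w) * shell_norm u (weight_form w v) a"
proof -
  let ?n = "real CARD('n)" and ?R = "2 * pi * real CARD('l)"
  obtain D where D: "0 \<le> D" "\<And>W B (f :: 'l \<Rightarrow> real^'n \<Rightarrow> complex). sectorial_form W B \<Longrightarrow> (\<And>i. schwartz (f i)) \<Longrightarrow>
      Lp_norm q (T_mult (form_gauss B a) f)
          \<le> ennreal (D * W powr s) * shell_norm u B a * (\<Prod>i\<in>UNIV. Lp_norm (p i) (f i))"
    by (rule T_mult_form_gauss_le[of a]) blast
  define e where "e = ?n / (2 * q)"
  define P where "P = (\<Prod>i\<in>UNIV. p i powr (- (?n / (2 * p i))))"
  have P: "0 \<le> P" unfolding P_def by (intro prod_nonneg) auto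
  show thesis
  proof
    show "0 \<le> q powr e * D * ?R powr s * P" using D(1) P by simp
    fix W v and w :: "'l \<Rightarrow> complex"
    assume W: "1 \<le> W" and w: "\<And>i. sector_weight W (w i)" and v: "sector_weight W v"
    let ?B = "weight_form w v :: real^'n^'l \<Rightarrow> real^'n^'l \<Rightarrow> complex"
      and ?f = "\<lambda>i. modulated_gauss (a $ i) (1 / cnj (w i))"
    note w_pos = sector_weight_Re_pos[OF w] and v_pos = sector_weight_Re_pos[OF v]
    have f: "schwartz (?f i)" for i
      using Re_inverse_pos[of "cnj (w i)"] w_pos[of i] by (intro schwartz_modulated_gauss) simp
    have "ennreal (gauss_output ?n q w v) = ennreal (q powr e) * Lp_norm q (T_mult (form_gauss ?B a) ?f)"
      unfolding Lp_norm_T_mult_form_gauss[where w=w, OF q_pos w_pos v_pos]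
      using q_pos gauss_output_nonneg[of ?n q w v] by (simp add: e_def powr_minus flip: ennreal_mult)
    also have "\<dots> \<le> ennreal (q powr e)
        * (ennreal (D * (?R * W) powr s) * shell_norm u ?B a * ennreal (P * gauss_input ?n p w))"
      using D(2)[OF sectorial_weight_form[where w=w, OF W w v], of ?f] f
      unfolding prod_Lp_norm_modulated_gauss[where w=w and p=p, OF w_pos p_pos] P_def
      by (intro mult_left_mono) auto
    also have "\<dots> = ennreal (q powr e * D * ?R powr s * P * W powr s * gauss_input ?n p w) * shell_norm u ?B a"
      using D(1) P gauss_input_nonneg[of ?n p w] by (simp add: ennreal_mult powr_mult mult_ac)
    finally show "ennreal (gauss_output ?n q w v)
        \<le> ennreal (q powr e * D * ?R powr s * P * W powr s * gauss_input ?n p w) * shell_norm u ?B a" .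
  qed
qed

lemma exponent_condition:
  fixes w :: "real \<Rightarrow> 'l \<Rightarrow> complex" and v :: "real \<Rightarrow> complex" and I :: "'l set" and a :: "real^'n^'l"
  assumes w: "\<And>W i. 1 \<le> W \<Longrightarrow> sector_weight W (w W i)" and v: "\<And>W. 1 \<le> W \<Longrightarrow> sector_weight W (v W)"
    and ratio: "\<And>W i. 1 \<le> W \<Longrightarrow> norm (w W i) / Re (w W i) = (if i \<in> I then W powr \<gamma> else 1)"
    and width: "\<And>W i. 1 \<le> W \<Longrightarrow> (norm (w W i))\<^sup>2 / Re (w W i) = (if i \<in> I then W\<^sup>2 else 1)"
    and denom: "\<And>W. 1 \<le> W \<Longrightarrow> norm (1 + dual_weight (w W) * v W) \<le> A * W powr (2 * \<theta>)" and A: "0 < A"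
    and decay: "\<And>W. 1 \<le> W \<Longrightarrow> Re (dual_weight (w W) / (1 + dual_weight (w W) * v W)) \<le> B / W\<^sup>2" and B: "0 < B"
    and shell: "\<And>W. 1 \<le> W \<Longrightarrow> shell_norm u (weight_form (w W) (v W)) a \<le> ennreal (K * W powr (- \<mu>))" and K: "0 \<le> K"
  shows "real CARD('n) * (\<gamma> * real (card I) / 2 - \<theta> + 1 / q - (\<Sum>i\<in>I. 1 / p i)) + \<mu> \<le> s"
proof -
  let ?n = "real CARD('n)"
  obtain D where D: "0 \<le> D" "\<And>W w v. 1 \<le> W \<Longrightarrow> (\<And>i. sector_weight W (w i)) \<Longrightarrow> sector_weight W v \<Longrightarrow>
      ennreal (gauss_output ?n q w v)
          \<le> ennreal (D * W powr s * gauss_input ?n p w) * shell_norm u (weight_form w v) a"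
    by (rule gauss_output_le[of a]) blast
  define c where "c = ((1/2) powr (?n / 2)) ^ CARD('l) * A powr (- (?n / 2)) * B powr (- (?n / (2 * q)))"
  have c: "0 < c" using A B by (simp add: c_def)
  have "c * W powr (?n * (\<gamma> * real (card I) / 2 - \<theta> + 1 / q)) \<le> (D * K) * W powr (s + ?n * (\<Sum>i\<in>I. 1 / p i) - \<mu>)"
    if W: "1 \<le> W" for W
  proof -
    have W0: "0 < W" using W by simp
    have "c * W powr (?n * (\<gamma> * real (card I) / 2 - \<theta> + 1 / q)) \<le> gauss_output ?n q (w W) (v W)"
      unfolding c_def using W0 q_pos sector_weight_Re_pos[OF w[OF W]] sector_weight_Re_pos[OF v[OF W]] ratio[OF W]
          denom[OF W] decay[OF W]
      by (intro gauss_output_two_weights_ge) auto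
    then have "ennreal (c * W powr (?n * (\<gamma> * real (card I) / 2 - \<theta> + 1 / q)))
        \<le> ennreal (gauss_output ?n q (w W) (v W))"
      by (rule ennreal_leI)
    also have "\<dots> \<le> ennreal (D * W powr s * gauss_input ?n p (w W)) * shell_norm u (weight_form (w W) (v W)) a"
      by (rule D(2)[OF W w[OF W] v[OF W]])
    also have "\<dots> \<le> ennreal (D * W powr s * gauss_input ?n p (w W)) * ennreal (K * W powr (- \<mu>))"
      by (intro mult_left_mono shell W) simp
    also have "\<dots> = ennreal ((D * K) * W powr (s + ?n * (\<Sum>i\<in>I. 1 / p i) - \<mu>))"
      using D(1) K by (simp add: gauss_input_two_weights[where w="w W", OF W0 width[OF W]] powr_add powr_diff
          powr_minus divide_inverse mult_ac flip: ennreal_mult)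
    finally show ?thesis
      using D(1) K by (subst (asm) ennreal_le_iff) auto
  qed
  from exponent_le_of_powr_le[OF c this] show ?thesis by (simp add: algebra_simps)
qed

lemma chirp_condition: "1 / q - 1/2 - (\<Sum>i\<in>I. 1 / p i - 1/2) \<le> s / real CARD('n)"
proof -
  define z where "z W = Complex 1 (sqrt (W\<^sup>2 - 1))" for W
  define w where "w W i = (if i \<in> I then z W else 1)" for W and i :: 'l
  let ?\<beta> = "real CARD('l) / 2" and ?V = "measure lborel (cball (0 :: real^'n^'l) 2) powr (1 / u)"
  have z: "Re (z W) = 1" "norm (z W) = W" if "1 \<le> W" for W
    using that by (auto simp: z_def cmod_def)
  have sector: "sector_weight W (z W)" "sector_weight W (w W i)" if "1 \<le> W" for W i
    using that one_le_power[OF that, of 2] by (auto simp: sector_weight_def w_def z)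
  have \<beta>: "dual_weight (w W) = of_real ?\<beta>" if "1 \<le> W" for W
    using that by (simp add: dual_weight_def w_def z if_distrib[of Re] cong: if_cong)
  have "real CARD('n) * (1 * real (card I) / 2 - 1/2 + 1 / q - (\<Sum>i\<in>I. 1 / p i)) + 0 \<le> s"
  proof (rule exponent_condition[where w=w and v=z and I=I and a=0])
    fix W :: real assume W: "1 \<le> W"
    note z = z[OF W] and \<beta> = \<beta>[OF W]
    show "sector_weight W (z W)" "sector_weight W (w W i)" for i by (rule sector[OF W])+
    show "norm (w W i) / Re (w W i) = (if i \<in> I then W powr 1 else 1)"
      "(norm (w W i))\<^sup>2 / Re (w W i) = (if i \<in> I then W\<^sup>2 else 1)" for i
      using W by (auto simp: w_def z)
    have "norm (1 + dual_weight (w W) * z W) \<le> 1 + ?\<beta> * W"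
      using norm_triangle_ineq[of 1 "of_real ?\<beta> * z W"] by (simp add: \<beta> norm_mult z)
    then show "norm (1 + dual_weight (w W) * z W) \<le> (1 + ?\<beta>) * W powr (2 * (1/2))"
      using W by (simp add: algebra_simps)
    show "Re (dual_weight (w W) / (1 + dual_weight (w W) * z W)) \<le> (1 + ?\<beta>) / ?\<beta> / W\<^sup>2"
      using Re_divide_one_plus_le[of ?\<beta> "z W"] by (simp only: \<beta> z) simp
    show "shell_norm u (weight_form (w W) (z W)) (0 :: real^'n^'l) \<le> ennreal (?V * W powr (- 0))"
      using shell_norm_le_const[OF sectorial_weight_form[where w="w W", OF W sector(2)[OF W] sector(1)[OF W]],
          where u=u and a="0 :: real^'n^'l"] u W by simp
  qed (simp_all add: add_pos_pos)
  then have "real CARD('n) * (1 / q - 1/2 - (\<Sum>i\<in>I. 1 / p i - 1/2)) \<le> s"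
    by (simp add: sum_subtractf algebra_simps)
  then show ?thesis by (simp add: pos_le_divide_eq mult.commute)
qed

lemma bump_condition:
  fixes I :: "'l set"
  shows "1 / q - bump_exponent I + (real (card I) + bump_exponent I) / u - (\<Sum>i\<in>I. 1 / p i) \<le> s / real CARD('n)"
proof -
  let ?\<theta> = "bump_exponent I" and ?w = "bump_weight I" and ?v = "\<lambda>W. complex_of_real (W\<^sup>2)"
  obtain e :: "real^'n" where e: "norm e = 1" using norm_Basis nonempty_Basis by blast
  define a :: "real^'n^'l" where "a = (\<chi> i. e)"
  obtain K where K: "0 \<le> K" "\<And>W. 1 \<le> W \<Longrightarrow> shell_norm u (weight_form (?w W) (?v W)) a
      \<le> ennreal (K * W powr (- (real CARD('n) * (real (card I) + ?\<theta>) / u)))"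
    using shell_norm_bump_le[of u a e I] u e by (auto simp: a_def)
  have "real CARD('n) * (0 * real (card I) / 2 - ?\<theta> + 1 / q - (\<Sum>i\<in>I. 1 / p i))
      + real CARD('n) * (real (card I) + ?\<theta>) / u \<le> s"
  proof (rule exponent_condition[where w="?w" and v="?v" and I=I and a=a and A="1 + real CARD('l)" and B=1])
    fix W :: real assume W: "1 \<le> W"
    then have W2: "1 \<le> W\<^sup>2" by (rule one_le_power)
    show "sector_weight W (?v W)" "sector_weight W (?w W i)" for i
      using W2 by (auto simp: sector_weight_def bump_weight_def power2_eq_square[of "W\<^sup>2"] simp del: of_real_power)
    show "norm (?w W i) / Re (?w W i) = (if i \<in> I then W powr 0 else 1)"
      "(norm (?w W i))\<^sup>2 / Re (?w W i) = (if i \<in> I then W\<^sup>2 else 1)" for i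
      using W by (auto simp: bump_weight_def divide_simps simp del: of_real_power simp flip: power_add)
  qed (use K dual_weight_bump_bounds in auto)
  then have "real CARD('n) * (1 / q - ?\<theta> + (real (card I) + ?\<theta>) / u - (\<Sum>i\<in>I. 1 / p i)) \<le> s"
    by (simp add: algebra_simps)
  then show ?thesis by (simp add: pos_le_divide_eq mult.commute)
qed

lemma dimension_condition: "real CARD('l) / u \<le> s / real CARD('n)"
  using bump_condition[of UNIV] by (simp add: bump_exponent_def q)

lemma conjugate_exponent_condition:
  fixes I :: "'l set"
  assumes u': "1 / u + 1 / u' = 1"
  shows "1 / q - 1 / u' - (\<Sum>i\<in>I. 1 / p i - 1 / u) \<le> s / real CARD('n)"
proof (cases "I = UNIV")
  case True
  have "1 / u < 1" using u by simp
  then have "0 \<le> 1 / u'" using u' by linarith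
  moreover have "1 / q - 1 / u' - (\<Sum>i\<in>I. 1 / p i - 1 / u) = real CARD('l) / u - 1 / u'"
    by (simp add: True sum_subtractf q)
  ultimately show ?thesis using dimension_condition by linarith
next
  case False
  have "1 / q - 1 / u' - (\<Sum>i\<in>I. 1 / p i - 1 / u) = 1 / q - 1 + (real (card I) + 1) / u - (\<Sum>i\<in>I. 1 / p i)"
    using u' by (simp add: sum_subtractf add_divide_distrib)
  then show ?thesis using bump_condition[of I] False by (simp only: bump_exponent_def if_False)
qed

end

theorem theorem6p1:
  fixes \<Theta> :: "real^'n^'l \<Rightarrow> complex"
    and p :: "'l \<Rightarrow> real" and pp u u' s C :: real
  assumes Theta_schwartz: "schwartz \<Theta>"
    and Theta_supp: "\<forall>\<xi>. FT \<Theta> \<xi> \<noteq> 0 \<longrightarrow> 1/2 \<le> norm \<xi> \<and> norm \<xi> \<le> 2"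
    and p_range: "\<forall>i. 1 < p i"
    and pp_def: "1 / pp = (\<Sum>i\<in>UNIV. 1 / p i)"
    and u_range: "1 < u"
    and u'_def: "1 / u + 1 / u' = 1"
    and s_pos: "0 < s"
    and bounded: "\<forall>m :: real^'n^'l \<Rightarrow> complex.
         m \<in> borel_measurable lborel \<and> bounded (range m) \<and> A_norm \<Theta> u s m < top \<longrightarrow>
         (\<forall>f :: 'l \<Rightarrow> real^'n \<Rightarrow> complex. (\<forall>i. schwartz (f i)) \<longrightarrow>
            Lp_norm pp (T_mult m f) \<le> ennreal C * A_norm \<Theta> u s m * (\<Prod>i\<in>UNIV. Lp_norm (p i) (f i)))"
  shows "s / real CARD('n) \<ge>
           max (real CARD('l) / u)
             (max (Max ((\<lambda>I. 1 / pp - 1/2 - (\<Sum>i\<in>I. 1 / p i - 1/2)) ` Pow UNIV))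
                  (Max ((\<lambda>I. 1 / pp - 1 / u' - (\<Sum>i\<in>I. 1 / p i - 1 / u)) ` Pow UNIV)))"
proof -
  interpret bounded_multipliers \<Theta> p pp u s C
    using assms by unfold_locales
  show ?thesis
    using dimension_condition chirp_condition conjugate_exponent_condition[OF u'_def]
    by (auto intro!: max.boundedI simp: Max_le_iff)
qed

end
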